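(* Let $\Gamma\curvearrowright\Omega$ be an action with invariant measure $\mu$ as described in the context, and assume that the action is paradoxical and expanding. Let $A\in\mathcal{B}_\mu\cap\mathcal{C}$. Then the following statements hold. (i) A subset $B\subseteq\Omega$ is essentially Borel equidecomposable to $A$ if and only if $B\in\mathcal{B}_\mu$, $\mu(B)=\mu(A)$ and there is a null set $N$ with $B\bigtriangleup N\in\mathcal{C}$. (ii) A subset $B\subseteq\Omega$ is measurably equidecomposable to $A$ if and only if $B\in\mathcal{B}_\mu\cap\mathcal{C}$ and $\mu(B)=\mu(A)$. (iii) Suppose additionally that $A$ has the property of Baire and that the action preserves the family of meager sets. Then a subset $B\subseteq\Omega$ is Baire-Lebesgue equidecomposable to $A$ if and only if $B\in\mathcal{B}_\mu\cap\mathcal{C}\cap\mathcal{T}$ and $\mu(B)=\mu(A)$.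
   Context: Setting: $\Gamma$ is a group, $(\Omega,\tau)$ is a Polish topological space with Borel $\sigma$-algebra $\mathcal{B}$, and $a:\Gamma\curvearrowright\Omega$ is a left action by Borel automorphisms. $\mu$ is a $\sigma$-finite measure on $(\Omega,\mathcal{B})$ which is non-zero on all non-empty open sets, and the action preserves $\mu$. Write $\gamma.U=\{\gamma.u: u\in U\}$ and $T.U=\bigcup_{\gamma\in T}\gamma.U$. $\mathcal{B}_\mu$ is the completion of $\mathcal{B}$ with respect to $\mu$; its elements are called measurable. Null means $\mu$-null. A set $A\subseteq\Omega$ covers $B\subseteq\Omega$ if there is a finite $T\subseteq\Gamma$ with $B\subseteq T.A$. $\mathcal{C}$ is the family of all subsets of $\Omega$ that have compact closure and cover some non-empty open set. $\mathcal{T}$ is the $\sigma$-algebra of subsets of $\Omega$ with the property of Baire. For a family $\mathcal{A}\subseteq 2^\Omega$ invariant under the action, sets $A,B\subseteq\Omega$ are $\mathcal{A}$-equidecomposable if there are $m\in\mathbb{N}$, $\gamma_1,\dots,\gamma_m\in\Gamma$ and a partition $A=A_1\sqcup\dots\sqcup A_m$ with each $A_i\in\mathcal{A}$ such that $\gamma_1.A_1,\dots,\gamma_m.A_m$ partition $B$. For $\mathcal{A}=\mathcal{B},\ \mathcal{B}_\mu,\ \mathcal{B}_\mu\cap\mathcal{T}$ this is called Borel, measurable, and Baire-Lebesgue equidecomposability, respectively; with no qualification, $\mathcal{A}=2^\Omega$. Sets $A,B$ are essentially Borel equidecomposable if they are measurable and there are null sets $N,N'$ such that $A\setminus N$ and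 $B\setminus N'$ are Borel equidecomposable. The action is paradoxical if: (1) $\Omega$ is locally compact; (2) for every $\gamma\in\Gamma$ and every compact $C\subseteq\Omega$ the closure of $\gamma.C$ is compact; (3) any two subsets of $\Omega$ with compact closure and non-empty interior are equidecomposable. A set $C\in\mathcal{B}_\mu$ is a domain of expansion if $0<\mu(C)<\infty$ and for every real $\eta>0$ there is a finite set $R\subseteq\Gamma$ such that for all measurable $Y\subseteq C$ we have $\mu((R.Y)\cap C)\ge\min\left((1-\eta)\mu(C),\ \mu(Y)/\eta\right)$. The action is expanding if every set in $\mathcal{B}_\mu\cap\mathcal{C}$ is a domain of expansion. *)

theory Defs
  imports "HOL-Analysis.Analysis" "HOL-Algebra.Group_Action"
begin

text \<open>
  The Polish space is the universe of a type of class \<open>polish_space\<close>. The action is a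
  homomorphism \<open>\<phi>\<close> from the group \<open>G\<close> to the group of all bijections of that type; applying
  \<open>borel_aut\<close> to group inverses makes each \<open>\<phi> g\<close> a Borel automorphism.
\<close>

locale invariant_borel_action =
  group_action G UNIV \<phi> + sigma_finite_measure M
  for G :: "('g, 'm) monoid_scheme" (structure)
    and \<phi> :: "'g \<Rightarrow> 'a::polish_space \<Rightarrow> 'a"
    and M :: "'a measure" +
  assumes sets_M: "sets M = sets borel"
    and borel_aut: "g \<in> carrier G \<Longrightarrow> \<phi> g \<in> borel_measurable borel"
    and nonzero_open: "open U \<Longrightarrow> U \<noteq> {} \<Longrightarrow> emeasure M U \<noteq> 0"
    and invariant: "g \<in> carrier G \<Longrightarrow> U \<in> sets M \<Longrightarrow> emeasure M (\<phi> g ` U) = emeasure M U"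

definition translates :: "('g \<Rightarrow> 'a \<Rightarrow> 'a) \<Rightarrow> 'g set \<Rightarrow> 'a set \<Rightarrow> 'a set" where
  "translates \<phi> T U = (\<Union>g\<in>T. \<phi> g ` U)"

definition covers ::
    "('g, 'm) monoid_scheme \<Rightarrow> ('g \<Rightarrow> 'a \<Rightarrow> 'a) \<Rightarrow> 'a set \<Rightarrow> 'a set \<Rightarrow> bool" where
  "covers G \<phi> A B \<longleftrightarrow> (\<exists>T. finite T \<and> T \<subseteq> carrier G \<and> B \<subseteq> translates \<phi> T A)"

definition relcompact_covering ::
    "('g, 'm) monoid_scheme \<Rightarrow> ('g \<Rightarrow> 'a \<Rightarrow> 'a) \<Rightarrow> 'a::topological_space set set" where
  "relcompact_covering G \<phi> =
    {A. compact (closure A) \<and> (\<exists>U. open U \<and> U \<noteq> {} \<and> covers G \<phi> A U)}"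

definition nowhere_dense :: "'a::topological_space set \<Rightarrow> bool" where
  "nowhere_dense S \<longleftrightarrow> interior (closure S) = {}"

definition meager :: "'a::topological_space set \<Rightarrow> bool" where
  "meager S \<longleftrightarrow> (\<exists>F. countable F \<and> (\<forall>T\<in>F. nowhere_dense T) \<and> S = \<Union>F)"

definition baire_property_sets :: "'a::topological_space set set" where
  "baire_property_sets = {S. \<exists>U. open U \<and> meager (sym_diff S U)}"

text \<open>Pieces of a decomposition may be empty.\<close>

definition equidecomposable ::
    "('g, 'm) monoid_scheme \<Rightarrow> ('g \<Rightarrow> 'a \<Rightarrow> 'a) \<Rightarrow> 'a set set \<Rightarrow> 'a set \<Rightarrow> 'a set \<Rightarrow> bool" where
  "equidecomposable G \<phi> \<A> A B \<longleftrightarrow>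
    (\<exists>(m::nat) \<gamma> P.
      (\<forall>i<m. \<gamma> i \<in> carrier G \<and> P i \<in> \<A>) \<and>
      disjoint_family_on P {..<m} \<and> (\<Union>i<m. P i) = A \<and>
      disjoint_family_on (\<lambda>i. \<phi> (\<gamma> i) ` P i) {..<m} \<and> (\<Union>i<m. \<phi> (\<gamma> i) ` P i) = B)"

definition borel_equidecomposable ::
    "('g, 'm) monoid_scheme \<Rightarrow> ('g \<Rightarrow> 'a::topological_space \<Rightarrow> 'a) \<Rightarrow> 'a set \<Rightarrow> 'a set \<Rightarrow> bool" where
  "borel_equidecomposable G \<phi> A B \<longleftrightarrow> equidecomposable G \<phi> (sets borel) A B"

definition measurably_equidecomposable ::
    "('g, 'm) monoid_scheme \<Rightarrow> ('g \<Rightarrow> 'a \<Rightarrow> 'a) \<Rightarrow> 'a measure \<Rightarrow> 'a set \<Rightarrow> 'a set \<Rightarrow> bool" where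
  "measurably_equidecomposable G \<phi> M A B \<longleftrightarrow> equidecomposable G \<phi> (sets (completion M)) A B"

definition baire_lebesgue_equidecomposable ::
    "('g, 'm) monoid_scheme \<Rightarrow> ('g \<Rightarrow> 'a::topological_space \<Rightarrow> 'a) \<Rightarrow> 'a measure \<Rightarrow>
      'a set \<Rightarrow> 'a set \<Rightarrow> bool" where
  "baire_lebesgue_equidecomposable G \<phi> M A B \<longleftrightarrow>
    equidecomposable G \<phi> (sets (completion M) \<inter> baire_property_sets) A B"

definition ess_borel_equidecomposable ::
    "('g, 'm) monoid_scheme \<Rightarrow> ('g \<Rightarrow> 'a::topological_space \<Rightarrow> 'a) \<Rightarrow> 'a measure \<Rightarrow>
      'a set \<Rightarrow> 'a set \<Rightarrow> bool" where
  "ess_borel_equidecomposable G \<phi> M A B \<longleftrightarrow>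
    A \<in> sets (completion M) \<and> B \<in> sets (completion M) \<and>
    (\<exists>N \<in> null_sets (completion M). \<exists>N' \<in> null_sets (completion M).
      borel_equidecomposable G \<phi> (A - N) (B - N'))"

definition paradoxical_action ::
    "('g, 'm) monoid_scheme \<Rightarrow> ('g \<Rightarrow> 'a::topological_space \<Rightarrow> 'a) \<Rightarrow> bool" where
  "paradoxical_action G \<phi> \<longleftrightarrow>
    locally_compact_space (euclidean :: 'a topology) \<and>
    (\<forall>g \<in> carrier G. \<forall>C. compact C \<longrightarrow> compact (closure (\<phi> g ` C))) \<and>
    (\<forall>A B. compact (closure A) \<and> interior A \<noteq> {} \<and> compact (closure B) \<and> interior B \<noteq> {}
      \<longrightarrow> equidecomposable G \<phi> UNIV A B)"

text \<open>
  All values of \<open>measure\<close> below are genuine: the sets involved are measurable subsets of \<open>C\<close>,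
  which has finite measure.
\<close>

definition domain_of_expansion ::
    "('g, 'm) monoid_scheme \<Rightarrow> ('g \<Rightarrow> 'a \<Rightarrow> 'a) \<Rightarrow> 'a measure \<Rightarrow> 'a set \<Rightarrow> bool" where
  "domain_of_expansion G \<phi> M C \<longleftrightarrow>
    C \<in> sets (completion M) \<and>
    0 < emeasure (completion M) C \<and> emeasure (completion M) C < \<infinity> \<and>
    (\<forall>\<eta>::real. \<eta> > 0 \<longrightarrow>
      (\<exists>R. finite R \<and> R \<subseteq> carrier G \<and>
        (\<forall>Y \<in> sets (completion M). Y \<subseteq> C \<longrightarrow>
          measure (completion M) (translates \<phi> R Y \<inter> C) \<ge>
            min ((1 - \<eta>) * measure (completion M) C) (measure (completion M) Y / \<eta>))))"

definition expanding_action ::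
    "('g, 'm) monoid_scheme \<Rightarrow> ('g \<Rightarrow> 'a::topological_space \<Rightarrow> 'a) \<Rightarrow> 'a measure \<Rightarrow> bool" where
  "expanding_action G \<phi> M \<longleftrightarrow>
    (\<forall>C \<in> sets (completion M) \<inter> relcompact_covering G \<phi>. domain_of_expansion G \<phi> M C)"

end

theory Submission
  imports Defs
begin

text \<open>
  All three kinds of equidecomposability preserve the measure and, the essential one up to null sets, the
  covering class, because the pieces of \<open>B\<close> are moved by finitely many group elements that preserve
  measure and relative compactness. The content is the converse: members \<open>A\<close>, \<open>B\<close> of the covering class with the same finite measure have to be
  matched by finitely many group elements. Three matchings are constructed, each good on a different part
  of the space, and glued along sets that are invariant under the finitely many elements involved.

  A paradoxical action on more than one point has no isolated points, and then \<open>A\<close> expands into \<open>B\<close> in the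
  combinatorial sense: some finite \<open>S\<close> gives every finite \<open>F \<subseteq> A\<close> at least \<open>2 * card F\<close> neighbours in \<open>B\<close>
  (lemma \<open>paradoxical_expansion\<close>). By Hall's theorem for infinite families and the Schroeder--Bernstein
  theorem, \<open>A\<close> and \<open>B\<close> are equidecomposable with arbitrary pieces (\<open>relcompact_covering_matching\<close>).

  Under the same expansion the injections can be chosen with Borel pieces off a meager set
  (\<open>matching_off_meager\<close>, after Marks and Unger). Edges are fixed in countably many stages on sparser and
  sparser sets while Hall's condition is preserved for the rest. A connected finite set that
  loses several neighbours in one stage is large, so the factor 2 absorbs its losses. By Baire category it
  suffices that stage \<open>n\<close> treats a nonmeager part of the \<open>n\<close>-th basic open set.

  Almost everywhere the matching comes from the expansion of measure (\<open>almost_perfect_matching\<close>, after Lyons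
  and Nazarov). As \<open>A \<union> B\<close> is a domain of expansion covered by both sets, some finite set of group elements
  makes the bipartite graph between \<open>A\<close> and \<open>B\<close> expand in measure from both sides. If a part of measure
  \<open>u > 0\<close> is unmatched, then alternating paths of length logarithmic in \<open>1 / u\<close> reach an unmatched set of
  positive measure, and shifting along them improves the matching at a cost bounded by the decrease
  of \<open>sqrt u\<close>. Since these costs are summable, a maximality argument in the style of Ekeland's variational
  principle yields a matching without unmatched part of positive measure.

  The last matching has Borel pieces off an invariant null set \<open>N\<close>, which gives the first statement. Arbitrary
  pieces inside \<open>N\<close> are measurable, which gives the second one. For the third one the matching
  off an invariant meager set \<open>Z\<close> is used on \<open>N - Z\<close>, and arbitrary pieces only inside \<open>N \<inter> Z\<close>.
\<close>

section \<open>Piecewise translations and equidecompositions\<close>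

text \<open>
  A piecewise translation is recorded by the group element that it applies at each point; its pieces are
  the level sets of this labelling.
\<close>

definition move :: "('g \<Rightarrow> 'a \<Rightarrow> 'a) \<Rightarrow> ('a \<rightharpoonup> 'g) \<Rightarrow> 'a \<Rightarrow> 'a" where
  "move \<phi> l x = \<phi> (the (l x)) x"

definition matching ::
    "('g \<Rightarrow> 'a \<Rightarrow> 'a) \<Rightarrow> 'g set \<Rightarrow> 'a set set \<Rightarrow> 'a set \<Rightarrow> 'a set \<Rightarrow> ('a \<rightharpoonup> 'g) \<Rightarrow> bool" where
  "matching \<phi> S \<A> A B l \<longleftrightarrow>
    dom l \<subseteq> A \<and> ran l \<subseteq> S \<and> move \<phi> l ` dom l \<subseteq> B \<and> inj_on (move \<phi> l) (dom l) \<and>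
    (\<forall>s. {x. l x = Some s} \<in> \<A>)"

definition perfect_matching ::
    "('g \<Rightarrow> 'a \<Rightarrow> 'a) \<Rightarrow> 'g set \<Rightarrow> 'a set set \<Rightarrow> 'a set \<Rightarrow> 'a set \<Rightarrow> ('a \<rightharpoonup> 'g) \<Rightarrow> bool" where
  "perfect_matching \<phi> S \<A> A B l \<longleftrightarrow>
    matching \<phi> S \<A> A B l \<and> dom l = A \<and> move \<phi> l ` A = B"

lemma move_Some: "l x = Some s \<Longrightarrow> move \<phi> l x = \<phi> s x"
  by (simp add: move_def)

lemma matchingD:
  assumes "matching \<phi> S \<A> A B l"
  shows "dom l \<subseteq> A" "ran l \<subseteq> S" "move \<phi> l ` dom l \<subseteq> B" "inj_on (move \<phi> l) (dom l)"
    "{x. l x = Some s} \<in> \<A>"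
  using assms by (auto simp: matching_def)

lemma matching_Some:
  assumes "matching \<phi> S \<A> A B l" "l x = Some s"
  shows "x \<in> A" "s \<in> S" "\<phi> s x \<in> B"
proof -
  have d: "x \<in> dom l" using assms(2) by auto
  show "x \<in> A" using d matchingD(1)[OF assms(1)] by auto
  show "s \<in> S" using matchingD(2)[OF assms(1)] assms(2) by (auto simp: ran_def)
  show "\<phi> s x \<in> B"
    using matchingD(3)[OF assms(1)] d move_Some[of l x s \<phi>] assms(2) by (metis image_subset_iff)
qed

lemma matching_inj:
  assumes "matching \<phi> S \<A> A B l" "l x = Some s" "l y = Some t" "\<phi> s x = \<phi> t y"
  shows "x = y"
proof -
  have "move \<phi> l x = move \<phi> l y" using assms by (simp add: move_def)
  moreover have "x \<in> dom l" "y \<in> dom l" using assms by auto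
  ultimately show ?thesis using matchingD(4)[OF assms(1)] by (meson inj_onD)
qed

lemma matchingI:
  assumes "\<And>x s. l x = Some s \<Longrightarrow> x \<in> A \<and> s \<in> S \<and> \<phi> s x \<in> B"
    and "\<And>x y s t. \<lbrakk>l x = Some s; l y = Some t; \<phi> s x = \<phi> t y\<rbrakk> \<Longrightarrow> x = y"
    and "\<And>s. {x. l x = Some s} \<in> \<A>"
  shows "matching \<phi> S \<A> A B l"
proof -
  have "inj_on (move \<phi> l) (dom l)"
  proof (rule inj_onI)
    fix x y assume "x \<in> dom l" "y \<in> dom l" and e: "move \<phi> l x = move \<phi> l y"
    then obtain s t where "l x = Some s" "l y = Some t" by auto
    with e assms(2) show "x = y" by (auto simp: move_def)
  qed
  moreover have "move \<phi> l ` dom l \<subseteq> B" using assms(1) by (auto simp: move_def)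
  moreover have "dom l \<subseteq> A" using assms(1) by auto
  moreover have "ran l \<subseteq> S" using assms(1) by (auto simp: ran_def)
  ultimately show ?thesis using assms(3) by (simp add: matching_def)
qed

lemma matching_mono:
  assumes l: "matching \<phi> S \<A> A B l" and "A \<subseteq> A'" "B \<subseteq> B'"
  shows "matching \<phi> S \<A> A' B' l"
  unfolding matching_def
proof (intro conjI allI)
  show "dom l \<subseteq> A'" by (rule subset_trans[OF matchingD(1)[OF l] assms(2)])
  show "move \<phi> l ` dom l \<subseteq> B'" by (rule subset_trans[OF matchingD(3)[OF l] assms(3)])
qed (rule matchingD[OF l])+

lemma perfect_matchingD:
  assumes "perfect_matching \<phi> S \<A> A B l"
  shows "matching \<phi> S \<A> A B l" "dom l = A" "move \<phi> l ` A = B"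
  using assms by (auto simp: perfect_matching_def)

lemma perfect_matching_weaken:
  assumes "perfect_matching \<phi> S \<A> A B l" "S \<subseteq> S'" "\<A> \<subseteq> \<A>'"
  shows "perfect_matching \<phi> S' \<A>' A B l"
  using assms unfolding perfect_matching_def matching_def by blast

definition hit :: "('g \<Rightarrow> 'a \<Rightarrow> 'a) \<Rightarrow> ('a \<rightharpoonup> 'g) \<Rightarrow> 'a set" where
  "hit \<phi> l = move \<phi> l ` dom l"

lemma hitI: "l x = Some s \<Longrightarrow> \<phi> s x \<in> hit \<phi> l"
  unfolding hit_def by (auto simp: move_def intro!: image_eqI[of _ _ x])

lemma hitE:
  assumes "y \<in> hit \<phi> l"
  obtains x s where "l x = Some s" "y = \<phi> s x"
  using assms unfolding hit_def by (auto simp: move_def)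

lemma hit_restrict: "hit \<phi> (l |` V) = move \<phi> l ` (V \<inter> dom l)"
proof -
  have "dom (l |` V) = V \<inter> dom l" by (auto simp: restrict_map_def split: if_splits)
  moreover have "move \<phi> (l |` V) ` (V \<inter> dom l) = move \<phi> l ` (V \<inter> dom l)"
    by (intro image_cong) (auto simp: move_def)
  ultimately show ?thesis by (simp add: hit_def)
qed

lemma matching_restrict:
  assumes l: "matching \<phi> S \<A> A B l" and pieces: "\<And>s. {x. l x = Some s} \<inter> V \<in> \<A>'"
  shows "matching \<phi> S \<A>' A B (l |` V)"
proof (rule matchingI)
  fix x s assume "(l |` V) x = Some s"
  then have "l x = Some s" by (auto simp: restrict_map_def split: if_splits)
  then show "x \<in> A \<and> s \<in> S \<and> \<phi> s x \<in> B" using matching_Some[OF l] by simp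
next
  fix x y s t assume "(l |` V) x = Some s" "(l |` V) y = Some t" and e: "\<phi> s x = \<phi> t y"
  then have "l x = Some s" "l y = Some t" by (auto simp: restrict_map_def split: if_splits)
  then show "x = y" using matching_inj[OF l _ _ e] by simp
next
  fix s
  have "{x. (l |` V) x = Some s} = {x. l x = Some s} \<inter> V" by (auto simp: restrict_map_def split: if_splits)
  then show "{x. (l |` V) x = Some s} \<in> \<A>'" using pieces by simp
qed

lemma matching_Un:
  assumes l1: "matching \<phi> S \<A> A B l1" and l2: "matching \<phi> S \<A> A B l2"
    and dom: "dom l1 \<inter> dom l2 = {}" and hit: "hit \<phi> l1 \<inter> hit \<phi> l2 = {}"
    and un: "\<And>X Y. X \<in> \<A> \<Longrightarrow> Y \<in> \<A> \<Longrightarrow> X \<union> Y \<in> \<A>"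
  shows "matching \<phi> S \<A> A B (l1 ++ l2)" "hit \<phi> (l1 ++ l2) = hit \<phi> l1 \<union> hit \<phi> l2"
proof -
  have val: "(l1 ++ l2) x = Some s \<longleftrightarrow> l1 x = Some s \<or> l2 x = Some s" for x s
    using dom by (auto simp: map_add_Some_iff)
  show "hit \<phi> (l1 ++ l2) = hit \<phi> l1 \<union> hit \<phi> l2"
  proof (intro equalityI subsetI)
    fix y assume "y \<in> hit \<phi> (l1 ++ l2)"
    then obtain x s where "(l1 ++ l2) x = Some s" "y = \<phi> s x" by (rule hitE)
    then show "y \<in> hit \<phi> l1 \<union> hit \<phi> l2" unfolding val using hitI by fastforce
  next
    fix y assume "y \<in> hit \<phi> l1 \<union> hit \<phi> l2"
    then obtain x s where "l1 x = Some s \<or> l2 x = Some s" "y = \<phi> s x" by (metis UnE hitE)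
    then show "y \<in> hit \<phi> (l1 ++ l2)" using hitI[of "l1 ++ l2" x s \<phi>] unfolding val by simp
  qed
  show "matching \<phi> S \<A> A B (l1 ++ l2)"
  proof (rule matchingI)
    fix x s assume "(l1 ++ l2) x = Some s"
    then show "x \<in> A \<and> s \<in> S \<and> \<phi> s x \<in> B"
      unfolding val using matching_Some[OF l1] matching_Some[OF l2] by blast
  next
    fix x y s t assume a: "(l1 ++ l2) x = Some s" "(l1 ++ l2) y = Some t" and e: "\<phi> s x = \<phi> t y"
    have no: "\<not> (l1 u = Some v \<and> l2 w = Some z)" if "\<phi> v u = \<phi> z w" for u v w z
    proof
      assume "l1 u = Some v \<and> l2 w = Some z"
      then have "\<phi> v u \<in> hit \<phi> l1" "\<phi> z w \<in> hit \<phi> l2" by (auto intro: hitI)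
      then show False using that hit by auto
    qed
    have "l1 x = Some s \<and> l1 y = Some t \<or> l2 x = Some s \<and> l2 y = Some t"
      using a no[OF e] no[OF e[symmetric]] unfolding val by blast
    then show "x = y" using matching_inj[OF l1 _ _ e] matching_inj[OF l2 _ _ e] by blast
  next
    fix s
    have "{x. (l1 ++ l2) x = Some s} = {x. l1 x = Some s} \<union> {x. l2 x = Some s}" using val by auto
    then show "{x. (l1 ++ l2) x = Some s} \<in> \<A>" using un matchingD(5)[OF l1] matchingD(5)[OF l2] by simp
  qed
qed

lemma perfect_matching_Un:
  assumes l1: "perfect_matching \<phi> S \<A> A1 B1 l1" and l2: "perfect_matching \<phi> S \<A> A2 B2 l2"
    and "A1 \<inter> A2 = {}" "B1 \<inter> B2 = {}" and un: "\<And>X Y. X \<in> \<A> \<Longrightarrow> Y \<in> \<A> \<Longrightarrow> X \<union> Y \<in> \<A>"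
  shows "perfect_matching \<phi> S \<A> (A1 \<union> A2) (B1 \<union> B2) (l1 ++ l2)"
proof -
  have m1: "matching \<phi> S \<A> (A1 \<union> A2) (B1 \<union> B2) l1" and m2: "matching \<phi> S \<A> (A1 \<union> A2) (B1 \<union> B2) l2"
    by (rule matching_mono[OF perfect_matchingD(1)[OF l1]]; simp)
      (rule matching_mono[OF perfect_matchingD(1)[OF l2]]; simp)
  have d1: "dom l1 = A1" "hit \<phi> l1 = B1" and d2: "dom l2 = A2" "hit \<phi> l2 = B2"
    using l1 l2 by (auto simp: perfect_matching_def hit_def)
  have "dom l1 \<inter> dom l2 = {}" "hit \<phi> l1 \<inter> hit \<phi> l2 = {}" using d1 d2 assms(3,4) by simp_all
  note u = matching_Un[OF m1 m2 this un]
  have dom: "dom (l1 ++ l2) = A1 \<union> A2" using d1 d2 by auto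
  have "hit \<phi> (l1 ++ l2) = B1 \<union> B2" using u(2) d1 d2 by simp
  then have "move \<phi> (l1 ++ l2) ` (A1 \<union> A2) = B1 \<union> B2" unfolding hit_def dom .
  then show ?thesis using u(1) dom by (simp add: perfect_matching_def)
qed

locale space_action = group_action G UNIV \<phi>
  for G :: "('g, 'm) monoid_scheme" (structure) and \<phi> :: "'g \<Rightarrow> 'a \<Rightarrow> 'a"
begin

sublocale group G
  using group_hom group_hom.axioms(1) by auto

lemma act_one [simp]: "\<phi> \<one> x = x"
  using id_eq_one by (metis UNIV_I restrict_apply')

lemma act_mult: "g \<in> carrier G \<Longrightarrow> h \<in> carrier G \<Longrightarrow> \<phi> (g \<otimes> h) x = \<phi> g (\<phi> h x)"
  using composition_rule by simp

lemma act_inv_left [simp]: "g \<in> carrier G \<Longrightarrow> \<phi> (inv g) (\<phi> g x) = x"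
  by (metis UNIV_I orbit_sym_aux)

lemma act_inv_right [simp]: "g \<in> carrier G \<Longrightarrow> \<phi> g (\<phi> (inv g) x) = x"
  by (metis act_inv_left inv_closed inv_inv)

lemma act_eq_iff: "g \<in> carrier G \<Longrightarrow> \<phi> g x = \<phi> g y \<longleftrightarrow> x = y"
  by (metis act_inv_left)

lemma act_inj: "g \<in> carrier G \<Longrightarrow> inj (\<phi> g)"
  by (simp add: inj_def act_eq_iff)

lemma act_image_eq_vimage: "g \<in> carrier G \<Longrightarrow> \<phi> g ` X = \<phi> (inv g) -` X"
  by (auto simp: image_iff) (metis act_inv_right)

lemma matching_image_eq:
  assumes "matching \<phi> S \<A> A B l"
  shows "move \<phi> l ` (E \<inter> dom l) = (\<Union>s\<in>S. \<phi> s ` (E \<inter> {x. l x = Some s}))"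
proof (intro equalityI subsetI)
  fix y assume "y \<in> move \<phi> l ` (E \<inter> dom l)"
  then obtain x s where "x \<in> E" "l x = Some s" "y = \<phi> s x" by (auto simp: move_def)
  then show "y \<in> (\<Union>s\<in>S. \<phi> s ` (E \<inter> {x. l x = Some s}))" using matching_Some[OF assms] by blast
next
  fix y assume "y \<in> (\<Union>s\<in>S. \<phi> s ` (E \<inter> {x. l x = Some s}))"
  then obtain x s where "x \<in> E" "l x = Some s" "y = \<phi> s x" by auto
  then show "y \<in> move \<phi> l ` (E \<inter> dom l)" by (auto simp: move_def intro!: image_eqI[of _ _ x])
qed

text \<open>
  A set that is invariant under the labels splits a matching. Matchings with different merits can therefore
  be combined along a partition of the space into invariant sets.
\<close>

lemma matching_restrict_invariant:
  assumes l: "matching \<phi> S \<A> A B l" and inv: "\<And>g. g \<in> S \<Longrightarrow> \<phi> g ` V = V"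
    and pieces: "\<And>s. {x. l x = Some s} \<inter> V \<in> \<A>'"
  shows "matching \<phi> S \<A>' (A \<inter> V) (B \<inter> V) (l |` V)"
proof -
  note r = matching_restrict[OF l pieces]
  show ?thesis
  proof (rule matchingI)
    fix x s assume x: "(l |` V) x = Some s"
    then have "x \<in> V" by (auto simp: restrict_map_def split: if_splits)
    moreover have "\<phi> s x \<in> V" using inv[OF matching_Some(2)[OF r x]] \<open>x \<in> V\<close> by blast
    ultimately show "x \<in> A \<inter> V \<and> s \<in> S \<and> \<phi> s x \<in> B \<inter> V" using matching_Some[OF r x] by simp
  next
    fix x y s t assume "(l |` V) x = Some s" "(l |` V) y = Some t" "\<phi> s x = \<phi> t y"
    then show "x = y" by (rule matching_inj[OF r])
  qed (rule matchingD(5)[OF r])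
qed

lemma perfect_matching_restrict:
  assumes l: "perfect_matching \<phi> S \<A> A B l" and S: "S \<subseteq> carrier G"
    and inv: "\<And>g. g \<in> S \<Longrightarrow> \<phi> g ` V = V" and pieces: "\<And>s. {x. l x = Some s} \<inter> V \<in> \<A>'"
  shows "perfect_matching \<phi> S \<A>' (A \<inter> V) (B \<inter> V) (l |` V)"
proof -
  note m = perfect_matchingD(1)[OF l] and d = perfect_matchingD(2)[OF l] and r = perfect_matchingD(3)[OF l]
  have m': "matching \<phi> S \<A>' (A \<inter> V) (B \<inter> V) (l |` V)"
    by (rule matching_restrict_invariant[OF m]) (rule inv, assumption, rule pieces)
  have d': "dom (l |` V) = A \<inter> V" using d by auto
  have "B \<inter> V \<subseteq> hit \<phi> (l |` V)"
  proof
    fix y assume y: "y \<in> B \<inter> V"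
    then obtain x where x: "x \<in> A" "y = move \<phi> l x" using r by blast
    then obtain s where s: "l x = Some s" using d by blast
    have sS: "s \<in> S" by (rule matching_Some(2)[OF m s])
    have "\<phi> s x \<in> \<phi> s ` V" using y x(2) s inv[OF sS] by (simp add: move_def)
    then have "x \<in> V" using inj_image_mem_iff[OF act_inj, of s x V] sS S by blast
    then have "(l |` V) x = Some s" using s by simp
    then have "\<phi> s x \<in> hit \<phi> (l |` V)" by (rule hitI)
    then show "y \<in> hit \<phi> (l |` V)" using x(2) s by (simp add: move_def)
  qed
  moreover have "hit \<phi> (l |` V) \<subseteq> B \<inter> V" using matchingD(3)[OF m'] by (simp only: hit_def)
  ultimately have "move \<phi> (l |` V) ` (A \<inter> V) = B \<inter> V" unfolding hit_def d' by (intro equalityI)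
  then show ?thesis using m' d' by (simp add: perfect_matching_def)
qed

lemma equidecomposable_if_perfect_matching:
  assumes l: "perfect_matching \<phi> S \<A> A B l" and "finite S" "S \<subseteq> carrier G"
  shows "equidecomposable G \<phi> \<A> A B"
proof -
  note m = perfect_matchingD(1)[OF l] and d = perfect_matchingD(2)[OF l] and r = perfect_matchingD(3)[OF l]
  obtain h :: "nat \<Rightarrow> 'g" and n where h: "bij_betw h {..<n} S"
    using \<open>finite S\<close> ex_bij_betw_nat_finite by (metis atLeast0LessThan)
  note hS = bij_betw_imp_surj_on[OF h, symmetric]
  define P where "P i = {x. l x = Some (h i)}" for i
  have "(\<Union>i<n. P i) = A"
  proof -
    have "(\<Union>i<n. P i) = (\<Union>s\<in>S. {x. l x = Some s})"
      unfolding P_def hS by auto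
    then show ?thesis using d matching_Some[OF m] by blast
  qed
  moreover have "(\<Union>i<n. \<phi> (h i) ` P i) = B"
  proof -
    have "(\<Union>i<n. \<phi> (h i) ` P i) = (\<Union>s\<in>S. \<phi> s ` {x. l x = Some s})"
      unfolding P_def hS by auto
    also have "\<dots> = move \<phi> l ` (UNIV \<inter> dom l)"
      using matching_image_eq[OF m, of UNIV] by simp
    finally show ?thesis using r d by simp
  qed
  moreover have "disjoint_family_on P {..<n}"
    using bij_betw_imp_inj_on[OF h] by (auto simp: disjoint_family_on_def P_def inj_on_def)
  moreover have "disjoint_family_on (\<lambda>i. \<phi> (h i) ` P i) {..<n}"
  proof (unfold disjoint_family_on_def, intro ballI impI)
    fix i j assume ij: "i \<in> {..<n}" "j \<in> {..<n}" "i \<noteq> j"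
    then have "h i \<noteq> h j" using bij_betw_imp_inj_on[OF h] by (meson inj_onD)
    then show "\<phi> (h i) ` P i \<inter> \<phi> (h j) ` P j = {}"
      using matching_inj[OF m, of _ "h i" _ "h j"] by (force simp: P_def)
  qed
  moreover have "\<forall>i<n. h i \<in> carrier G \<and> P i \<in> \<A>"
    using bij_betw_apply[OF h] assms(3) matchingD(5)[OF m] by (auto simp: P_def)
  ultimately show ?thesis unfolding equidecomposable_def by blast
qed

lemma perfect_matching_if_equidecomposable:
  assumes "equidecomposable G \<phi> \<A> A B"
  obtains S l where "finite S" "S \<subseteq> carrier G" "perfect_matching \<phi> S UNIV A B l"
proof -
  obtain m :: nat and \<gamma> P where g: "\<And>i. i < m \<Longrightarrow> \<gamma> i \<in> carrier G"
    and dP: "disjoint_family_on P {..<m}" and A: "(\<Union>i<m. P i) = A"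
    and dQ: "disjoint_family_on (\<lambda>i. \<phi> (\<gamma> i) ` P i) {..<m}" and B: "(\<Union>i<m. \<phi> (\<gamma> i) ` P i) = B"
    using assms unfolding equidecomposable_def by blast
  define l where "l x = (if x \<in> A then Some (\<gamma> (SOME i. i < m \<and> x \<in> P i)) else None)" for x
  have l: "l x = Some (\<gamma> i)" if "i < m" "x \<in> P i" for i x
  proof -
    have "(SOME i. i < m \<and> x \<in> P i) = i"
      using that dP by (intro some_equality) (auto simp: disjoint_family_on_def)
    moreover have "x \<in> A" using that A by auto
    ultimately show ?thesis by (simp add: l_def)
  qed
  have ex: "\<exists>i<m. x \<in> P i \<and> s = \<gamma> i" if "l x = Some s" for x s
  proof -
    have "x \<in> A" using that by (auto simp: l_def split: if_splits)
    then obtain i where "i < m" "x \<in> P i" using A by auto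
    then show ?thesis using l that by (metis option.inject)
  qed
  have "matching \<phi> (\<gamma> ` {..<m}) UNIV A B l"
  proof (rule matchingI)
    fix x s assume "l x = Some s"
    then show "x \<in> A \<and> s \<in> \<gamma> ` {..<m} \<and> \<phi> s x \<in> B" using ex A B by blast
  next
    fix x y s t assume a: "l x = Some s" "l y = Some t" "\<phi> s x = \<phi> t y"
    obtain i j where ij: "i < m" "x \<in> P i" "s = \<gamma> i" "j < m" "y \<in> P j" "t = \<gamma> j"
      using ex a by meson
    have "\<phi> (\<gamma> i) x \<in> \<phi> (\<gamma> i) ` P i" "\<phi> (\<gamma> j) y \<in> \<phi> (\<gamma> j) ` P j" using ij by blast+
    then have "\<phi> (\<gamma> i) ` P i \<inter> \<phi> (\<gamma> j) ` P j \<noteq> {}" using a(3) ij by auto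
    then have "i = j" using dQ ij by (auto simp: disjoint_family_on_def)
    then show "x = y" using ij a(3) act_eq_iff g by auto
  qed auto
  moreover have "dom l = A" by (auto simp: l_def split: if_splits)
  moreover have "move \<phi> l ` A = B"
  proof -
    have "move \<phi> l x = \<phi> (\<gamma> i) x" if "i < m" "x \<in> P i" for i x
      using l[OF that] by (simp add: move_def)
    then have "move \<phi> l ` P i = \<phi> (\<gamma> i) ` P i" if "i < m" for i using that by (simp cong: image_cong)
    then have "(\<Union>i<m. move \<phi> l ` P i) = B" using B by simp
    then show ?thesis using A by (simp add: image_UN[symmetric])
  qed
  ultimately have "perfect_matching \<phi> (\<gamma> ` {..<m}) UNIV A B l" by (simp add: perfect_matching_def)
  then show ?thesis using that g by (metis finite_imageI finite_lessThan image_subsetI lessThan_iff)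
qed

end

locale invariant_sigma_algebra = space_action G \<phi> + sigma_algebra UNIV \<A>
  for G :: "('g, 'm) monoid_scheme" (structure) and \<phi> :: "'g \<Rightarrow> 'a \<Rightarrow> 'a" and \<A> :: "'a set set" +
  assumes act_image: "g \<in> carrier G \<Longrightarrow> X \<in> \<A> \<Longrightarrow> \<phi> g ` X \<in> \<A>"
begin

lemma matching_dom_in:
  assumes "matching \<phi> S \<A> A B l" "finite S"
  shows "dom l \<in> \<A>"
proof -
  have "dom l = (\<Union>s\<in>S. {x. l x = Some s})" using matching_Some(2)[OF assms(1)] by auto
  then show ?thesis using assms matchingD(5)[OF assms(1)] by (auto intro!: finite_UN)
qed

lemma matching_image_in:
  assumes "matching \<phi> S \<A> A B l" "finite S" "S \<subseteq> carrier G" "E \<in> \<A>"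
  shows "move \<phi> l ` (E \<inter> dom l) \<in> \<A>"
  unfolding matching_image_eq[OF assms(1)]
  using assms matchingD(5)[OF assms(1)] by (auto intro!: finite_UN act_image)

text \<open>
  Banach's form of the Schroeder--Bernstein theorem. The set on which the first injection is
  used is a countable union of images of a member of the sigma-algebra, so the pieces of the
  resulting bijection stay in it.
\<close>

lemma Schroeder_Bernstein_matching:
  assumes f: "matching \<phi> S \<A> A B f" "dom f = A" and g: "matching \<phi> T \<A> B A g" "dom g = B"
    and fin: "finite S" "finite T" and sub: "S \<subseteq> carrier G" "T \<subseteq> carrier G"
  obtains h where "perfect_matching \<phi> (S \<union> (\<lambda>t. inv t) ` T) \<A> A B h"
proof -
  define F where "F = move \<phi> f"
  define H where "H = move \<phi> g"
  define D where "D n = ((\<lambda>X. H ` F ` X) ^^ n) (A - H ` B)" for n :: nat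
  define C where "C = (\<Union>n. D n)"
  have FA: "F ` A \<subseteq> B" and HB: "H ` B \<subseteq> A" and injF: "inj_on F A" and injH: "inj_on H B"
    using matchingD[OF f(1)] matchingD[OF g(1)] f(2) g(2) by (auto simp: F_def H_def)
  have A: "A \<in> \<A>" and B: "B \<in> \<A>"
    using matching_dom_in[OF f(1) fin(1)] matching_dom_in[OF g(1) fin(2)] f(2) g(2) by auto
  have Fim: "F ` X \<in> \<A>" if "X \<in> \<A>" "X \<subseteq> A" for X
    using matching_image_in[OF f(1) fin(1) sub(1) that(1)] that(2) f(2)
    by (simp add: F_def Int_absorb2)
  have Him: "H ` X \<in> \<A>" if "X \<in> \<A>" "X \<subseteq> B" for X
    using matching_image_in[OF g(1) fin(2) sub(2) that(1)] that(2) g(2)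
    by (simp add: H_def Int_absorb2)
  have D: "D n \<in> \<A> \<and> D n \<subseteq> A" for n
  proof (induction n)
    case 0
    show ?case using A B Him by (auto simp: D_def)
  next
    case (Suc n)
    have "D (Suc n) = H ` F ` D n" by (simp add: D_def)
    moreover have "F ` D n \<in> \<A>" "F ` D n \<subseteq> B" using Suc Fim FA by blast+
    ultimately have "D (Suc n) \<in> \<A>" "D (Suc n) \<subseteq> H ` B" using Him by auto
    then show ?case using HB by blast
  qed
  have C: "C \<in> \<A>" "C \<subseteq> A" using D by (auto simp: C_def)
  have CF: "H (F x) \<in> C" if x: "x \<in> C" for x
  proof -
    obtain n where "x \<in> D n" using x by (auto simp: C_def)
    then have "H (F x) \<in> D (Suc n)" by (simp add: D_def)
    then show ?thesis by (auto simp: C_def)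
  qed
  have CH: "y \<in> F ` C" if y: "y \<in> B" "H y \<in> C" for y
  proof -
    obtain n where n: "H y \<in> D n" using y by (auto simp: C_def)
    have "n \<noteq> 0" using n y(1) by (cases n) (auto simp: D_def)
    then obtain k where k: "n = Suc k" using not0_implies_Suc by auto
    then obtain x where "x \<in> D k" "H y = H (F x)" using n by (auto simp: D_def)
    moreover have "F x \<in> B" using \<open>x \<in> D k\<close> D FA by blast
    ultimately show ?thesis using injH y(1) by (auto simp: C_def dest: inj_onD)
  qed
  have onto: "\<exists>y. y \<in> B \<and> H y = x" if x: "x \<in> A - C" for x
  proof -
    have "x \<notin> D 0" using x by (auto simp: C_def)
    then show ?thesis using x by (auto simp: D_def)
  qed
  define K where "K x = (THE y. y \<in> B \<and> H y = x)" for x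
  have K: "K (H y) = y" if "y \<in> B" for y
    unfolding K_def using that injH by (intro the_equality) (auto dest: inj_onD)
  have KB: "K x \<in> B" "H (K x) = x" if "x \<in> A - C" for x using onto[OF that] K by auto
  define h where
    "h x = (if x \<in> C then f x else if x \<in> A then Some (inv (the (g (K x)))) else None)" for x
  have hC: "h x = Some s \<longleftrightarrow> f x = Some s" if "x \<in> C" for x s using that by (simp add: h_def)
  have domh: "dom h = A" using f(2) C(2) by (auto simp: h_def split: if_splits)
  have hK: "\<phi> s x = K x \<and> g (K x) = Some (inv s) \<and> s \<in> (\<lambda>t. inv t) ` T"
    if hx: "h x = Some s" and x: "x \<in> A - C" for x s
  proof -
    obtain t where t: "g (K x) = Some t" using KB(1)[OF x] g(2) by auto
    have tT: "t \<in> T" "t \<in> carrier G" using matching_Some(2)[OF g(1) t] sub(2) by auto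
    have s: "s = inv t" using hx x t by (auto simp: h_def)
    have "x = \<phi> t (K x)" using KB(2)[OF x] t by (simp add: H_def move_def)
    then have "\<phi> s x = K x" using s tT by (metis act_inv_left)
    then show ?thesis using s t tT by auto
  qed
  have mh: "move \<phi> h x = (if x \<in> C then F x else K x)" if x: "x \<in> A" for x
  proof -
    obtain s where s: "h x = Some s" using x domh by blast
    then show ?thesis using hC[of x s] hK[OF s] x by (auto simp: move_def F_def)
  qed
  have inj: "inj_on (move \<phi> h) A"
  proof (rule inj_onI)
    have *: False if "x \<in> C" "y \<in> A - C" "F x = K y" for x y
      using CF[OF that(1)] KB(2)[OF that(2)] that by auto
    fix x y assume xy: "x \<in> A" "y \<in> A" "move \<phi> h x = move \<phi> h y"
    show "x = y"
    proof (cases "x \<in> C"; cases "y \<in> C")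
      assume "x \<in> C" "y \<in> C" then show ?thesis using xy mh injF by (auto dest: inj_onD)
    next
      assume "x \<in> C" "y \<notin> C" then show ?thesis using xy mh *[of x y] by auto
    next
      assume "x \<notin> C" "y \<in> C" then show ?thesis using xy mh *[of y x] by auto
    next
      assume "x \<notin> C" "y \<notin> C" then show ?thesis using xy mh KB(2) by (metis DiffI)
    qed
  qed
  have img: "move \<phi> h ` A = B"
  proof (intro equalityI subsetI)
    fix y assume "y \<in> move \<phi> h ` A"
    then show "y \<in> B" using mh FA KB(1) by (auto split: if_splits)
  next
    fix y assume y: "y \<in> B"
    show "y \<in> move \<phi> h ` A"
    proof (cases "H y \<in> C")
      case True
      then obtain x where "x \<in> C" "y = F x" using CH[OF y] by auto
      then show ?thesis using mh C(2) by (metis image_eqI subsetD)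
    next
      case False
      then show ?thesis using mh[of "H y"] K[OF y] HB y by (metis image_eqI image_subset_iff)
    qed
  qed
  have "matching \<phi> (S \<union> (\<lambda>t. inv t) ` T) \<A> A B h"
    unfolding matching_def
  proof (intro conjI allI)
    show "ran h \<subseteq> S \<union> (\<lambda>t. inv t) ` T"
    proof
      fix s assume "s \<in> ran h"
      then obtain x where x: "h x = Some s" by (auto simp: ran_def)
      then have "x \<in> A" using domh by auto
      then show "s \<in> S \<union> (\<lambda>t. inv t) ` T"
        using x hC[of x s] hK[OF x] matching_Some(2)[OF f(1)] by blast
    qed
    fix s
    have "{x. h x = Some s} = (C \<inter> {x. f x = Some s}) \<union>
       ((A - C) \<inter> (\<Union>t\<in>{t\<in>T. inv t = s}. \<phi> t ` {y. g y = Some t}))" (is "?L = ?R")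
    proof (intro equalityI subsetI)
      fix x assume "x \<in> ?L"
      then have x: "h x = Some s" by simp
      then have "x \<in> A" using domh by auto
      show "x \<in> ?R"
      proof (cases "x \<in> C")
        case True then show ?thesis using hC x by auto
      next
        case False
        then obtain t where t: "t \<in> T" "s = inv t" using hK[OF x] \<open>x \<in> A\<close> by auto
        then have "t = inv s" using sub by (metis inv_inv subsetD)
        then have "g (K x) = Some t" using hK[OF x] \<open>x \<in> A\<close> False by auto
        moreover have "x = \<phi> t (K x)"
          using KB(2)[of x] \<open>x \<in> A\<close> False \<open>g (K x) = Some t\<close> by (simp add: H_def move_def)
        ultimately show ?thesis using t \<open>x \<in> A\<close> False by blast
      qed
    next
      fix x assume "x \<in> ?R"
      then consider "x \<in> C" "f x = Some s"
        | t y where "x \<in> A - C" "t \<in> T" "inv t = s" "g y = Some t" "x = \<phi> t y" by auto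
      then show "x \<in> ?L"
      proof cases
        case 1 then show ?thesis using hC by auto
      next
        case 2
        then have "x = H y" "y \<in> B" using matching_Some[OF g(1)] by (auto simp: H_def move_def)
        then have "K x = y" using K by simp
        then show ?thesis using 2 by (auto simp: h_def)
      qed
    qed
    also have "\<dots> \<in> \<A>"
    proof -
      have "\<phi> t ` {y. g y = Some t} \<in> \<A>" if "t \<in> T" for t
        using that sub act_image matchingD(5)[OF g(1)] by blast
      then have "(\<Union>t\<in>{t\<in>T. inv t = s}. \<phi> t ` {y. g y = Some t}) \<in> \<A>"
        using fin by (intro finite_UN) auto
      then show ?thesis using A C matchingD(5)[OF f(1)] by auto
    qed
    finally show "{x. h x = Some s} \<in> \<A>" .
  qed (use domh img inj in auto)
  then show ?thesis using that domh img by (simp add: perfect_matching_def)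
qed

end

section \<open>Infinite matchings and the expansion forced by paradoxicality\<close>

definition Hall_relation :: "'a set \<Rightarrow> ('a \<times> 'b) set \<Rightarrow> bool" where
  "Hall_relation A R \<longleftrightarrow> (\<forall>F. finite F \<longrightarrow> F \<subseteq> A \<longrightarrow> card F \<le> card (R `` F))"

text \<open>
  Over finitely many points the members of the chain are finite, so one of them already agrees with the
  intersection there.
\<close>

lemma Hall_relation_Inter:
  assumes fin: "\<And>x. x \<in> A \<Longrightarrow> finite (N `` {x})"
    and chain: "\<And>R R'. R \<in> \<C> \<Longrightarrow> R' \<in> \<C> \<Longrightarrow> R \<subseteq> R' \<or> R' \<subseteq> R"
    and sub: "\<And>R. R \<in> \<C> \<Longrightarrow> R \<subseteq> N \<and> Hall_relation A R" and "\<C> \<noteq> {}"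
  shows "Hall_relation A (\<Inter>\<C>)"
  unfolding Hall_relation_def
proof (intro allI impI)
  fix F assume F: "finite F" "F \<subseteq> A"
  define c where "c R = card (R \<inter> F \<times> UNIV)" for R :: "('a \<times> 'b) set"
  have finR: "finite (R \<inter> F \<times> UNIV)" if "R \<in> \<C>" for R
  proof (rule finite_subset)
    show "R \<inter> F \<times> UNIV \<subseteq> (SIGMA x:F. N `` {x})" using sub[OF that] by auto
    show "finite (SIGMA x:F. N `` {x})" using F fin by auto
  qed
  obtain R where R: "R \<in> \<C>" and min: "\<And>R'. R' \<in> \<C> \<Longrightarrow> c R \<le> c R'"
    using \<open>\<C> \<noteq> {}\<close> ex_has_least_nat[of "\<lambda>R. R \<in> \<C>" _ c] by blast
  have "R \<inter> F \<times> UNIV \<subseteq> R'" if R': "R' \<in> \<C>" for R'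
  proof (cases "R \<subseteq> R'")
    case False
    then have "R' \<inter> F \<times> UNIV \<subseteq> R \<inter> F \<times> UNIV" using chain[OF R R'] by auto
    then have "R' \<inter> F \<times> UNIV = R \<inter> F \<times> UNIV"
      using min[OF R'] finR[OF R] unfolding c_def by (intro card_seteq) auto
    then show ?thesis by auto
  qed auto
  then have "R `` F = (\<Inter>\<C>) `` F" using R by blast
  then show "card F \<le> card ((\<Inter>\<C>) `` F)"
    using sub[OF R] F by (auto simp: Hall_relation_def)
qed

text \<open>
  Hall's marriage theorem for infinite families of finite sets, by Rado's argument: Hall's
  condition survives intersections of chains, and a minimal relation that satisfies it is a
  function, because two values at one point could not both be indispensable.
\<close>

theorem infinite_Hall:
  fixes N :: "('a \<times> 'b) set"
  assumes fin: "\<And>x. x \<in> A \<Longrightarrow> finite (N `` {x})" and hall: "Hall_relation A N"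
  obtains f where "\<And>x. x \<in> A \<Longrightarrow> (x, f x) \<in> N" "inj_on f A"
proof -
  define \<R> where "\<R> = {R. R \<subseteq> N \<and> Hall_relation A R}"
  have "\<exists>M\<in>uminus ` \<R>. \<forall>X\<in>uminus ` \<R>. M \<subseteq> X \<longrightarrow> X = M"
  proof (rule subset_Zorn)
    fix \<C> assume ch: "subset.chain (uminus ` \<R>) \<C>"
    show "\<exists>U\<in>uminus ` \<R>. \<forall>X\<in>\<C>. X \<subseteq> U"
    proof (cases "\<C> = {}")
      case True then show ?thesis using hall by (auto simp: \<R>_def)
    next
      case False
      have sub: "uminus ` \<C> \<subseteq> \<R>" using ch by (auto simp: subset.chain_def)
      have "Hall_relation A (\<Inter>(uminus ` \<C>))"
      proof (rule Hall_relation_Inter[OF fin])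
        fix R R' assume "R \<in> uminus ` \<C>" "R' \<in> uminus ` \<C>"
        then show "R \<subseteq> R' \<or> R' \<subseteq> R" using ch by (auto simp: subset.chain_def) blast
      qed (use sub False in \<open>auto simp: \<R>_def\<close>)
      moreover have "\<Inter>(uminus ` \<C>) \<subseteq> N" using sub False by (auto simp: \<R>_def)
      ultimately have "\<Inter>(uminus ` \<C>) \<in> \<R>" by (simp add: \<R>_def)
      then have "- \<Inter>(uminus ` \<C>) \<in> uminus ` \<R>" by (rule imageI)
      moreover have "\<forall>X\<in>\<C>. X \<subseteq> - \<Inter>(uminus ` \<C>)" by auto
      ultimately show ?thesis by blast
    qed
  qed
  then obtain R where R: "R \<in> \<R>" and min: "\<And>R'. R' \<in> \<R> \<Longrightarrow> R' \<subseteq> R \<Longrightarrow> R' = R"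
    by (auto simp: image_iff)
  have RN: "R \<subseteq> N" and hR: "\<And>F. finite F \<Longrightarrow> F \<subseteq> A \<Longrightarrow> card F \<le> card (R `` F)"
    using R by (auto simp: \<R>_def Hall_relation_def)
  have finR: "finite (R `` F)" if "finite F" "F \<subseteq> A" for F
  proof (rule finite_subset)
    show "R `` F \<subseteq> (\<Union>x\<in>F. N `` {x})" using RN by auto
    show "finite (\<Union>x\<in>F. N `` {x})" using that fin by auto
  qed
  have need: "\<exists>F. finite F \<and> F \<subseteq> A \<and> x \<notin> F \<and> card (R `` F \<union> (R `` {x} - {a})) \<le> card F"
    if "x \<in> A" "(x, a) \<in> R" for x a
  proof -
    have "R - {(x, a)} \<notin> \<R>" using min[of "R - {(x, a)}"] that by auto
    then obtain F where F: "finite F" "F \<subseteq> A" "card ((R - {(x, a)}) `` F) < card F"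
      using RN by (auto simp: \<R>_def Hall_relation_def not_le)
    have "x \<in> F"
    proof (rule ccontr)
      assume "x \<notin> F"
      then have "(R - {(x, a)}) `` F = R `` F" by auto
      then show False using F hR[of F] by auto
    qed
    have e1: "(R - {(x, a)}) `` F = R `` (F - {x}) \<union> (R `` {x} - {a})" using \<open>x \<in> F\<close> by blast
    have e2: "card F = Suc (card (F - {x}))" by (rule card.remove[OF F(1) \<open>x \<in> F\<close>])
    from F(3)[unfolded e1 e2]
    have "card (R `` (F - {x}) \<union> (R `` {x} - {a})) \<le> card (F - {x})"
      by (rule less_Suc_eq_le[THEN iffD1])
    moreover have "finite (F - {x})" "F - {x} \<subseteq> A" "x \<notin> F - {x}" using F by auto
    ultimately show ?thesis by blast
  qed
  have single: "a = b" if x: "x \<in> A" "(x, a) \<in> R" "(x, b) \<in> R" for x a b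
  proof (rule ccontr)
    assume "a \<noteq> b"
    from need[OF x(1,2)] obtain F where F: "finite F" "F \<subseteq> A" "x \<notin> F"
      "card (R `` F \<union> (R `` {x} - {a})) \<le> card F" by (elim exE conjE)
    from need[OF x(1,3)] obtain J where J: "finite J" "J \<subseteq> A" "x \<notin> J"
      "card (R `` J \<union> (R `` {x} - {b})) \<le> card J" by (elim exE conjE)
    let ?P = "R `` F \<union> (R `` {x} - {a})" and ?Q = "R `` J \<union> (R `` {x} - {b})"
    have finP: "finite ?P" "finite ?Q" using F J finR[of F] finR[of J] finR[of "{x}"] x by auto
    have e: "?P \<union> ?Q = R `` insert x (F \<union> J)" using \<open>a \<noteq> b\<close> by blast
    have "card (insert x (F \<union> J)) = Suc (card (F \<union> J))" using F J by (intro card_insert_disjoint) auto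
    then have 1: "Suc (card (F \<union> J)) \<le> card (?P \<union> ?Q)"
      using hR[of "insert x (F \<union> J)"] F(1,2) J(1,2) x(1) unfolding e by simp
    have "R `` (F \<inter> J) \<subseteq> ?P \<inter> ?Q" by auto
    then have 2: "card (F \<inter> J) \<le> card (?P \<inter> ?Q)"
      using hR[of "F \<inter> J"] F(1,2) finP card_mono[of "?P \<inter> ?Q" "R `` (F \<inter> J)"]
      by (meson finite_Int inf.coboundedI1 le_trans)
    have "card ?P + card ?Q = card (?P \<union> ?Q) + card (?P \<inter> ?Q)"
      using finP by (rule card_Un_Int)
    moreover have "card F + card J = card (F \<union> J) + card (F \<inter> J)"
      using F(1) J(1) by (rule card_Un_Int)
    ultimately show False using 1 2 F(4) J(4) by linarith
  qed
  have ex: "\<exists>a. (x, a) \<in> R" if "x \<in> A" for x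
    using hR[of "{x}"] that by (cases "R `` {x} = {}") auto
  then obtain f where f: "\<And>x. x \<in> A \<Longrightarrow> (x, f x) \<in> R" by metis
  have "inj_on f A"
  proof (rule inj_onI, rule ccontr)
    fix x y assume xy: "x \<in> A" "y \<in> A" "f x = f y" "x \<noteq> y"
    have "R `` {x, y} \<subseteq> {f x}"
    proof
      fix z assume "z \<in> R `` {x, y}"
      then have "(x, z) \<in> R \<or> (y, z) \<in> R" by auto
      then show "z \<in> {f x}" using single[OF xy(1) f[OF xy(1)]] single[OF xy(2) f[OF xy(2)]] xy(3) by auto
    qed
    then have "card (R `` {x, y}) \<le> card {f x}" by (intro card_mono) auto
    then show False using hR[of "{x, y}"] xy by simp
  qed
  moreover have "(x, f x) \<in> N" if "x \<in> A" for x using RN f[OF that] by auto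
  ultimately show ?thesis using that by blast
qed

lemma translates_mono: "F \<subseteq> F' \<Longrightarrow> translates \<phi> S F \<subseteq> translates \<phi> S F'"
  by (auto simp: translates_def)

lemma translates_Un: "translates \<phi> S (F \<union> F') = translates \<phi> S F \<union> translates \<phi> S F'"
  by (auto simp: translates_def)

lemma finite_translates: "finite S \<Longrightarrow> finite F \<Longrightarrow> finite (translates \<phi> S F)"
  by (auto simp: translates_def)

context space_action
begin

lemma Hall_matching:
  assumes S: "finite S" "S \<subseteq> carrier G"
    and hall: "\<And>F. finite F \<Longrightarrow> F \<subseteq> A \<Longrightarrow> card F \<le> card (translates \<phi> S F \<inter> B)"
  obtains l where "matching \<phi> S UNIV A B l" "dom l = A"
proof -
  define N where "N = {(x, y). \<exists>s\<in>S. y = \<phi> s x \<and> y \<in> B}"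
  have N: "N `` F = translates \<phi> S F \<inter> B" for F by (auto simp: N_def translates_def)
  have fin: "finite (N `` {x})" for x unfolding N using S by (simp add: finite_translates)
  have "Hall_relation A N" unfolding Hall_relation_def N using hall by blast
  then obtain f where f: "\<And>x. x \<in> A \<Longrightarrow> (x, f x) \<in> N" and inj: "inj_on f A"
    using infinite_Hall[OF fin] by blast
  define l where "l x = (if x \<in> A then Some (SOME s. s \<in> S \<and> f x = \<phi> s x) else None)" for x
  have l: "s \<in> S \<and> f x = \<phi> s x" if "l x = Some s" for x s
  proof -
    have "\<exists>s. s \<in> S \<and> f x = \<phi> s x" using that f by (auto simp: l_def N_def split: if_splits)
    from someI_ex[OF this] show ?thesis using that by (auto simp: l_def split: if_splits)
  qed
  have dom: "dom l = A" by (auto simp: l_def split: if_splits)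
  have "matching \<phi> S UNIV A B l"
  proof (rule matchingI)
    fix x s assume a: "l x = Some s"
    then have "x \<in> A" using dom by auto
    then show "x \<in> A \<and> s \<in> S \<and> \<phi> s x \<in> B" using l[OF a] f[of x] by (auto simp: N_def)
  next
    fix x y s t assume a: "l x = Some s" "l y = Some t" "\<phi> s x = \<phi> t y"
    then have "x \<in> A" "y \<in> A" "f x = f y" using dom l by auto
    then show "x = y" using inj by (meson inj_onD)
  qed auto
  then show ?thesis using that dom by blast
qed

lemma translates_translates:
  assumes "S \<subseteq> carrier G" "T \<subseteq> carrier G"
  shows "translates \<phi> T (translates \<phi> S X) = translates \<phi> ((\<lambda>(t, s). t \<otimes> s) ` (T \<times> S)) X"
  using assms by (force simp: translates_def act_mult subset_iff)

end

locale borel_action = space_action G \<phi>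
  for G :: "('g, 'm) monoid_scheme" (structure) and \<phi> :: "'g \<Rightarrow> 'a::polish_space \<Rightarrow> 'a" +
  assumes act_borel: "g \<in> carrier G \<Longrightarrow> \<phi> g \<in> borel_measurable borel"

lemma locally_compact_nbhd:
  fixes A :: "'a::t2_space set"
  assumes "locally_compact_space (euclidean :: 'a topology)" "compact (closure A)"
  obtains V where "open V" "A \<subseteq> V" "compact (closure V)"
proof -
  have "\<exists>U K. open U \<and> compact K \<and> x \<in> U \<and> U \<subseteq> K" for x :: 'a
    using assms(1) unfolding locally_compact_space_def by auto
  then obtain U K where UK: "\<And>x :: 'a. open (U x) \<and> compact (K x) \<and> x \<in> U x \<and> U x \<subseteq> K x"
    by metis
  have "closure A \<subseteq> (\<Union>x\<in>UNIV. U x)" using UK by blast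
  then obtain D where D: "finite D" "closure A \<subseteq> (\<Union>x\<in>D. U x)"
    using compactE_image[OF assms(2), of UNIV U] UK by (metis UNIV_I subset_UNIV)
  have cK: "compact (\<Union>x\<in>D. K x)" using D UK by auto
  moreover have "closure (\<Union>x\<in>D. U x) \<subseteq> (\<Union>x\<in>D. K x)"
    using UK compact_imp_closed[OF cK] by (intro closure_minimal) blast+
  ultimately have "compact (closure (\<Union>x\<in>D. U x))" using cK
    by (metis closed_closure compact_Int_closed inf.absorb_iff2)
  then show ?thesis using that[of "\<Union>x\<in>D. U x"] D UK closure_subset by blast
qed

lemma compact_closure_subset:
  fixes A B :: "'a::t2_space set"
  assumes "compact (closure B)" "A \<subseteq> B"
  shows "compact (closure A)"
  using assms by (metis closed_closure closure_mono compact_Int_closed inf.absorb_iff2)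

context borel_action
begin

text \<open>
  An open singleton would be equidecomposable to a relatively compact open set that contains two points.
\<close>

lemma no_isolated_points:
  assumes parad: "paradoxical_action G \<phi>" and "p \<noteq> (q :: 'a)"
  shows "\<not> open {r :: 'a}"
proof
  assume r: "open {r}"
  obtain q' where q': "q' \<noteq> r" using \<open>p \<noteq> q\<close> by metis
  have lc: "locally_compact_space (euclidean :: 'a topology)"
    using parad by (simp add: paradoxical_action_def)
  obtain V where V: "open V" "{q', r} \<subseteq> V" "compact (closure V)"
    using locally_compact_nbhd[OF lc, of "{q', r}"] by auto
  have "interior V \<noteq> {}" using V by (auto simp: interior_open)
  moreover have "interior {r} \<noteq> {}" using r by (simp add: interior_open)
  ultimately have "equidecomposable G \<phi> UNIV V {r}"
    using parad V(3) unfolding paradoxical_action_def by (metis closed_singleton closure_closed compact_sing)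
  then obtain S l where "perfect_matching \<phi> S UNIV V {r} l"
    using perfect_matching_if_equidecomposable by metis
  then have "inj_on (move \<phi> l) V" "move \<phi> l ` V = {r}"
    by (auto simp: perfect_matching_def matching_def)
  then have "q' = r" using V(2) by (metis (no_types, lifting) imageI inj_onD insert_subset singletonD)
  then show False using q' by simp
qed

lemma disjoint_open_subsets:
  assumes iso: "\<And>r. \<not> open {r :: 'a}" and "open W" "W \<noteq> {}"
  shows "\<exists>\<U>. finite \<U> \<and> card \<U> = n \<and> disjoint \<U> \<and>
           (\<forall>X\<in>\<U>. open X \<and> X \<noteq> {} \<and> X \<subseteq> (W :: 'a set))"
  using assms(2,3)
proof (induction n arbitrary: W)
  case 0
  show ?case by (intro exI[of _ "{}"]) auto
next
  case (Suc n)
  obtain x where x: "x \<in> W" using Suc.prems by auto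
  have "W \<noteq> {x}" using iso[of x] Suc.prems by auto
  then obtain y where y: "y \<in> W" "y \<noteq> x" using x by blast
  obtain P Q where PQ: "open P" "open Q" "x \<in> P" "y \<in> Q" "P \<inter> Q = {}"
    using hausdorff[OF y(2)[symmetric]] by auto
  have "open (W \<inter> Q)" "W \<inter> Q \<noteq> {}" using Suc.prems PQ y by auto
  from Suc.IH[OF this] obtain \<U> where U: "finite \<U>" "card \<U> = n" "disjoint \<U>"
    "\<forall>X\<in>\<U>. open X \<and> X \<noteq> {} \<and> X \<subseteq> W \<inter> Q" by (elim exE conjE)
  have new: "W \<inter> P \<notin> \<U>"
  proof
    assume "W \<inter> P \<in> \<U>"
    then have "W \<inter> P \<subseteq> W \<inter> Q" using U(4) by simp
    moreover have "x \<in> W \<inter> P" using x PQ by simp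
    ultimately show False using PQ(5) by auto
  qed
  have "disjoint (insert (W \<inter> P) \<U>)"
  proof -
    have "W \<inter> P \<inter> X = {}" if "X \<in> \<U>" for X
    proof -
      have "X \<subseteq> W \<inter> Q" using U(4) that by simp
      then show ?thesis using PQ(5) by auto
    qed
    then show ?thesis using U(3) by (auto simp: disjoint_def)
  qed
  moreover have "\<forall>X\<in>insert (W \<inter> P) \<U>. open X \<and> X \<noteq> {} \<and> X \<subseteq> W"
    using U(4) Suc.prems PQ x by auto
  ultimately show ?case
    using U(1,2) new by (intro exI[of _ "insert (W \<inter> P) \<U>"]) auto
qed

text \<open>
  The covering set \<open>B\<close> captures an open set with finitely many, say \<open>n\<close>, translates. Inside that
  open set there is room for \<open>2n\<close> disjoint equidecomposable copies of a neighbourhood of \<open>A\<close>, and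
  folding them back into \<open>B\<close> is at most \<open>n\<close>-to-one.
\<close>

lemma paradoxical_expansion:
  assumes parad: "paradoxical_action G \<phi>" and "p \<noteq> (q :: 'a)"
    and A: "compact (closure A)" and B: "B \<in> relcompact_covering G \<phi>"
  obtains S where "finite S" "S \<subseteq> carrier G"
    "\<And>F. finite F \<Longrightarrow> F \<subseteq> A \<Longrightarrow> 2 * card F \<le> card (translates \<phi> S F \<inter> B)"
proof -
  have lc: "locally_compact_space (euclidean :: 'a topology)"
    using parad by (simp add: paradoxical_action_def)
  obtain U T where U: "open U" "U \<noteq> {}" and T: "finite T" "T \<subseteq> carrier G" "U \<subseteq> translates \<phi> T B"
    using B unfolding relcompact_covering_def covers_def by auto
  obtain u where u: "u \<in> U" using U by auto
  have comp: "compact (closure (A \<union> {u}))" using A by (simp add: closure_insert)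
  obtain V where V: "open V" "A \<union> {u} \<subseteq> V" "compact (closure V)"
    using locally_compact_nbhd[OF lc comp] by auto
  have "T \<noteq> {}" using u T(3) by (auto simp: translates_def)
  then have n: "card T > 0" using T by (simp add: card_gt_0_iff)
  have W: "open (U \<inter> V)" "U \<inter> V \<noteq> {}" using U V u by auto
  obtain \<U> where fU: "finite \<U>" and cU: "card \<U> = 2 * card T" and dU: "disjoint \<U>"
    and oU: "\<And>X. X \<in> \<U> \<Longrightarrow> open X \<and> X \<noteq> {} \<and> X \<subseteq> U \<inter> V"
    using disjoint_open_subsets[OF no_isolated_points[OF parad \<open>p \<noteq> q\<close>] W, of "2 * card T"] by blast
  have "\<exists>S l. finite S \<and> S \<subseteq> carrier G \<and> perfect_matching \<phi> S UNIV V X l" if X: "X \<in> \<U>" for X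
  proof -
    have "compact (closure X)" using oU[OF X] compact_closure_subset[OF V(3)] by auto
    moreover have "interior X \<noteq> {}" "interior V \<noteq> {}"
      using oU[OF X] V by (auto simp: interior_open)
    ultimately have "equidecomposable G \<phi> UNIV V X"
      using parad V(3) unfolding paradoxical_action_def by blast
    then show ?thesis by (metis perfect_matching_if_equidecomposable)
  qed
  then obtain S l where fS: "\<And>X. X \<in> \<U> \<Longrightarrow> finite (S X)" and cS: "\<And>X. X \<in> \<U> \<Longrightarrow> S X \<subseteq> carrier G"
    and l: "\<And>X. X \<in> \<U> \<Longrightarrow> perfect_matching \<phi> (S X) UNIV V X (l X)" by metis
  define S0 where "S0 = (\<Union>X\<in>\<U>. S X)"
  have S0: "finite S0" "S0 \<subseteq> carrier G" using fU fS cS by (auto simp: S0_def)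
  define R where "R = (\<lambda>(t, s). inv t \<otimes> s) ` (T \<times> S0)"
  have R: "finite R" "R \<subseteq> carrier G" using S0 T by (auto simp: R_def)
  have "2 * card F \<le> card (translates \<phi> R F \<inter> B)" if F: "finite F" "F \<subseteq> A" for F
  proof -
    define Y where "Y = (\<Union>X\<in>\<U>. move \<phi> (l X) ` F)"
    have FV: "F \<subseteq> V" using F V by auto
    have img: "move \<phi> (l X) ` F \<subseteq> X \<inter> translates \<phi> S0 F" if X: "X \<in> \<U>" for X
    proof
      fix y assume "y \<in> move \<phi> (l X) ` F"
      then obtain x where x: "x \<in> F" "y = move \<phi> (l X) x" by auto
      obtain s where s: "l X x = Some s" using l[OF X] x FV by (auto simp: perfect_matching_def)
      have "s \<in> S X" "\<phi> s x \<in> X"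
        using matching_Some[OF perfect_matchingD(1)[OF l[OF X]] s] by auto
      then show "y \<in> X \<inter> translates \<phi> S0 F"
        using x s X by (auto simp: move_def translates_def S0_def)
    qed
    have "card Y = (\<Sum>X\<in>\<U>. card (move \<phi> (l X) ` F))"
      unfolding Y_def
    proof (rule card_UN_disjoint[OF fU])
      show "\<forall>X\<in>\<U>. finite (move \<phi> (l X) ` F)" using F by auto
      show "\<forall>X\<in>\<U>. \<forall>X'\<in>\<U>. X \<noteq> X' \<longrightarrow> move \<phi> (l X) ` F \<inter> move \<phi> (l X') ` F = {}"
      proof (intro ballI impI)
        fix X X' assume X: "X \<in> \<U>" "X' \<in> \<U>" "X \<noteq> X'"
        then have "X \<inter> X' = {}" using dU by (simp add: disjoint_def)
        then show "move \<phi> (l X) ` F \<inter> move \<phi> (l X') ` F = {}"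
          using img[OF X(1)] img[OF X(2)] by blast
      qed
    qed
    also have "\<dots> = (\<Sum>X\<in>\<U>. card F)"
    proof (rule sum.cong[OF refl])
      fix X assume X: "X \<in> \<U>"
      have "inj_on (move \<phi> (l X)) V" using l[OF X] by (auto simp: perfect_matching_def matching_def)
      then show "card (move \<phi> (l X) ` F) = card F" using FV by (meson card_image inj_on_subset)
    qed
    finally have cY: "card Y = 2 * card T * card F" using cU by simp
    define Z where "Z = translates \<phi> R F \<inter> B"
    have fZ: "finite Z" using R F by (simp add: Z_def finite_translates)
    have "Y \<subseteq> (\<Union>t\<in>T. \<phi> t ` Z)"
    proof
      fix y assume "y \<in> Y"
      then obtain X where X: "X \<in> \<U>" "y \<in> move \<phi> (l X) ` F" by (auto simp: Y_def)
      then have yU: "y \<in> U" "y \<in> translates \<phi> S0 F" using img[OF X(1)] oU[OF X(1)] by blast+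
      obtain t b where t: "t \<in> T" "b \<in> B" "y = \<phi> t b"
        using yU T(3) by (auto simp: translates_def)
      obtain s x where s: "s \<in> S0" "x \<in> F" "y = \<phi> s x"
        using yU(2) by (auto simp: translates_def)
      have tc: "t \<in> carrier G" "s \<in> carrier G" using t(1) s(1) T(2) S0(2) by auto
      have "b = \<phi> (inv t) y" using t tc by simp
      also have "\<dots> = \<phi> (inv t \<otimes> s) x" using s tc by (simp add: act_mult)
      finally have "b \<in> Z" using t s by (force simp: Z_def translates_def R_def)
      then show "y \<in> (\<Union>t\<in>T. \<phi> t ` Z)" using t by auto
    qed
    then have "card Y \<le> card (\<Union>t\<in>T. \<phi> t ` Z)" using T(1) fZ by (intro card_mono) auto
    also have "\<dots> \<le> (\<Sum>t\<in>T. card (\<phi> t ` Z))" using T(1) by (rule card_UN_le)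
    also have "\<dots> \<le> (\<Sum>t\<in>T. card Z)" using fZ by (intro sum_mono card_image_le)
    finally have "card T * (2 * card F) \<le> card T * card Z" using cY by (simp add: algebra_simps)
    then show ?thesis using n by (simp add: Z_def)
  qed
  then show ?thesis using that R by blast
qed

text \<open>
  Expansion of single points already means that finitely many elements suffice to move every point
  of \<open>A\<close> into \<open>B\<close>.
\<close>

lemma paradoxical_covers:
  assumes "paradoxical_action G \<phi>" "p \<noteq> (q :: 'a)"
    and "compact (closure A)" "B \<in> relcompact_covering G \<phi>"
  shows "covers G \<phi> B A"
proof -
  obtain S where S: "finite S" "S \<subseteq> carrier G"
    and ex: "\<And>F. finite F \<Longrightarrow> F \<subseteq> A \<Longrightarrow> 2 * card F \<le> card (translates \<phi> S F \<inter> B)"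
    using paradoxical_expansion[OF assms] by metis
  have "A \<subseteq> translates \<phi> ((\<lambda>s. inv s) ` S) B"
  proof
    fix x assume "x \<in> A"
    then have "translates \<phi> S {x} \<inter> B \<noteq> {}" using ex[of "{x}"] by auto
    then obtain s where s: "s \<in> S" "\<phi> s x \<in> B" by (auto simp: translates_def)
    then have "x = \<phi> (inv s) (\<phi> s x)" using S by auto
    then show "x \<in> translates \<phi> ((\<lambda>s. inv s) ` S) B" using s by (auto simp: translates_def)
  qed
  then show ?thesis
    unfolding covers_def using S by (intro exI[of _ "(\<lambda>s. inv s) ` S"]) auto
qed

end

section \<open>Meager sets and the property of Baire\<close>

lemma meager_subset:
  assumes "meager S" "S' \<subseteq> S"
  shows "meager S'"
proof -
  obtain F where F: "countable F" "\<And>T. T \<in> F \<Longrightarrow> nowhere_dense T" "S = \<Union>F"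
    using assms(1) unfolding meager_def by auto
  have "nowhere_dense (T \<inter> S')" if "T \<in> F" for T
    using F(2)[OF that] interior_mono[OF closure_mono[of "T \<inter> S'" T]]
    unfolding nowhere_dense_def by auto
  moreover have "S' = \<Union>((\<lambda>T. T \<inter> S') ` F)" using F(3) assms(2) by auto
  ultimately show ?thesis
    unfolding meager_def using F(1) by (intro exI[of _ "(\<lambda>T. T \<inter> S') ` F"]) auto
qed

lemma meager_Union:
  assumes "countable \<Z>" "\<And>Z. Z \<in> \<Z> \<Longrightarrow> meager Z"
  shows "meager (\<Union>\<Z>)"
proof -
  have "\<forall>Z\<in>\<Z>. \<exists>F. countable F \<and> (\<forall>T\<in>F. nowhere_dense T) \<and> Z = \<Union>F"
    using assms(2) unfolding meager_def by blast
  from bchoice[OF this] obtain F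
    where F: "\<forall>Z\<in>\<Z>. countable (F Z) \<and> (\<forall>T\<in>F Z. nowhere_dense T) \<and> Z = \<Union>(F Z)"
    by (elim exE)
  have "\<Union>\<Z> = \<Union>(\<Union>Z\<in>\<Z>. F Z)"
  proof -
    have "(\<Union>Z\<in>\<Z>. \<Union>(F Z)) = \<Union>\<Z>" using F by (metis (no_types, lifting) SUP_cong image_ident)
    then show ?thesis unfolding UN_UN_flatten[of "\<lambda>x. x", simplified] by simp
  qed
  moreover have "countable (\<Union>Z\<in>\<Z>. F Z)" using F assms(1) by (intro countable_UN) auto
  moreover have "\<forall>T\<in>(\<Union>Z\<in>\<Z>. F Z). nowhere_dense T" using F by simp
  ultimately show ?thesis unfolding meager_def by (intro exI conjI)
qed

lemma nowhere_dense_imp_meager: "nowhere_dense S \<Longrightarrow> meager S"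
  unfolding meager_def by (intro exI[of _ "{S}"]) auto

lemma meager_empty [simp]: "meager {}"
  by (rule nowhere_dense_imp_meager) (simp add: nowhere_dense_def)

lemma meager_Un: "meager S \<Longrightarrow> meager T \<Longrightarrow> meager (S \<union> T)"
  using meager_Union[of "{S, T}"] by auto

lemma meager_UN: "(\<And>n::nat. meager (Z n)) \<Longrightarrow> meager (\<Union>n. Z n)"
  using meager_Union[of "range Z"] by auto

lemma meager_borel_hull:
  fixes S :: "'a::topological_space set"
  assumes "meager S"
  obtains Z where "Z \<in> sets borel" "meager Z" "S \<subseteq> Z"
proof -
  obtain F where F: "countable F" "\<And>T. T \<in> F \<Longrightarrow> nowhere_dense T" "S = \<Union>F"
    using assms(1) unfolding meager_def by auto
  have "\<Union>(closure ` F) \<in> sets borel" using F(1) by (intro sets.countable_Union) auto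
  moreover have "meager (\<Union>(closure ` F))"
    using F by (intro meager_Union) (auto intro!: nowhere_dense_imp_meager simp: nowhere_dense_def)
  moreover have "S \<subseteq> \<Union>(closure ` F)" unfolding F(3) using closure_subset by blast
  ultimately show ?thesis using that by blast
qed

text \<open>The Baire category theorem.\<close>

lemma meager_open_empty:
  fixes S :: "'a::complete_space set"
  assumes "meager S" "open S"
  shows "S = {}"
proof -
  obtain F where F: "countable F" "\<And>T. T \<in> F \<Longrightarrow> nowhere_dense T" "S = \<Union>F"
    using assms(1) unfolding meager_def by auto
  have "euclidean interior_of \<Union>(closure ` F) = {}"
    using F by (intro Baire_category_alt) (auto simp: completely_metrizable_space_euclidean nowhere_dense_def)
  then have "interior (\<Union>(closure ` F)) = {}" by simp
  moreover have "S \<subseteq> \<Union>(closure ` F)" unfolding F(3) using closure_subset by blast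
  ultimately show ?thesis using interior_maximal[OF _ assms(2), of "\<Union>(closure ` F)"] by simp
qed

lemma meager_closed_diff_interior:
  assumes "closed C"
  shows "meager (C - interior C)"
proof -
  have "closed (C - interior C)" using assms by auto
  moreover have "interior (C - interior C) = {}"
    using interior_mono[of "C - interior C" C] interior_subset[of "C - interior C"] by auto
  ultimately show ?thesis by (intro nowhere_dense_imp_meager) (simp add: nowhere_dense_def)
qed

lemma sigma_algebra_baire: "sigma_algebra UNIV (baire_property_sets :: 'a::topological_space set set)"
  unfolding sigma_algebra_iff2
proof (intro conjI ballI allI impI)
  show "baire_property_sets \<subseteq> Pow (UNIV :: 'a set)" by simp
  show "{} \<in> (baire_property_sets :: 'a set set)"
    unfolding baire_property_sets_def by (auto intro!: exI[of _ "{}"])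
next
  fix S :: "'a set" assume "S \<in> baire_property_sets"
  then obtain U where U: "open U" "meager (sym_diff S U)" by (auto simp: baire_property_sets_def)
  have "sym_diff (UNIV - S) (interior (- U)) \<subseteq> sym_diff S U \<union> (- U - interior (- U))"
    using interior_subset[of "- U"] by auto
  then have "meager (sym_diff (UNIV - S) (interior (- U)))"
    using meager_subset meager_Un[OF U(2) meager_closed_diff_interior[of "- U"]] U(1) by blast
  then show "UNIV - S \<in> baire_property_sets" unfolding baire_property_sets_def by blast
next
  fix A :: "nat \<Rightarrow> 'a set" assume "range A \<subseteq> baire_property_sets"
  then have "\<forall>n. \<exists>U. open U \<and> meager (sym_diff (A n) U)" by (auto simp: baire_property_sets_def)
  then obtain U where U: "\<And>n. open (U n)" "\<And>n. meager (sym_diff (A n) (U n))" by metis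
  have "sym_diff (\<Union>n. A n) (\<Union>n. U n) \<subseteq> (\<Union>n. sym_diff (A n) (U n))" by auto
  then have "meager (sym_diff (\<Union>n. A n) (\<Union>n. U n))"
    using meager_subset meager_UN[of "\<lambda>n. sym_diff (A n) (U n)"] U(2) by blast
  then show "(\<Union>n. A n) \<in> baire_property_sets"
    using U(1) unfolding baire_property_sets_def by blast
qed

lemma borel_subset_baire: "sets borel \<subseteq> (baire_property_sets :: 'a::topological_space set set)"
proof -
  have "{S :: 'a set. open S} \<subseteq> baire_property_sets"
    by (auto simp: baire_property_sets_def intro!: exI)
  then show ?thesis
    using sigma_algebra.sigma_sets_subset[OF sigma_algebra_baire] by (simp add: sets_borel)
qed

lemma nonmeager_baire:
  assumes "S \<in> baire_property_sets" "\<not> meager S"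
  obtains U where "open U" "U \<noteq> {}" "meager (U - S)"
proof -
  obtain U where U: "open U" "meager (sym_diff S U)" using assms by (auto simp: baire_property_sets_def)
  have "U \<noteq> {}"
  proof
    assume "U = {}" then show False using U assms(2) by simp
  qed
  moreover have "meager (U - S)" using U(2) by (rule meager_subset) auto
  ultimately show ?thesis using that U by blast
qed

lemma baire_borel_off_meager:
  assumes "S \<in> baire_property_sets"
  obtains Z where "Z \<in> sets borel" "meager Z" "S - Z \<in> sets borel"
proof -
  obtain U where U: "open U" "meager (sym_diff S U)" using assms by (auto simp: baire_property_sets_def)
  obtain Z where Z: "Z \<in> sets borel" "meager Z" "sym_diff S U \<subseteq> Z" using meager_borel_hull U(2) by blast
  have "S - Z = U - Z" using Z(3) by auto
  then have "S - Z \<in> sets borel" using U Z by simp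
  then show ?thesis using that Z by blast
qed

context space_action
begin

text \<open>
  Finitely many elements and their inverses generate an invariant set in countably many steps, so every
  sigma-ideal that the action respects has invariant hulls.
\<close>

lemma invariant_hull:
  assumes S: "finite S" "S \<subseteq> carrier G" and "N \<in> \<I>"
    and un: "\<And>\<Z>. countable \<Z> \<Longrightarrow> \<Z> \<subseteq> \<I> \<Longrightarrow> \<Union>\<Z> \<in> \<I>"
    and act: "\<And>g Z. g \<in> carrier G \<Longrightarrow> Z \<in> \<I> \<Longrightarrow> \<phi> g ` Z \<in> \<I>"
  obtains N' where "N' \<in> \<I>" "N \<subseteq> N'" "\<And>g. g \<in> S \<Longrightarrow> \<phi> g ` N' = N'"
proof -
  define S' where "S' = S \<union> (\<lambda>g. inv g) ` S"
  define step where "step Z = \<Union>(insert Z ((\<lambda>g. \<phi> g ` Z) ` S'))" for Z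
  define Z where "Z n = (step ^^ n) N" for n
  have S': "finite S'" "S' \<subseteq> carrier G" using S by (auto simp: S'_def)
  have ZI: "Z n \<in> \<I>" for n
  proof (induction n)
    case (Suc n)
    have "step (Z n) \<in> \<I>" unfolding step_def
      using Suc S' act by (intro un) (auto intro: countable_finite)
    then show ?case by (simp add: Z_def)
  qed (simp add: Z_def \<open>N \<in> \<I>\<close>)
  have step: "\<phi> g x \<in> (\<Union>n. Z n)" if g: "g \<in> S'" and x: "x \<in> (\<Union>n. Z n)" for g x
  proof -
    obtain n where "x \<in> Z n" using x by auto
    then have "\<phi> g x \<in> Z (Suc n)" using g by (auto simp: Z_def step_def)
    then show ?thesis by blast
  qed
  have "(\<Union>n. Z n) \<in> \<I>" using ZI by (intro un) auto
  moreover have "N \<subseteq> (\<Union>n. Z n)"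
  proof -
    have "Z 0 = N" by (simp add: Z_def)
    then show ?thesis by blast
  qed
  moreover have "\<phi> g ` (\<Union>n. Z n) = (\<Union>n. Z n)" if g: "g \<in> S" for g
  proof (intro equalityI subsetI)
    fix x assume "x \<in> \<phi> g ` (\<Union>n. Z n)"
    then show "x \<in> (\<Union>n. Z n)" using step g by (auto simp: S'_def)
  next
    fix x assume "x \<in> (\<Union>n. Z n)"
    then have "\<phi> (inv g) x \<in> (\<Union>n. Z n)" using step[of "inv g" x] g by (auto simp: S'_def)
    moreover have "x = \<phi> g (\<phi> (inv g) x)" using g S by auto
    ultimately show "x \<in> \<phi> g ` (\<Union>n. Z n)" by (metis imageI)
  qed
  ultimately show ?thesis using that by blast
qed

lemma invariant_Compl:
  assumes "g \<in> carrier G" "\<phi> g ` V = V"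
  shows "\<phi> g ` (- V) = - V"
  using assms bij_image_Compl_eq[of "\<phi> g" V] surj_prop[of g] act_inj[of g] by (simp add: bij_def)

lemma invariant_Int:
  assumes "g \<in> carrier G" "\<phi> g ` V = V" "\<phi> g ` W = W"
  shows "\<phi> g ` (V \<inter> W) = V \<inter> W"
  using assms image_Int[OF act_inj] by simp

end

section \<open>Matchings off a meager set\<close>

definition connected_by :: "('a \<times> 'a) set \<Rightarrow> 'a set \<Rightarrow> bool" where
  "connected_by r F \<longleftrightarrow> (\<forall>F'\<subseteq>F. F' \<noteq> {} \<longrightarrow> F' \<noteq> F \<longrightarrow> (\<exists>p\<in>F'. \<exists>q\<in>F - F'. (p, q) \<in> r))"

text \<open>
  Each ball around \<open>p\<close> that does not exhaust \<open>F\<close> has a neighbour in \<open>F\<close> outside, so the balls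
  gain a point at every radius.
\<close>

lemma connected_by_growth:
  assumes F: "connected_by r F" "finite F" "p \<in> F" and "refl r"
  shows "Suc k \<le> card (F \<inter> (r ^^ k) `` {p}) \<or> F \<subseteq> (r ^^ k) `` {p}"
proof (induction k)
  case 0
  have "F \<inter> (r ^^ 0) `` {p} = {p}" using F(3) by auto
  then show ?case by simp
next
  case (Suc k)
  have mono: "(r ^^ k) `` {p} \<subseteq> (r ^^ Suc k) `` {p}" using \<open>refl r\<close> by (auto simp: refl_on_def)
  show ?case
  proof (cases "F \<subseteq> (r ^^ k) `` {p}")
    case True
    then show ?thesis using mono by blast
  next
    case False
    let ?F = "F \<inter> (r ^^ k) `` {p}"
    have c: "Suc k \<le> card ?F" using Suc False by simp
    then have "?F \<noteq> {}" by auto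
    moreover have "?F \<noteq> F" using False by blast
    ultimately obtain x y where xy: "x \<in> ?F" "y \<in> F - ?F" "(x, y) \<in> r"
      using F(1)[unfolded connected_by_def, rule_format, of ?F] by auto
    have "y \<in> (r ^^ Suc k) `` {p}" using xy by auto
    then have "insert y ?F \<subseteq> F \<inter> (r ^^ Suc k) `` {p}" using xy(2) mono by blast
    then have "card (insert y ?F) \<le> card (F \<inter> (r ^^ Suc k) `` {p})" using F(2) by (intro card_mono) auto
    moreover have "card (insert y ?F) = Suc (card ?F)" using F(2) xy(2) by (intro card_insert_disjoint) auto
    ultimately show ?thesis using c by linarith
  qed
qed

lemma connected_by_reach:
  assumes "connected_by r F" "finite F" "p \<in> F" "refl r"
  shows "F \<subseteq> (r ^^ card F) `` {p}"
proof -
  have "card (F \<inter> (r ^^ card F) `` {p}) \<le> card F" using assms(2) by (intro card_mono) auto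
  then show ?thesis using connected_by_growth[OF assms, of "card F"] by auto
qed

lemma sym_relpow:
  assumes "sym r"
  shows "sym (r ^^ n)"
proof (induction n)
  case (Suc n)
  show ?case
  proof (rule symI)
    fix x y assume "(x, y) \<in> r ^^ Suc n"
    then obtain z where "(x, z) \<in> r ^^ n" "(z, y) \<in> r" by auto
    then have "(y, z) \<in> r" "(z, x) \<in> r ^^ n" using Suc assms by (auto dest: symD)
    then show "(y, x) \<in> r ^^ Suc n" by (rule relpow_Suc_I2)
  qed
qed (auto simp: sym_def)

context space_action
begin

text \<open>Two points are adjacent if they have a common neighbour with respect to \<open>S\<close>.\<close>

definition links :: "'g set \<Rightarrow> 'g set" where
  "links S = insert \<one> ((\<lambda>(s, t). inv s \<otimes> t) ` (S \<times> S))"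

fun link_words :: "'g set \<Rightarrow> nat \<Rightarrow> 'g set" where
  "link_words S 0 = {\<one>}"
| "link_words S (Suc n) = (\<lambda>(e, h). e \<otimes> h) ` (links S \<times> link_words S n)"

definition adjacent :: "'g set \<Rightarrow> ('a \<times> 'a) set" where
  "adjacent S = {(x, y). \<exists>e\<in>links S. y = \<phi> e x}"

lemma links_closed: "S \<subseteq> carrier G \<Longrightarrow> links S \<subseteq> carrier G"
  by (auto simp: links_def)

lemma finite_links: "finite S \<Longrightarrow> finite (links S)"
  by (simp add: links_def)

lemma link_words_closed: "S \<subseteq> carrier G \<Longrightarrow> link_words S n \<subseteq> carrier G"
proof (induction n)
  case (Suc n)
  have "e \<otimes> h \<in> carrier G" if "e \<in> links S" "h \<in> link_words S n" for e h
    using that links_closed[OF Suc.prems] Suc.IH[OF Suc.prems] by (intro m_closed) auto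
  then show ?case by auto
qed simp

lemma finite_link_words: "finite S \<Longrightarrow> finite (link_words S n)"
  by (induction n) (auto simp: finite_links)

lemma refl_adjacent: "refl (adjacent S)"
proof (rule reflI)
  fix x
  have "\<one> \<in> links S" by (simp add: links_def)
  then show "(x, x) \<in> adjacent S" unfolding adjacent_def by (force intro!: bexI[of _ \<one>])
qed

lemma adjacentI:
  assumes "S \<subseteq> carrier G" "s \<in> S" "t \<in> S" "\<phi> s x = \<phi> t y"
  shows "(x, y) \<in> adjacent S"
proof -
  have c: "s \<in> carrier G" "t \<in> carrier G" using assms by auto
  have "y = \<phi> (inv t) (\<phi> t y)" using c by simp
  also have "\<dots> = \<phi> (inv t \<otimes> s) x" using c assms(4) by (simp add: act_mult)
  finally have "y = \<phi> (inv t \<otimes> s) x" .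
  moreover have "inv t \<otimes> s \<in> links S" using assms by (force simp: links_def)
  ultimately show ?thesis unfolding adjacent_def by blast
qed

lemma sym_adjacent:
  assumes "S \<subseteq> carrier G"
  shows "sym (adjacent S)"
proof (rule symI)
  fix x y assume "(x, y) \<in> adjacent S"
  then obtain e where e: "e \<in> links S" "y = \<phi> e x" by (auto simp: adjacent_def)
  show "(y, x) \<in> adjacent S"
  proof (cases "e = \<one>")
    case True
    then show ?thesis using e(2) refl_adjacent[of S] by (simp add: refl_on_def)
  next
    case False
    then obtain s t where st: "s \<in> S" "t \<in> S" "e = inv s \<otimes> t" using e by (auto simp: links_def)
    then have "\<phi> s y = \<phi> t x" using e assms by (auto simp: act_mult subset_iff)
    then show ?thesis using adjacentI assms st by blast
  qed
qed

lemma relpow_adjacent: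
  assumes "S \<subseteq> carrier G"
  shows "(x, y) \<in> adjacent S ^^ n \<longleftrightarrow> (\<exists>h\<in>link_words S n. y = \<phi> h x)"
proof (induction n arbitrary: y)
  case (Suc n)
  have c: "e \<in> carrier G" "h \<in> carrier G" if "e \<in> links S" "h \<in> link_words S n" for e h
    using that links_closed[OF assms] link_words_closed[OF assms, of n] by auto
  have "(x, y) \<in> adjacent S ^^ Suc n \<longleftrightarrow> (\<exists>h\<in>link_words S n. \<exists>e\<in>links S. y = \<phi> e (\<phi> h x))"
    using Suc.IH by (auto simp: adjacent_def relcomp_unfold)
  also have "\<dots> \<longleftrightarrow> (\<exists>h\<in>link_words S n. \<exists>e\<in>links S. y = \<phi> (e \<otimes> h) x)"
    using c by (simp add: act_mult cong: bex_cong)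
  also have "\<dots> \<longleftrightarrow> (\<exists>h\<in>link_words S (Suc n). y = \<phi> h x)" by auto
  finally show ?case .
qed auto

definition sparse :: "'g set \<Rightarrow> 'a set \<Rightarrow> bool" where
  "sparse H C \<longleftrightarrow> (\<forall>x\<in>C. \<forall>h\<in>H. \<phi> h x \<in> C \<longrightarrow> \<phi> h x = x)"

text \<open>
  A connected finite set that sees two points of a sparse set must bridge the gap between them, so
  it has many elements around each point that it sees.
\<close>

lemma sparse_hits_bound:
  assumes S: "S \<subseteq> carrier G" "finite S" "s \<in> S" and C: "sparse (link_words S (2 * k + 2)) C"
    and F: "connected_by (adjacent S) F" "finite F"
  defines "J \<equiv> translates \<phi> S F \<inter> \<phi> s ` C"
  shows "card J \<le> 1 \<or> card J * Suc k \<le> card F"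
proof (cases "card J \<le> 1")
  case False
  let ?r = "adjacent S"
  have fJ: "finite J" using S F by (simp add: J_def finite_translates)
  have "\<exists>p x. p \<in> F \<and> x \<in> C \<and> y = \<phi> s x \<and> (x, p) \<in> ?r" if y: "y \<in> J" for y
  proof -
    obtain t p x where t: "t \<in> S" "p \<in> F" "y = \<phi> t p" "x \<in> C" "y = \<phi> s x"
      using y by (auto simp: J_def translates_def)
    then have "(x, p) \<in> ?r" using adjacentI[OF S(1,3) t(1)] by metis
    then show ?thesis using t by blast
  qed
  then obtain p x where pF: "\<And>y. y \<in> J \<Longrightarrow> p y \<in> F" and xC: "\<And>y. y \<in> J \<Longrightarrow> x y \<in> C"
    and yx: "\<And>y. y \<in> J \<Longrightarrow> y = \<phi> s (x y)" and xp: "\<And>y. y \<in> J \<Longrightarrow> (x y, p y) \<in> ?r"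
    by metis
  define V where "V y = F \<inter> (?r ^^ k) `` {p y}" for y
  have dis: "(?r ^^ k) `` {p y} \<inter> (?r ^^ k) `` {p z} = {}" if yz: "y \<in> J" "z \<in> J" "y \<noteq> z" for y z
  proof (rule ccontr)
    assume "\<not> ?thesis"
    then obtain q where q: "(p y, q) \<in> ?r ^^ k" "(p z, q) \<in> ?r ^^ k" by auto
    have sym: "sym (?r ^^ k)" by (rule sym_relpow[OF sym_adjacent[OF S(1)]])
    have "(q, p z) \<in> ?r ^^ k" using q(2) sym by (meson symD)
    then have "(p y, p z) \<in> ?r ^^ (k + k)" using q(1) by (auto simp: relpow_add)
    then have "(p y, x z) \<in> ?r ^^ Suc (k + k)"
      using xp[OF yz(2)] sym_adjacent[OF S(1)] by (auto dest: symD)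
    then have "(x y, x z) \<in> ?r ^^ Suc (Suc (k + k))" using xp[OF yz(1)] by (meson relpow_Suc_I2)
    then obtain h where "h \<in> link_words S (Suc (Suc (k + k)))" "x z = \<phi> h (x y)"
      using relpow_adjacent[OF S(1)] by blast
    moreover have "2 * k + 2 = Suc (Suc (k + k))" by simp
    ultimately have "x z = x y" using C xC[OF yz(1)] xC[OF yz(2)] unfolding sparse_def by metis
    then show False using yx yz by metis
  qed
  have "Suc k \<le> card (V y)" if y: "y \<in> J" for y
  proof -
    obtain z where z: "z \<in> J" "z \<noteq> y"
    proof -
      have "J \<noteq> {y}" using False by auto
      then show ?thesis using y that by blast
    qed
    have "p z \<in> (?r ^^ k) `` {p z}"
    proof -
      have "(q, q) \<in> ?r ^^ k" for q
        using refl_adjacent by (induction k) (auto simp: refl_on_def)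
      then show ?thesis by simp
    qed
    then have "p z \<notin> (?r ^^ k) `` {p y}" using dis[OF y z(1)] z(2) by blast
    then show ?thesis
      using connected_by_growth[OF F pF[OF y] refl_adjacent, of k] pF[OF z(1)] unfolding V_def by blast
  qed
  then have "card J * Suc k \<le> (\<Sum>y\<in>J. card (V y))"
    using sum_bounded_below[of J "Suc k" "\<lambda>y. card (V y)"] by simp
  also have "\<dots> = card (\<Union>y\<in>J. V y)"
    using fJ F(2) dis by (intro card_UN_disjoint[symmetric]) (auto simp: V_def)
  also have "\<dots> \<le> card F" using F(2) by (intro card_mono) (auto simp: V_def)
  finally show ?thesis by simp
qed simp

end

sublocale borel_action \<subseteq> invariant_sigma_algebra G \<phi> "sets borel"
proof (intro invariant_sigma_algebra.intro invariant_sigma_algebra_axioms.intro)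
  show "space_action G \<phi>" by unfold_locales
  show "sigma_algebra UNIV (sets borel :: 'a set set)"
    using sets.sigma_algebra_axioms[of "borel :: 'a measure"] by simp
  fix g and X :: "'a set" assume g: "g \<in> carrier G" and X: "X \<in> sets borel"
  have "\<phi> (inv g) -` X \<inter> space borel \<in> sets borel"
    using act_borel g X by (intro measurable_sets) auto
  then show "\<phi> g ` X \<in> sets borel" using act_image_eq_vimage g by simp
qed

context borel_action
begin

lemma borel_coincidence:
  assumes "g \<in> carrier G" "h \<in> carrier G"
  shows "{x. \<phi> g x = \<phi> h x} \<in> sets borel"
proof -
  have "(\<lambda>x. dist (\<phi> g x) (\<phi> h x)) \<in> borel_measurable borel"
    using assms by (intro borel_measurable_dist act_borel)
  then have "(\<lambda>x. dist (\<phi> g x) (\<phi> h x)) -` {0} \<inter> space borel \<in> sets borel"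
    by (intro measurable_sets) auto
  moreover have "(\<lambda>x. dist (\<phi> g x) (\<phi> h x)) -` {0} \<inter> space borel = {x. \<phi> g x = \<phi> h x}" by auto
  ultimately show ?thesis by simp
qed

lemma borel_vimage: "g \<in> carrier G \<Longrightarrow> X \<in> sets borel \<Longrightarrow> {x. \<phi> g x \<in> X} \<in> sets borel"
  using measurable_sets[OF act_borel, of g X] by (simp add: vimage_def)

text \<open>This makes Hall's condition for a finite part of the orbit of \<open>x\<close> a Borel condition on \<open>x\<close>.\<close>

lemma borel_card_orbit_part:
  assumes "finite K" "K \<subseteq> carrier G" "\<And>k. k \<in> K \<Longrightarrow> {x. P k x} \<in> sets borel"
  shows "(\<lambda>x. real (card ((\<lambda>k. \<phi> k x) ` {k\<in>K. P k x}))) \<in> borel_measurable borel"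
  using assms
proof (induction K rule: finite_induct)
  case (insert k K)
  define Q where "Q = {x. P k x} - (\<Union>h\<in>K. {x. P h x} \<inter> {x. \<phi> h x = \<phi> k x})"
  have "Q \<in> sets borel"
    unfolding Q_def using insert by (intro sets.Diff sets.finite_UN sets.Int borel_coincidence) auto
  have eq: "real (card ((\<lambda>k. \<phi> k x) ` {h\<in>insert k K. P h x})) =
      real (card ((\<lambda>k. \<phi> k x) ` {h\<in>K. P h x})) + indicat_real Q x" for x
  proof (cases "x \<in> Q")
    case True
    then have "{h\<in>insert k K. P h x} = insert k {h\<in>K. P h x}"
      "\<phi> k x \<notin> (\<lambda>k. \<phi> k x) ` {h\<in>K. P h x}" by (auto simp: Q_def)
    then show ?thesis using True insert(1) by simp
  next
    case False
    have "\<phi> k x \<in> (\<lambda>k. \<phi> k x) ` {h\<in>K. P h x}" if Pk: "P k x"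
    proof -
      obtain h where "h \<in> K" "P h x" "\<phi> h x = \<phi> k x" using False Pk by (auto simp: Q_def)
      then show ?thesis by (intro image_eqI[of _ _ h]) auto
    qed
    then have "(\<lambda>k. \<phi> k x) ` {h\<in>insert k K. P h x} = (\<lambda>k. \<phi> k x) ` {h\<in>K. P h x}"
      by blast
    then show ?thesis using False by simp
  qed
  show ?case unfolding eq using insert \<open>Q \<in> sets borel\<close> by (intro borel_measurable_add) auto
qed simp

text \<open>
  A point has finitely many other translates under \<open>H\<close>, and a basic open set separates it from them.
\<close>

lemma countable_sparse_cover:
  assumes "finite H" "H \<subseteq> carrier G"
  obtains \<C> where "countable \<C>" "\<C> \<subseteq> sets borel" "\<And>C. C \<in> \<C> \<Longrightarrow> sparse H C" "\<Union>\<C> = UNIV"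
proof -
  obtain \<V> :: "'a set set" where V: "countable \<V>" "topological_basis \<V>"
    using ex_countable_basis by auto
  define C where "C V = V \<inter> (\<Inter>h\<in>H. {x. \<phi> h x = \<phi> \<one> x} \<union> {x. \<phi> h x \<in> - V})" for V
  have Cborel: "C V \<in> sets borel" if "V \<in> \<V>" for V
  proof -
    have "V \<in> sets borel" using topological_basis_open[OF V(2) that] by simp
    moreover have "{x. \<phi> h x = \<phi> \<one> x} \<union> {x. \<phi> h x \<in> - V} \<in> sets borel" if "h \<in> H" for h
      using that assms(2) \<open>V \<in> sets borel\<close> by (intro sets.Un borel_coincidence borel_vimage) auto
    ultimately have "space borel \<inter> (V \<inter> (\<Inter>h\<in>H. {x. \<phi> h x = \<phi> \<one> x} \<union> {x. \<phi> h x \<in> - V})) \<in> sets borel"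
      using assms(1) by (cases "H = {}") (auto intro!: sets.Int sets.finite_INT)
    then show ?thesis by (simp add: C_def)
  qed
  have Csparse: "sparse H (C V)" for V by (auto simp: sparse_def C_def)
  have Ccov: "x \<in> \<Union>(C ` \<V>)" for x
  proof -
    let ?Y = "(\<lambda>h. \<phi> h x) ` H - {x}"
    have o: "open (- ?Y)" using assms(1) by (intro open_Compl finite_imp_closed) auto
    have x: "x \<in> - ?Y" by simp
    obtain V' where "V' \<in> \<V>" "x \<in> V'" "V' \<subseteq> - ?Y"
      by (rule topological_basisE[OF V(2) o x])
    then have "x \<in> C V'" by (auto simp: C_def)
    then show ?thesis using \<open>V' \<in> \<V>\<close> by blast
  qed
  show ?thesis
  proof (rule that)
    show "countable (C ` \<V>)" using V(1) by simp
    show "C ` \<V> \<subseteq> sets borel" using Cborel by (rule image_subsetI)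
    show "sparse H D" if "D \<in> C ` \<V>" for D using Csparse that by (elim imageE) simp
    show "\<Union>(C ` \<V>) = UNIV" using Ccov by (simp add: set_eq_iff)
  qed
qed

end

lemma matching_extend:
  assumes l: "matching \<phi> S \<A> A B l" and inj: "inj (\<phi> s)" and "s \<in> S"
    and C: "C \<subseteq> A - dom l" "\<phi> s ` C \<subseteq> B - hit \<phi> l" "C \<in> \<A>"
    and un: "\<And>X Y. X \<in> \<A> \<Longrightarrow> Y \<in> \<A> \<Longrightarrow> X \<union> Y \<in> \<A>"
  defines "l' \<equiv> (\<lambda>x. if x \<in> C then Some s else l x)"
  shows "matching \<phi> S \<A> A B l'" "dom l' = dom l \<union> C" "hit \<phi> l' = hit \<phi> l \<union> \<phi> s ` C"
proof -
  have val: "l' x = Some t \<longleftrightarrow> x \<in> C \<and> t = s \<or> l x = Some t" for x t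
    using C(1) by (auto simp: l'_def)
  show dom: "dom l' = dom l \<union> C" by (auto simp: l'_def split: if_splits)
  have "move \<phi> l' ` C = \<phi> s ` C" by (intro image_cong) (auto simp: l'_def move_def)
  moreover have "move \<phi> l' ` dom l = move \<phi> l ` dom l"
    using C(1) by (intro image_cong) (auto simp: l'_def move_def)
  ultimately show "hit \<phi> l' = hit \<phi> l \<union> \<phi> s ` C" unfolding hit_def dom by (simp add: image_Un)
  show "matching \<phi> S \<A> A B l'"
  proof (rule matchingI)
    fix x t assume "l' x = Some t"
    then show "x \<in> A \<and> t \<in> S \<and> \<phi> t x \<in> B"
      unfolding val using C \<open>s \<in> S\<close> matching_Some[OF l] by blast
  next
    fix x y t u assume a: "l' x = Some t" "l' y = Some u" and e: "\<phi> t x = \<phi> u y"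
    have no: False if xy: "x \<in> C" "l y = Some u" "\<phi> s x = \<phi> u y" for x y u
    proof -
      have "\<phi> s x \<in> B - hit \<phi> l" using C(2) xy(1) by blast
      then show False using hitI[of l y u \<phi>, OF xy(2)] xy(3) by simp
    qed
    from a consider "x \<in> C" "t = s" "y \<in> C" "u = s" | "x \<in> C" "t = s" "l y = Some u"
      | "l x = Some t" "y \<in> C" "u = s" | "l x = Some t" "l y = Some u"
      unfolding val by blast
    then show "x = y"
    proof cases
      case 1 then show ?thesis using inj e by (simp add: inj_def)
    next
      case 2 then show ?thesis using no e by blast
    next
      case 3 then show ?thesis using no[of y x t] e by simp
    next
      case 4 then show ?thesis using matching_inj[OF l _ _ e] by blast
    qed
  next
    fix t
    have "{x. l' x = Some t} = (if t = s then {x. l x = Some t} \<union> C else {x. l x = Some t})"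
      using val by auto
    then show "{x. l' x = Some t} \<in> \<A>" using un C(3) matchingD(5)[OF l] by simp
  qed
qed

context borel_action
begin

text \<open>
  The invariant of the construction. The second condition lets the rest of \<open>A\<close> be matched. The
  third one bounds the loss of neighbours of connected finite sets: stage \<open>n\<close> takes at most one of them, or
  at most \<open>card F / 2 ^ (n + 2)\<close>. Since initially there are twice as many neighbours as points, large sets
  never run short.
\<close>

definition Hall_stage :: "'g set \<Rightarrow> 'a set \<Rightarrow> 'a set \<Rightarrow> nat \<Rightarrow> ('a \<rightharpoonup> 'g) \<Rightarrow> bool" where
  "Hall_stage S A B n l \<longleftrightarrow> matching \<phi> S (sets borel) A B l \<and>
    (\<forall>F. finite F \<longrightarrow> F \<subseteq> A - dom l \<longrightarrow> card F \<le> card (translates \<phi> S F \<inter> (B - hit \<phi> l))) \<and>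
    (\<forall>F. finite F \<longrightarrow> connected_by (adjacent S) F \<longrightarrow>
      real (card (translates \<phi> S F \<inter> hit \<phi> l)) \<le> n + card F / 2 * (1 - (1 / 2) ^ n))"

text \<open>
  Hall's condition for the remaining points after \<open>x\<close> has been matched by \<open>s\<close>. Testing it along the
  orbit of \<open>x\<close> only, through words, makes it a Borel condition on \<open>x\<close>.
\<close>

definition may_match :: "'g set \<Rightarrow> 'a set \<Rightarrow> 'a set \<Rightarrow> 'g \<Rightarrow> 'a \<Rightarrow> bool" where
  "may_match S D E s x \<longleftrightarrow> \<phi> s x \<in> E \<and>
    (\<forall>K. finite K \<and> K \<subseteq> (\<Union>n. link_words S n) \<and> (\<forall>k\<in>K. \<phi> k x \<in> D \<and> \<phi> k x \<noteq> x) \<longrightarrow>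
      card ((\<lambda>k. \<phi> k x) ` K) \<le>
      card (translates \<phi> S ((\<lambda>k. \<phi> k x) ` K) \<inter> (E - {\<phi> s x})))"

text \<open>The orbit is countable, so there are countably many finite sets to test.\<close>

lemma borel_may_match:
  assumes S: "finite S" "S \<subseteq> carrier G" "s \<in> S" and D: "D \<in> sets borel" and E: "E \<in> sets borel"
  shows "{x. may_match S D E s x} \<in> sets borel"
proof -
  define \<K> where "\<K> = {K. finite K \<and> K \<subseteq> (\<Union>n. link_words S n)}"
  have countable: "countable \<K>"
  proof -
    have "countable (\<Union>n. link_words S n)"
      by (simp add: countable_finite finite_link_words[OF S(1)])
    then show ?thesis unfolding \<K>_def by (rule countable_Collect_finite_subset)
  qed
  have sc: "s \<in> carrier G" using S by auto
  define bad where "bad K = {x. \<forall>k\<in>K. \<phi> k x \<in> D \<and> \<phi> k x \<noteq> x} \<inter>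
      {x. \<not> card ((\<lambda>k. \<phi> k x) ` K) \<le> card (translates \<phi> S ((\<lambda>k. \<phi> k x) ` K) \<inter> (E - {\<phi> s x}))}" for K
  have "bad K \<in> sets borel" if K: "K \<in> \<K>" for K
  proof -
    have fK: "finite K" using K by (simp add: \<K>_def)
    have Kc: "K \<subseteq> carrier G" using K link_words_closed[OF S(2)] unfolding \<K>_def by blast
    have "{x. \<forall>k\<in>K. \<phi> k x \<in> D \<and> \<phi> k x \<noteq> x} = UNIV \<inter> (\<Inter>k\<in>K. {x. \<phi> k x \<in> D} - {x. \<phi> k x = \<phi> \<one> x})"
      by auto
    also have "\<dots> \<in> sets borel"
    proof (cases "K = {}")
      case False
      have "{x. \<phi> k x \<in> D} - {x. \<phi> k x = \<phi> \<one> x} \<in> sets borel" if "k \<in> K" for k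
        using that Kc D by (intro sets.Diff borel_vimage borel_coincidence) auto
      then show ?thesis using fK False by (intro sets.Int sets.finite_INT) auto
    qed simp
    finally have orbit: "{x. \<forall>k\<in>K. \<phi> k x \<in> D \<and> \<phi> k x \<noteq> x} \<in> sets borel" .
    have small: "{x. \<not> card ((\<lambda>k. \<phi> k x) ` K) \<le>
        card (translates \<phi> S ((\<lambda>k. \<phi> k x) ` K) \<inter> (E - {\<phi> s x}))} \<in> sets borel"
    proof -
      define L where "L = (\<lambda>(t, k). t \<otimes> k) ` (S \<times> K)"
      have L: "finite L" "L \<subseteq> carrier G" using S fK Kc by (auto simp: L_def)
      have tr: "translates \<phi> S ((\<lambda>k. \<phi> k x) ` K) \<inter> (E - {\<phi> s x}) =
          (\<lambda>g. \<phi> g x) ` {g\<in>L. \<phi> g x \<in> E \<and> \<phi> g x \<noteq> \<phi> s x}" for x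
      proof -
        have e: "\<phi> (t \<otimes> k) x = \<phi> t (\<phi> k x)" if "t \<in> S" "k \<in> K" for t k
          using that S Kc by (intro act_mult) auto
        have "translates \<phi> S ((\<lambda>k. \<phi> k x) ` K) = (\<lambda>g. \<phi> g x) ` L"
          unfolding translates_def L_def using e by (force simp: image_iff)
        then show ?thesis by auto
      qed
      have "{x. \<phi> g x \<in> E \<and> \<phi> g x \<noteq> \<phi> s x} \<in> sets borel" if g: "g \<in> L" for g
      proof -
        have "{x. \<phi> g x \<in> E \<and> \<phi> g x \<noteq> \<phi> s x} = {x. \<phi> g x \<in> E} - {x. \<phi> g x = \<phi> s x}" by auto
        also have "\<dots> \<in> sets borel"
          using g L sc E by (intro sets.Diff borel_vimage borel_coincidence) auto
        finally show ?thesis .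
      qed
      then have m: "(\<lambda>x. real (card ((\<lambda>g. \<phi> g x) ` {g\<in>L. \<phi> g x \<in> E \<and> \<phi> g x \<noteq> \<phi> s x}))) \<in> borel_measurable borel"
        using L by (intro borel_card_orbit_part) auto
      have m': "(\<lambda>x. real (card ((\<lambda>k. \<phi> k x) ` K))) \<in> borel_measurable borel"
        using borel_card_orbit_part[OF fK Kc, of "\<lambda>_ _. True"] by simp
      have "{x. \<not> card ((\<lambda>k. \<phi> k x) ` K) \<le>
          card (translates \<phi> S ((\<lambda>k. \<phi> k x) ` K) \<inter> (E - {\<phi> s x}))} =
        {x \<in> space borel. real (card ((\<lambda>g. \<phi> g x) ` {g\<in>L. \<phi> g x \<in> E \<and> \<phi> g x \<noteq> \<phi> s x})) <
            real (card ((\<lambda>k. \<phi> k x) ` K))}"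
        unfolding tr by auto
      also have "\<dots> \<in> sets borel" using m m' by (rule borel_measurable_less)
      finally show ?thesis .
    qed
    show ?thesis unfolding bad_def by (rule sets.Int[OF orbit small])
  qed
  then have "(\<Union>K\<in>\<K>. bad K) \<in> sets borel" using countable by (intro sets.countable_UN'') auto
  moreover have "{x. may_match S D E s x} = {x. \<phi> s x \<in> E} - (\<Union>K\<in>\<K>. bad K)"
    unfolding may_match_def bad_def \<K>_def by blast
  ultimately show ?thesis using borel_vimage[OF sc E] by auto
qed

text \<open>
  Hall's theorem provides an injection, and deleting one of its edges leaves an injection of the rest.
\<close>

lemma ex_may_match:
  assumes S: "finite S" "S \<subseteq> carrier G"
    and hall: "\<And>F. finite F \<Longrightarrow> F \<subseteq> D \<Longrightarrow> card F \<le> card (translates \<phi> S F \<inter> E)" and x: "x \<in> D"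
  shows "\<exists>s\<in>S. may_match S D E s x"
proof -
  obtain j where j: "matching \<phi> S UNIV D E j" "dom j = D" using Hall_matching[OF S hall] by blast
  obtain s where s: "j x = Some s" using x j(2) by auto
  have "may_match S D E s x"
    unfolding may_match_def
  proof (intro conjI allI impI)
    show "\<phi> s x \<in> E" using matching_Some[OF j(1) s] by simp
    fix K assume K: "finite K \<and> K \<subseteq> (\<Union>n. link_words S n) \<and> (\<forall>k\<in>K. \<phi> k x \<in> D \<and> \<phi> k x \<noteq> x)"
    define F where "F = (\<lambda>k. \<phi> k x) ` K"
    have F: "finite F" "F \<subseteq> D" "x \<notin> F" using K by (auto simp: F_def)
    have "move \<phi> j ` F \<subseteq> translates \<phi> S F \<inter> (E - {\<phi> s x})"
    proof
      fix y assume "y \<in> move \<phi> j ` F"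
      then obtain z where z: "z \<in> F" "y = move \<phi> j z" by auto
      then obtain t where t: "j z = Some t" using F(2) j(2) by auto
      then have y: "y = \<phi> t z" using z by (simp add: move_def)
      have "\<phi> t z \<noteq> \<phi> s x" using matching_inj[OF j(1) t s] z(1) F(3) by metis
      then show "y \<in> translates \<phi> S F \<inter> (E - {\<phi> s x})"
        using y z matching_Some[OF j(1) t] by (auto simp: translates_def)
    qed
    then have "card (move \<phi> j ` F) \<le> card (translates \<phi> S F \<inter> (E - {\<phi> s x}))"
      using S F by (intro card_mono) (simp_all add: finite_translates)
    moreover have "card (move \<phi> j ` F) = card F"
      using matchingD(4)[OF j(1)] F(2) j(2) by (intro card_image) (auto intro: inj_on_subset)
    ultimately show "card ((\<lambda>k. \<phi> k x) ` K) \<le>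
        card (translates \<phi> S ((\<lambda>k. \<phi> k x) ` K) \<inter> (E - {\<phi> s x}))" by (simp add: F_def)
  qed
  then show ?thesis using matching_Some[OF j(1) s] by blast
qed

text \<open>
  Disconnected parts of a violation of Hall's condition have disjoint neighbourhoods, so one of them
  would be a smaller violation.
\<close>

lemma minimal_violation_connected:
  assumes S: "finite S" "S \<subseteq> carrier G" and F: "finite F"
    and viol: "card (translates \<phi> S F \<inter> E) < card F"
    and min: "\<And>F'. F' \<subset> F \<Longrightarrow> card F' \<le> card (translates \<phi> S F' \<inter> E)"
  shows "connected_by (adjacent S) F"
  unfolding connected_by_def
proof (intro allI impI, rule ccontr)
  fix F1 assume F1: "F1 \<subseteq> F" "F1 \<noteq> {}" "F1 \<noteq> F"
    and no: "\<not> (\<exists>p\<in>F1. \<exists>q\<in>F - F1. (p, q) \<in> adjacent S)"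
  let ?F2 = "F - F1"
  have "translates \<phi> S F1 \<inter> translates \<phi> S ?F2 = {}"
  proof (rule ccontr)
    assume "\<not> ?thesis"
    then obtain y where "y \<in> translates \<phi> S F1" "y \<in> translates \<phi> S ?F2" by blast
    then obtain s p t q where "s \<in> S" "p \<in> F1" "y = \<phi> s p" "t \<in> S" "q \<in> ?F2" "y = \<phi> t q"
      unfolding translates_def by blast
    then show False using no adjacentI[OF S(2)] by metis
  qed
  then have dis: "(translates \<phi> S F1 \<inter> E) \<inter> (translates \<phi> S ?F2 \<inter> E) = {}" by blast
  have fin: "finite F1" "finite ?F2" using F F1 by (auto intro: finite_subset)
  have "F1 \<union> ?F2 = F" using F1 by auto
  then have "translates \<phi> S F \<inter> E = (translates \<phi> S F1 \<inter> E) \<union> (translates \<phi> S ?F2 \<inter> E)"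
    using translates_Un[of \<phi> S F1 ?F2] by auto
  then have "card (translates \<phi> S F \<inter> E) =
      card (translates \<phi> S F1 \<inter> E) + card (translates \<phi> S ?F2 \<inter> E)"
    using card_Un_disjoint[OF _ _ dis] S fin by (simp add: finite_translates)
  moreover have "card F1 \<le> card (translates \<phi> S F1 \<inter> E)" using F1 by (intro min) auto
  moreover have "card ?F2 \<le> card (translates \<phi> S ?F2 \<inter> E)" using F1 by (intro min) auto
  moreover have "card F = card F1 + card ?F2"
    using F F1 by (metis card_Un_disjoint Diff_disjoint \<open>F1 \<union> ?F2 = F\<close> fin)
  ultimately show False using viol by linarith
qed

text \<open>
  All points of a sparse set that may be matched by \<open>s\<close> can be matched at once. A minimal violation \<open>F\<close> of Hall's condition is
  connected. If it sees one of the new edges, then it lies in the orbit of the corresponding point and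
  \<open>may_match\<close> excludes it. If it sees at least two, then it bridges a gap and is so large that
  the bound on lost neighbours excludes it.
\<close>

lemma Hall_stage_extend:
  assumes S: "finite S" "S \<subseteq> carrier G"
    and expand: "\<And>F. finite F \<Longrightarrow> F \<subseteq> A \<Longrightarrow> 2 * card F \<le> card (translates \<phi> S F \<inter> B)"
    and l: "Hall_stage S A B n l" and s: "s \<in> S"
    and C: "C \<in> sets borel" "C \<subseteq> A - dom l" "sparse (link_words S (2 * (2 ^ (n + 2) - 1) + 2)) C"
    and may: "\<And>x. x \<in> C \<Longrightarrow> may_match S (A - dom l) (B - hit \<phi> l) s x"
  defines "l' \<equiv> (\<lambda>x. if x \<in> C then Some s else l x)"
  shows "Hall_stage S A B (Suc n) l'"
proof -
  have sc: "s \<in> carrier G" using S s by auto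
  have m: "matching \<phi> S (sets borel) A B l"
    and hall: "\<And>F. finite F \<Longrightarrow> F \<subseteq> A - dom l \<Longrightarrow> card F \<le> card (translates \<phi> S F \<inter> (B - hit \<phi> l))"
    and few: "\<And>F. finite F \<Longrightarrow> connected_by (adjacent S) F \<Longrightarrow>
      real (card (translates \<phi> S F \<inter> hit \<phi> l)) \<le> n + card F / 2 * (1 - (1 / 2) ^ n)"
    using l unfolding Hall_stage_def by blast+
  have CE: "\<phi> s ` C \<subseteq> B - hit \<phi> l" using may by (auto simp: may_match_def)
  note ext = matching_extend[OF m act_inj[OF sc] s C(2) CE C(1) sets.Un]
  have m': "matching \<phi> S (sets borel) A B l'" unfolding l'_def by (rule ext(1))
  have dom': "dom l' = dom l \<union> C" unfolding l'_def by (rule ext(2))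
  have hit': "hit \<phi> l' = hit \<phi> l \<union> \<phi> s ` C" unfolding l'_def by (rule ext(3))
  \<comment> \<open>The gap is chosen such that \<open>Suc k\<close> is the inverse of the fraction that stage \<open>n\<close> may take.\<close>
  define k :: nat where "k = 2 ^ (n + 2) - 1"
  have Suc_k: "Suc k = 2 ^ (n + 2)" by (simp add: k_def)
  have hits: "card (translates \<phi> S F \<inter> \<phi> s ` C) \<le> 1 \<or> card (translates \<phi> S F \<inter> \<phi> s ` C) * 2 ^ (n + 2) \<le> card F"
    if "finite F" "connected_by (adjacent S) F" for F
    using sparse_hits_bound[OF S(2,1) s C(3)[folded k_def] that(2,1)] unfolding Suc_k .
  have few': "real (card (translates \<phi> S F \<inter> hit \<phi> l')) \<le> Suc n + card F / 2 * (1 - (1 / 2) ^ Suc n)"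
    if F: "finite F" "connected_by (adjacent S) F" for F
  proof -
    let ?j = "card (translates \<phi> S F \<inter> \<phi> s ` C)"
    have "translates \<phi> S F \<inter> hit \<phi> l' = (translates \<phi> S F \<inter> hit \<phi> l) \<union> (translates \<phi> S F \<inter> \<phi> s ` C)"
      unfolding hit' by blast
    then have "card (translates \<phi> S F \<inter> hit \<phi> l') \<le> card (translates \<phi> S F \<inter> hit \<phi> l) + ?j"
      by (metis card_Un_le)
    then have "real (card (translates \<phi> S F \<inter> hit \<phi> l')) \<le> real (card (translates \<phi> S F \<inter> hit \<phi> l)) + real ?j"
      by linarith
    moreover have "real ?j \<le> 1 + card F / 2 ^ (n + 2)"
    proof (cases "?j \<le> 1")
      case True
      have "0 \<le> real (card F) / 2 ^ (n + 2)" by simp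
      then show ?thesis using True by linarith
    next
      case False
      then have "?j * 2 ^ (n + 2) \<le> card F" using hits[OF F] by blast
      then have "real (?j * 2 ^ (n + 2)) \<le> real (card F)" by (rule of_nat_mono)
      then have "real ?j * 2 ^ (n + 2) \<le> real (card F)" by (simp only: of_nat_mult of_nat_power of_nat_numeral)
      then have "real ?j \<le> card F / 2 ^ (n + 2)" by (simp add: pos_le_divide_eq)
      then show ?thesis by linarith
    qed
    moreover have "card F / 2 * (1 - (1 / 2) ^ Suc n) = card F / 2 * (1 - (1 / 2) ^ n) + card F / 2 ^ (n + 2)"
      by (simp add: field_simps power_divide)
    ultimately show ?thesis using few[OF F] by linarith
  qed
  have hall': "card F \<le> card (translates \<phi> S F \<inter> (B - hit \<phi> l'))" if F0: "finite F" "F \<subseteq> A - dom l'" for F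
  proof (rule ccontr)
    assume no: "\<not> ?thesis"
    define Q where "Q F \<longleftrightarrow> finite F \<and> F \<subseteq> A - dom l' \<and>
      card (translates \<phi> S F \<inter> (B - hit \<phi> l')) < card F" for F
    have "Q F" using no F0 by (simp add: Q_def not_le)
    from ex_has_least_nat[of Q, OF this, of card] obtain F
      where QF: "Q F" and least: "\<forall>F'. Q F' \<longrightarrow> card F \<le> card F'" by (elim exE conjE)
    have F: "finite F" "F \<subseteq> A - dom l'" and viol: "card (translates \<phi> S F \<inter> (B - hit \<phi> l')) < card F"
      using QF unfolding Q_def by simp_all
    have conn: "connected_by (adjacent S) F"
    proof (rule minimal_violation_connected[OF S F(1) viol])
      fix F' assume F': "F' \<subset> F"
      have "card F' < card F" by (rule psubset_card_mono[OF F(1) F'])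
      moreover have "finite F'" "F' \<subseteq> A - dom l'" using F F' by (auto intro: finite_subset)
      ultimately show "card F' \<le> card (translates \<phi> S F' \<inter> (B - hit \<phi> l'))" using least unfolding Q_def by (metis not_le)
    qed
    let ?J = "translates \<phi> S F \<inter> \<phi> s ` C"
    have fT: "finite (translates \<phi> S F)" using S F by (simp add: finite_translates)
    consider "card ?J = 0" | "card ?J = 1" | "card ?J \<ge> 2" by linarith
    then show False
    proof cases
      case 1
      then have "?J = {}" using fT by simp
      then have "translates \<phi> S F \<inter> (B - hit \<phi> l') = translates \<phi> S F \<inter> (B - hit \<phi> l)" unfolding hit' by blast
      then show False using viol hall[of F] F dom' by auto
    next
      case 2
      then obtain y where y: "?J = {y}" using card_1_singletonE by blast
      then have "y \<in> ?J" by simp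
      then obtain t p x where tp: "t \<in> S" "p \<in> F" "y = \<phi> t p" "x \<in> C" "y = \<phi> s x"
        unfolding translates_def by blast
      have "(x, p) \<in> adjacent S" using adjacentI[OF S(2) s tp(1)] tp by metis
      then have reach: "(x, q) \<in> adjacent S ^^ Suc (card F)" if "q \<in> F" for q
        using connected_by_reach[OF conn F(1) tp(2) refl_adjacent] that by (blast intro: relpow_Suc_I2)
      define K where "K = {k \<in> link_words S (Suc (card F)). \<phi> k x \<in> F}"
      have KF: "(\<lambda>k. \<phi> k x) ` K = F"
      proof (intro equalityI subsetI)
        fix q assume "q \<in> F"
        then obtain h where "h \<in> link_words S (Suc (card F))" "q = \<phi> h x"
          using reach relpow_adjacent[OF S(2)] by blast
        then show "q \<in> (\<lambda>k. \<phi> k x) ` K" using \<open>q \<in> F\<close> unfolding K_def by blast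
      qed (auto simp: K_def)
      have fK: "finite K"
        by (rule finite_subset[OF _ finite_link_words[OF S(1), of "Suc (card F)"]]) (auto simp only: K_def)
      have subK: "K \<subseteq> (\<Union>n. link_words S n)" unfolding K_def by blast
      have "x \<notin> F" using F(2) tp(4) dom' by auto
      then have pK: "\<forall>k\<in>K. \<phi> k x \<in> A - dom l \<and> \<phi> k x \<noteq> x" using F(2) dom' unfolding K_def by auto
      have "card ((\<lambda>k. \<phi> k x) ` K) \<le> card (translates \<phi> S ((\<lambda>k. \<phi> k x) ` K) \<inter> (B - hit \<phi> l - {\<phi> s x}))"
        using may[OF tp(4)] fK subK pK unfolding may_match_def by blast
      then have "card F \<le> card (translates \<phi> S F \<inter> (B - hit \<phi> l - {\<phi> s x}))" unfolding KF .
      moreover have "translates \<phi> S F \<inter> (B - hit \<phi> l') = translates \<phi> S F \<inter> (B - hit \<phi> l - {\<phi> s x})"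
        using y tp(5) unfolding hit' by blast
      ultimately show False using viol by simp
    next
      case 3
      then have "card ?J * 2 ^ (n + 2) \<le> card F" using hits[OF F(1) conn] by linarith
      moreover have "2 * 2 ^ (n + 2) \<le> card ?J * (2 :: nat) ^ (n + 2)" using 3 by (rule mult_le_mono1)
      ultimately have big: "2 * 2 ^ (n + 2) \<le> card F" by linarith
      have "n + 1 \<le> 2 ^ (n + 2)" using less_exp[of "n + 2"] by linarith
      then have "2 * (n + 1) \<le> 2 * 2 ^ (n + 2)" by (rule mult_le_mono2)
      then have big: "2 * (n + 1) \<le> card F" using big by (rule order_trans)
      have "F \<subseteq> A" using F by blast
      then have "2 * card F \<le> card (translates \<phi> S F \<inter> B)" using expand F(1) by blast
      also have "\<dots> \<le> card ((translates \<phi> S F \<inter> (B - hit \<phi> l')) \<union> (translates \<phi> S F \<inter> hit \<phi> l'))"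
        using fT by (intro card_mono) auto
      also have "\<dots> \<le> card (translates \<phi> S F \<inter> (B - hit \<phi> l')) + card (translates \<phi> S F \<inter> hit \<phi> l')"
        by (rule card_Un_le)
      finally have "2 * real (card F) \<le> card (translates \<phi> S F \<inter> (B - hit \<phi> l')) + real (card (translates \<phi> S F \<inter> hit \<phi> l'))"
        by linarith
      moreover have "real (card (translates \<phi> S F \<inter> hit \<phi> l')) \<le> real (Suc n) + real (card F) / 2"
      proof -
        have "real (card F) / 2 * (1 - (1 / 2) ^ Suc n) \<le> real (card F) / 2 * 1"
          by (intro mult_left_mono) auto
        then have "real (Suc n) + real (card F) / 2 * (1 - (1 / 2) ^ Suc n) \<le> real (Suc n) + real (card F) / 2"
          by simp
        then show ?thesis using few'[OF F(1) conn] by (rule order_trans[rotated])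
      qed
      moreover have "2 * real (Suc n) \<le> real (card F)" using of_nat_mono[OF big, where 'a = real] by simp
      moreover have "c \<le> a" if "2 * c \<le> a + b" "b \<le> k + c / 2" "2 * k \<le> c" for a b c k :: real
        using that by (simp add: field_simps)
      ultimately have "real (card F) \<le> real (card (translates \<phi> S F \<inter> (B - hit \<phi> l')))" by metis
      then show False using viol by linarith
    qed
  qed
  show ?thesis unfolding Hall_stage_def using m' hall' few' by blast
qed

lemma Hall_stage_Suc:
  assumes "Hall_stage S A B n l"
  shows "Hall_stage S A B (Suc n) l"
proof -
  have le: "n + c / 2 * (1 - (1 / 2) ^ n) \<le> real (Suc n) + c / 2 * (1 - (1 / 2) ^ Suc n)" if "0 \<le> c" for c :: real
  proof -
    have "c / 2 * (1 - (1 / 2) ^ n) \<le> c / 2 * (1 - (1 / 2) ^ Suc n)"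
      using that by (intro mult_left_mono) auto
    then show ?thesis by simp
  qed
  show ?thesis using assms order_trans[OF _ le] unfolding Hall_stage_def by simp
qed

text \<open>
  Countably many sparse sets and finitely many labels account for all unmatched points, so one combination
  is nonmeager in \<open>U\<close> if the unmatched part is.
\<close>

lemma Hall_stage_step:
  assumes S: "finite S" "S \<subseteq> carrier G" and A: "A \<in> sets borel" and B: "B \<in> sets borel"
    and expand: "\<And>F. finite F \<Longrightarrow> F \<subseteq> A \<Longrightarrow> 2 * card F \<le> card (translates \<phi> S F \<inter> B)"
    and l: "Hall_stage S A B n l" and U: "U \<in> sets borel"
  shows "\<exists>l'. Hall_stage S A B (Suc n) l' \<and> (\<forall>x s. l x = Some s \<longrightarrow> l' x = Some s) \<and>
    (meager ((A - dom l) \<inter> U) \<or> \<not> meager (dom l' \<inter> U))"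
proof (cases "meager ((A - dom l) \<inter> U)")
  case True
  then show ?thesis using Hall_stage_Suc[OF l] by blast
next
  case False
  define D where "D = A - dom l"
  define E where "E = B - hit \<phi> l"
  define H where "H = link_words S (2 * (2 ^ (n + 2) - 1) + 2)"
  have m: "matching \<phi> S (sets borel) A B l"
    and hall: "\<And>F. finite F \<Longrightarrow> F \<subseteq> D \<Longrightarrow> card F \<le> card (translates \<phi> S F \<inter> E)"
    using l unfolding Hall_stage_def D_def E_def by blast+
  have D: "D \<in> sets borel" using matching_dom_in[OF m S(1)] A by (simp add: D_def)
  have "hit \<phi> l \<in> sets borel" using matching_image_in[OF m S, of UNIV] by (simp add: hit_def)
  then have E: "E \<in> sets borel" using B by (simp add: E_def)
  have fH: "finite H" "H \<subseteq> carrier G" unfolding H_def by (rule finite_link_words[OF S(1)], rule link_words_closed[OF S(2)])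
  obtain \<C> where \<C>: "countable \<C>" "\<C> \<subseteq> sets borel" "\<And>C. C \<in> \<C> \<Longrightarrow> sparse H C" "\<Union>\<C> = UNIV"
    using countable_sparse_cover[OF fH] by metis
  define P where "P = (\<lambda>(C, s). D \<inter> U \<inter> C \<inter> {x. may_match S D E s x})"
  have "D \<inter> U \<subseteq> (\<Union>i\<in>\<C> \<times> S. P i)"
  proof
    fix x assume x: "x \<in> D \<inter> U"
    have "x \<in> \<Union>\<C>" using \<C>(4) by simp
    then obtain C where "C \<in> \<C>" "x \<in> C" by (rule UnionE) 
    moreover have "x \<in> D" using x by simp
    have "\<exists>s\<in>S. may_match S D E s x" by (rule ex_may_match[OF S hall \<open>x \<in> D\<close>], assumption+)
    then obtain s where "s \<in> S" "may_match S D E s x" by (elim bexE)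
    ultimately have "(C, s) \<in> \<C> \<times> S" "x \<in> P (C, s)" using x by (auto simp: P_def)
    then show "x \<in> (\<Union>i\<in>\<C> \<times> S. P i)" by (rule UN_I)
  qed
  moreover have "countable (P ` (\<C> \<times> S))"
    using \<C>(1) S(1) by (intro countable_image countable_SIGMA) (auto intro: countable_finite)
  ultimately have "\<exists>i\<in>\<C> \<times> S. \<not> meager (P i)"
    using False meager_Union[of "P ` (\<C> \<times> S)"] meager_subset unfolding D_def by (metis imageE)
  then obtain C s where Cs: "C \<in> \<C>" "s \<in> S" "\<not> meager (P (C, s))" by blast
  define C' where "C' = P (C, s)"
  have "C' \<in> sets borel"
    using D U Cs(1) \<C>(2) borel_may_match[OF S Cs(2) D E] by (auto simp: C'_def P_def)
  moreover have "C' \<subseteq> A - dom l" by (auto simp: C'_def P_def D_def)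
  moreover have "sparse H C'" using \<C>(3)[OF Cs(1)] unfolding sparse_def C'_def P_def by blast
  moreover have "may_match S (A - dom l) (B - hit \<phi> l) s x" if "x \<in> C'" for x
    using that by (simp add: C'_def P_def D_def E_def)
  ultimately have st: "Hall_stage S A B (Suc n) (\<lambda>x. if x \<in> C' then Some s else l x)" (is "Hall_stage _ _ _ _ ?l")
    unfolding H_def using Hall_stage_extend[OF S expand l Cs(2)] by blast
  have "C' \<subseteq> dom ?l \<inter> U" by (auto simp: C'_def P_def)
  then have "\<not> meager (dom ?l \<inter> U)" using Cs(3) meager_subset unfolding C'_def by blast
  moreover have "\<forall>x t. l x = Some t \<longrightarrow> ?l x = Some t" by (auto simp: C'_def P_def D_def)
  ultimately show ?thesis using st by blast
qed

text \<open>
  Exhaustion over a countable basis. If the unmatched part of \<open>A\<close> were not meager, it would be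
  comeager in a basic open set, but the step for that set has matched a nonmeager part of it.
\<close>

theorem matching_off_meager:
  assumes S: "finite S" "S \<subseteq> carrier G" and A: "A \<in> sets borel" and B: "B \<in> sets borel"
    and expand: "\<And>F. finite F \<Longrightarrow> F \<subseteq> A \<Longrightarrow> 2 * card F \<le> card (translates \<phi> S F \<inter> B)"
  obtains l where "matching \<phi> S (sets borel) A B l" "meager (A - dom l)"
proof -
  obtain \<V> :: "'a set set" where \<V>: "countable \<V>" "topological_basis \<V>"
    using ex_countable_basis by blast
  have "\<V> \<noteq> {}" using topological_basisE[OF \<V>(2) open_UNIV UNIV_I] by blast
  then obtain U :: "nat \<Rightarrow> 'a set" where U: "range U = \<V>" using \<V>(1) by (metis uncountable_def)
  have oU: "open (U n)" for n using topological_basis_open[OF \<V>(2)] U by blast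
  have "\<exists>f. \<forall>n. Hall_stage S A B n (f n) \<and> ((\<forall>x s. f n x = Some s \<longrightarrow> f (Suc n) x = Some s) \<and>
      (meager ((A - dom (f n)) \<inter> U n) \<or> \<not> meager (dom (f (Suc n)) \<inter> U n)))"
  proof (rule dependent_nat_choice)
    have "hit \<phi> Map.empty = {}" by (simp add: hit_def)
    moreover have "card F \<le> card (translates \<phi> S F \<inter> B)" if "finite F" "F \<subseteq> A" for F
      using expand[OF that] by linarith
    moreover have "matching \<phi> S (sets borel) A B Map.empty" by (rule matchingI) auto
    ultimately have "Hall_stage S A B 0 Map.empty" by (simp add: Hall_stage_def)
    then show "\<exists>l. Hall_stage S A B 0 l" by blast
  next
    fix l n assume "Hall_stage S A B n l"
    then show "\<exists>l'. Hall_stage S A B (Suc n) l' \<and> ((\<forall>x s. l x = Some s \<longrightarrow> l' x = Some s) \<and>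
      (meager ((A - dom l) \<inter> U n) \<or> \<not> meager (dom l' \<inter> U n)))"
      using oU by (intro Hall_stage_step[OF S A B expand]) auto
  qed
  then obtain f where st: "\<And>n. Hall_stage S A B n (f n)"
    and inc: "\<And>n x s. f n x = Some s \<Longrightarrow> f (Suc n) x = Some s"
    and task: "\<And>n. meager ((A - dom (f n)) \<inter> U n) \<or> \<not> meager (dom (f (Suc n)) \<inter> U n)" by blast
  have m: "matching \<phi> S (sets borel) A B (f n)" for n using st[of n] by (simp add: Hall_stage_def)
  have mono: "f k x = Some s" if "f n x = Some s" "n \<le> k" for n k x s
    using that(2,1) by (induction k rule: dec_induct) (auto intro: inc)
  have uniq: "s = t" if "f n x = Some s" "f k x = Some t" for n k x s t
    using mono[OF that(1), of "max n k"] mono[OF that(2), of "max n k"] by simp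
  define l where "l x = (if \<exists>n s. f n x = Some s then Some (THE s. \<exists>n. f n x = Some s) else None)" for x
  have l: "l x = Some s \<longleftrightarrow> (\<exists>n. f n x = Some s)" for x s
  proof -
    have "(THE t. \<exists>n. f n x = Some t) = s" if "f n x = Some s" for n s
      using that uniq by (intro the_equality) blast+
    then show ?thesis unfolding l_def by auto
  qed
  have "matching \<phi> S (sets borel) A B l"
  proof (rule matchingI)
    fix x s assume "l x = Some s"
    then obtain n where "f n x = Some s" using l by blast
    then show "x \<in> A \<and> s \<in> S \<and> \<phi> s x \<in> B" using matching_Some[OF m] by blast
  next
    fix x y s t assume "l x = Some s" "l y = Some t" and e: "\<phi> s x = \<phi> t y"
    then obtain n k where "f n x = Some s" "f k y = Some t" using l by blast
    then have "f (max n k) x = Some s" "f (max n k) y = Some t"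
      by (auto intro: mono[where n = n] mono[where n = k])
    then show "x = y" using matching_inj[OF m _ _ e] by blast
  next
    fix s
    have "{x. l x = Some s} = (\<Union>n. {x. f n x = Some s})" unfolding l by auto
    then show "{x. l x = Some s} \<in> sets borel" using matchingD(5)[OF m] by auto
  qed
  moreover have "meager (A - dom l)"
  proof (rule ccontr)
    assume non: "\<not> meager (A - dom l)"
    have "dom l \<in> sets borel" using matching_dom_in[OF \<open>matching \<phi> S (sets borel) A B l\<close> S(1)] .
    then have "A - dom l \<in> baire_property_sets" using A borel_subset_baire by blast
    then obtain W where W: "open W" "W \<noteq> {}" "meager (W - (A - dom l))" using nonmeager_baire non by metis
    then obtain w where "w \<in> W" by blast
    then obtain V where V: "V \<in> \<V>" "w \<in> V" "V \<subseteq> W" by (rule topological_basisE[OF \<V>(2) W(1)])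
    then obtain n where n: "V = U n" using U by blast
    have V': "meager (U n - (A - dom l))" using W(3) V(3) n by (auto intro: meager_subset)
    have "dom (f (Suc n)) \<inter> U n \<subseteq> U n - (A - dom l)" using l by blast
    then have "meager (dom (f (Suc n)) \<inter> U n)" using V' meager_subset by blast
    then have "meager ((A - dom (f n)) \<inter> U n)" using task by blast
    moreover have "(A - dom l) \<inter> U n \<subseteq> (A - dom (f n)) \<inter> U n" using l by blast
    ultimately have "meager ((A - dom l) \<inter> U n)" using meager_subset by blast
    then have "meager ((U n - (A - dom l)) \<union> ((A - dom l) \<inter> U n))" using V' by (rule meager_Un[rotated])
    then have "meager (U n)" by (rule meager_subset) blast
    then show False using meager_open_empty oU V(2) n by blast
  qed
  ultimately show ?thesis using that by blast
qed

end

section \<open>Matchings off a null set\<close>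

text \<open>
  A form of Ekeland's variational principle: if increasing sequences have upper bounds, then some
  point admits no larger point at which the function \<open>e\<close> is smaller. Each term of a sequence is chosen
  almost optimal among the points above its predecessor, so nothing above the bound improves on it.
\<close>

lemma exists_minimal_along_order:
  fixes e :: "'b \<Rightarrow> real"
  assumes x0: "x0 \<in> X" and nonneg: "\<And>x. x \<in> X \<Longrightarrow> 0 \<le> e x"
    and refl: "\<And>x. x \<in> X \<Longrightarrow> R x x"
    and trans: "\<And>x y z. \<lbrakk>x \<in> X; y \<in> X; z \<in> X; R x y; R y z\<rbrakk> \<Longrightarrow> R x z"
    and mono: "\<And>x y. \<lbrakk>x \<in> X; y \<in> X; R x y\<rbrakk> \<Longrightarrow> e y \<le> e x"
    and bound: "\<And>f :: nat \<Rightarrow> 'b. (\<And>n. f n \<in> X \<and> R (f n) (f (Suc n))) \<Longrightarrow> \<exists>z\<in>X. \<forall>n. R (f n) z"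
  obtains z where "z \<in> X" "\<And>y. y \<in> X \<Longrightarrow> R z y \<Longrightarrow> e z \<le> e y"
proof -
  have "\<exists>f. \<forall>n. f n \<in> X \<and> (R (f n) (f (Suc n)) \<and>
      (\<forall>y\<in>X. R (f n) y \<longrightarrow> e (f (Suc n)) \<le> e y + (1 / 2) ^ n))"
  proof (rule dependent_nat_choice)
    show "\<exists>x. x \<in> X" using x0 by blast
  next
    fix x and n :: nat assume x: "x \<in> X"
    define V where "V = e ` {y\<in>X. R x y}"
    have V: "V \<noteq> {}" "bdd_below V"
      using x refl nonneg by (auto simp: V_def intro!: bdd_belowI[of _ 0])
    have "Inf V < Inf V + (1 / 2) ^ n" by simp
    then obtain v where v: "v \<in> V" "v < Inf V + (1 / 2) ^ n" using V(1) by (meson cInf_lessD)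
    then obtain z where z: "z \<in> X" "R x z" "v = e z" unfolding V_def by blast
    have "e z \<le> e y + (1 / 2) ^ n" if "y \<in> X" "R x y" for y
    proof -
      have "e y \<in> V" using that unfolding V_def by blast
      then have "Inf V \<le> e y" using V(2) by (rule cInf_lower)
      then show ?thesis using v(2) z(3) by linarith
    qed
    then show "\<exists>z. z \<in> X \<and> (R x z \<and> (\<forall>y\<in>X. R x y \<longrightarrow> e z \<le> e y + (1 / 2) ^ n))" using z by blast
  qed
  then obtain f where f: "\<And>n. f n \<in> X" "\<And>n. R (f n) (f (Suc n))"
    "\<And>n y. y \<in> X \<Longrightarrow> R (f n) y \<Longrightarrow> e (f (Suc n)) \<le> e y + (1 / 2) ^ n" by metis
  obtain z where z: "z \<in> X" "\<And>n. R (f n) z" using bound[of f] f(1,2) by blast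
  have "e z \<le> e y" if y: "y \<in> X" "R z y" for y
  proof (rule LIMSEQ_le_const)
    show "(\<lambda>n. e y + (1 / 2) ^ n) \<longlonglongrightarrow> e y"
      using tendsto_add[OF tendsto_const LIMSEQ_power_zero[of "1 / 2 :: real"], of "e y"] by simp
    have "e z \<le> e y + (1 / 2) ^ n" for n
      using mono[OF f(1)[of "Suc n"] z(1) z(2)] f(3)[OF y(1) trans[OF f(1) z(1) y(1) z(2) y(2)], of n] by linarith
    then show "\<exists>N. \<forall>n\<ge>N. e z \<le> e y + (1 / 2) ^ n" by blast
  qed
  then show ?thesis using that z(1) by blast
qed

sublocale invariant_borel_action \<subseteq> borel_action G \<phi>
proof (intro borel_action.intro borel_action_axioms.intro space_action.intro)
  show "group_action G UNIV \<phi>" by (rule group_action_axioms)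
qed (rule borel_aut)

text \<open>
  The factor 2 makes alternating paths spread geometrically from one side. Once they occupy three quarters
  of it, what they have not reached on the other side is small enough to be subject to the same factor.
\<close>

locale expanding_pair = invariant_borel_action G \<phi> M
  for G :: "('g, 'm) monoid_scheme" (structure)
    and \<phi> :: "'g \<Rightarrow> 'a::polish_space \<Rightarrow> 'a"
    and M :: "'a measure" +
  fixes S :: "'g set" and A B :: "'a set" and m :: real
  assumes S: "finite S" "S \<subseteq> carrier G" and sym: "s \<in> S \<Longrightarrow> inv s \<in> S"
    and A: "A \<in> fmeasurable M" and B: "B \<in> fmeasurable M"
    and mA: "measure M A = m" and mB: "measure M B = m" and m: "0 < m"
    and expand_AB: "\<lbrakk>X \<in> sets M; X \<subseteq> A\<rbrakk> \<Longrightarrow>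
      min (3 / 4 * m) (2 * measure M X) \<le> measure M (translates \<phi> S X \<inter> B)"
    and expand_BA: "\<lbrakk>X \<in> sets M; X \<subseteq> B\<rbrakk> \<Longrightarrow>
      min (3 / 4 * m) (2 * measure M X) \<le> measure M (translates \<phi> S X \<inter> A)"
begin

abbreviation borel_matching :: "('a \<rightharpoonup> 'g) \<Rightarrow> bool" where
  "borel_matching l \<equiv> matching \<phi> S (sets borel) A B l"

lemma sets_AB: "A \<in> sets M" "B \<in> sets M"
  using A B by auto

lemma fm_A: "X \<in> sets M \<Longrightarrow> X \<subseteq> A \<Longrightarrow> X \<in> fmeasurable M"
  using A by (rule fmeasurableI2)

lemma fm_B: "X \<in> sets M \<Longrightarrow> X \<subseteq> B \<Longrightarrow> X \<in> fmeasurable M"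
  using B by (rule fmeasurableI2)

lemma translates_sets: "X \<in> sets M \<Longrightarrow> translates \<phi> S X \<in> sets M"
  using S act_image unfolding translates_def sets_M by (intro sets.finite_UN) auto

lemma dom_sets: "borel_matching l \<Longrightarrow> dom l \<in> sets M"
  using matching_dom_in S sets_M by simp

lemma moved_sets: "borel_matching l \<Longrightarrow> E \<in> sets M \<Longrightarrow> move \<phi> l ` (E \<inter> dom l) \<in> sets M"
  using matching_image_in S sets_M by simp

lemma hit_sets: "borel_matching l \<Longrightarrow> hit \<phi> l \<in> sets M"
  using moved_sets[of l UNIV] sets_M by (simp add: hit_def)

lemma hit_subset: "borel_matching l \<Longrightarrow> hit \<phi> l \<subseteq> B"
  by (simp add: hit_def matching_def)

lemma measure_moved:
  assumes l: "borel_matching l" and E: "E \<in> sets M"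
  shows "measure M (move \<phi> l ` (E \<inter> dom l)) = measure M (E \<inter> dom l)"
proof -
  define P where "P s = E \<inter> {x. l x = Some s}" for s
  have P: "P s \<in> sets M" for s using E matchingD(5)[OF l] by (simp add: P_def sets_M)
  have Q: "\<phi> s ` P s \<in> sets M" if "s \<in> S" for s using that P S act_image by (auto simp: sets_M)
  have dP: "disjoint_family_on P S" by (auto simp: disjoint_family_on_def P_def)
  have dQ: "disjoint_family_on (\<lambda>s. \<phi> s ` P s) S"
  proof (unfold disjoint_family_on_def, intro ballI impI)
    fix s t assume "s \<in> S" "t \<in> S" "s \<noteq> t"
    then show "\<phi> s ` P s \<inter> \<phi> t ` P t = {}"
      using matching_inj[OF l, of _ s _ t] by (force simp: P_def)
  qed
  have "emeasure M (move \<phi> l ` (E \<inter> dom l)) = emeasure M (\<Union>s\<in>S. \<phi> s ` P s)"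
    using matching_image_eq[OF l] by (simp add: P_def)
  also have "\<dots> = (\<Sum>s\<in>S. emeasure M (\<phi> s ` P s))"
    using Q dQ S by (intro sum_emeasure[symmetric]) auto
  also have "\<dots> = (\<Sum>s\<in>S. emeasure M (P s))"
    using S P by (intro sum.cong invariant) auto
  also have "\<dots> = emeasure M (\<Union>s\<in>S. P s)" using P dP S by (intro sum_emeasure) auto
  also have "(\<Union>s\<in>S. P s) = E \<inter> dom l"
    using matching_Some(2)[OF l] by (auto simp: P_def)
  finally show ?thesis by (simp add: measure_def)
qed

definition pull :: "('a \<rightharpoonup> 'g) \<Rightarrow> 'a set \<Rightarrow> 'a set" where
  "pull l Y = {x \<in> dom l. move \<phi> l x \<in> Y}"

lemma move_pull: "move \<phi> l ` (pull l Y \<inter> dom l) = Y \<inter> hit \<phi> l"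
  by (auto simp: pull_def hit_def)

lemma pull_subset: "pull l Y \<subseteq> dom l"
  by (auto simp: pull_def)

lemma pull_sets:
  assumes l: "borel_matching l" and Y: "Y \<in> sets M"
  shows "pull l Y \<in> sets M"
proof -
  have "pull l Y = (\<Union>s\<in>S. {x. l x = Some s} \<inter> {x. \<phi> s x \<in> Y})"
    using matching_Some(2)[OF l] by (auto simp: pull_def move_def)
  also have "\<dots> \<in> sets borel"
    using S Y matchingD(5)[OF l] borel_vimage by (intro sets.finite_UN sets.Int) (auto simp: sets_M)
  finally show ?thesis by (simp add: sets_M)
qed

lemma measure_pull:
  assumes l: "borel_matching l" and Y: "Y \<in> sets M"
  shows "measure M (pull l Y) = measure M (Y \<inter> hit \<phi> l)"
  using measure_moved[OF l pull_sets[OF l Y]] move_pull[of l Y] pull_subset[of l Y]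
  by (simp add: Int_absorb2)

definition unmatched :: "('a \<rightharpoonup> 'g) \<Rightarrow> real" where
  "unmatched l = measure M (B - hit \<phi> l)"

lemma unmatched_eq:
  assumes l: "borel_matching l"
  shows "measure M (A - dom l) = unmatched l"
proof -
  have "measure M (A - dom l) = m - measure M (dom l)"
    using measure_Diff[of M A "dom l"] A sets_AB dom_sets[OF l] matchingD(1)[OF l] mA
    by (auto simp: fmeasurable_def)
  moreover have "unmatched l = m - measure M (hit \<phi> l)"
    using measure_Diff[of M B "hit \<phi> l"] B sets_AB hit_sets[OF l] hit_subset[OF l] mB
    by (auto simp: fmeasurable_def unmatched_def)
  moreover have "measure M (hit \<phi> l) = measure M (dom l)"
    using measure_moved[OF l, of UNIV] by (simp add: hit_def sets_M)
  ultimately show ?thesis by simp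
qed

lemma unmatched_bounds: "0 \<le> unmatched l" "borel_matching l \<Longrightarrow> unmatched l \<le> m"
  using measure_mono_fmeasurable[of "B - hit \<phi> l" B M] B sets_AB hit_sets
  by (auto simp: unmatched_def mB)

text \<open>\<open>layer l k\<close> consists of the points of \<open>A\<close> at the end of an alternating path of length at most \<open>2k\<close>
  that starts at an unmatched point of \<open>A\<close>.\<close>

primrec layer :: "('a \<rightharpoonup> 'g) \<Rightarrow> nat \<Rightarrow> 'a set" where
  "layer l 0 = A - dom l"
| "layer l (Suc k) = layer l k \<union> pull l (translates \<phi> S (layer l k))"

lemma layer_sets: "borel_matching l \<Longrightarrow> layer l k \<in> sets M"
  by (induction k) (auto intro!: pull_sets translates_sets dom_sets sets_AB)

lemma layer_subset: "borel_matching l \<Longrightarrow> layer l k \<subseteq> A"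
proof (induction k)
  case (Suc k)
  then show ?case using pull_subset[of l "translates \<phi> S (layer l k)"] matchingD(1)[of \<phi> S "sets borel" A B l] by auto
qed auto

lemma layer_mono: "i \<le> k \<Longrightarrow> layer l i \<subseteq> layer l k"
  by (induction k rule: dec_induct) auto

lemma moved_layer:
  "x \<in> layer l (Suc k) \<Longrightarrow> x \<in> dom l \<Longrightarrow> move \<phi> l x \<in> translates \<phi> S (layer l k)"
proof (induction k)
  case (Suc k)
  then consider "x \<in> layer l (Suc k)" | "x \<in> pull l (translates \<phi> S (layer l (Suc k)))" by auto
  then show ?case
  proof cases
    case 1
    have "translates \<phi> S (layer l k) \<subseteq> translates \<phi> S (layer l (Suc k))"
      by (intro translates_mono layer_mono) simp
    then show ?thesis using Suc.IH[OF 1 Suc.prems(2)] by blast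
  qed (simp add: pull_def)
qed (auto simp: pull_def)

definition reached :: "('a \<rightharpoonup> 'g) \<Rightarrow> nat \<Rightarrow> 'a set" where
  "reached l k = translates \<phi> S (layer l k) \<inter> (B - hit \<phi> l)"

lemma reached_sets: "borel_matching l \<Longrightarrow> reached l k \<in> sets M"
  unfolding reached_def by (intro sets.Int sets.Diff translates_sets layer_sets hit_sets sets_AB)

text \<open>
  As long as no unmatched point of \<open>B\<close> is reached, the neighbours of a layer are matched and their
  partners belong to the next layer.
\<close>

lemma layer_growth:
  assumes l: "borel_matching l" and none: "measure M (reached l k) = 0"
  shows "min (3 / 4 * m) (2 * measure M (layer l k)) \<le> measure M (layer l (Suc k))"
proof -
  let ?T = "translates \<phi> S (layer l k)"
  have T: "?T \<in> sets M" using l by (intro translates_sets layer_sets)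
  have "min (3 / 4 * m) (2 * measure M (layer l k)) \<le> measure M (?T \<inter> B)"
    by (intro expand_AB layer_sets layer_subset l)
  also have "?T \<inter> B = (?T \<inter> hit \<phi> l) \<union> reached l k"
    using hit_subset[OF l] by (auto simp: reached_def)
  also have "measure M \<dots> \<le> measure M (?T \<inter> hit \<phi> l) + measure M (reached l k)"
    using T hit_sets[OF l] reached_sets[OF l] by (intro measure_Un_le) auto
  also have "\<dots> = measure M (pull l ?T)" using none measure_pull[OF l T] by simp
  also have "\<dots> \<le> measure M (layer l (Suc k))"
    using pull_sets[OF l T] layer_sets[OF l] layer_subset[OF l, of "Suc k"]
    by (intro measure_mono_fmeasurable fm_A) auto
  finally show ?thesis .
qed

lemma layer_lower_bound:
  assumes l: "borel_matching l" and none: "\<And>j. j < k \<Longrightarrow> measure M (reached l j) = 0"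
  shows "min (3 / 4 * m) (2 ^ k * unmatched l) \<le> measure M (layer l k)"
  using none
proof (induction k)
  case 0
  then show ?case using unmatched_eq[OF l] by simp
next
  case (Suc k)
  have "min (3 / 4 * m) (2 ^ k * unmatched l) \<le> measure M (layer l k)" using Suc by simp
  moreover have "min (3 / 4 * m) (2 * measure M (layer l k)) \<le> measure M (layer l (Suc k))"
    using Suc.prems by (intro layer_growth l) simp
  ultimately show ?case using m by (simp add: min_def split: if_splits)
qed

text \<open>
  Once a layer fills three quarters of \<open>A\<close>, expansion from the other side applies to the points of
  \<open>B\<close> that it does not reach, and the part of \<open>A\<close> missed by the layers shrinks geometrically.
\<close>

lemma unreached_bound:
  assumes l: "borel_matching l" and big: "3 / 4 * m \<le> measure M (layer l k)"
  defines "W \<equiv> B - translates \<phi> S (layer l k)"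
  shows "2 * measure M W \<le> m - measure M (layer l k)"
    and "m - measure M (layer l (Suc k)) \<le> measure M W"
proof -
  have def: "measure M (A - layer l i) = m - measure M (layer l i)" for i
    using measure_Diff[of M A "layer l i"] A sets_AB layer_sets[OF l] layer_subset[OF l] mA
    by (auto simp: fmeasurable_def)
  have W: "W \<in> sets M" "W \<subseteq> B"
    unfolding W_def using sets_AB translates_sets[OF layer_sets[OF l]] by auto
  have "translates \<phi> S W \<inter> A \<subseteq> A - layer l k"
  proof
    fix x assume x: "x \<in> translates \<phi> S W \<inter> A"
    then obtain s w where sw: "s \<in> S" "w \<in> W" "x = \<phi> s w" by (auto simp: translates_def)
    have "x \<notin> layer l k"
    proof
      assume "x \<in> layer l k"
      moreover have "w = \<phi> (inv s) x" using sw S by auto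
      ultimately have "w \<in> translates \<phi> S (layer l k)" using sym[OF sw(1)] by (auto simp: translates_def)
      then show False using sw(2) by (simp add: W_def)
    qed
    then show "x \<in> A - layer l k" using x by simp
  qed
  moreover have "translates \<phi> S W \<inter> A \<in> sets M"
    using W translates_sets sets_AB by blast
  moreover have "A - layer l k \<in> fmeasurable M"
    using sets_AB layer_sets[OF l] by (intro fm_A) auto
  ultimately have "measure M (translates \<phi> S W \<inter> A) \<le> measure M (A - layer l k)"
    by (rule measure_mono_fmeasurable)
  then have "measure M (translates \<phi> S W \<inter> A) \<le> m - measure M (layer l k)"
    unfolding def .
  then show "2 * measure M W \<le> m - measure M (layer l k)"
    using expand_BA[OF W] big m by (simp add: min_def split: if_splits)
  have "A - layer l (Suc k) \<subseteq> pull l W"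
  proof
    fix x assume x: "x \<in> A - layer l (Suc k)"
    then have "x \<notin> layer l 0" using layer_mono[of 0 "Suc k" l] by blast
    then have xd: "x \<in> dom l" using x by simp
    then have "move \<phi> l x \<in> B" using matchingD(3)[OF l] by blast
    moreover have "move \<phi> l x \<notin> translates \<phi> S (layer l k)" using x xd by (simp add: pull_def)
    ultimately show "x \<in> pull l W" using xd by (simp add: pull_def W_def)
  qed
  then have "measure M (A - layer l (Suc k)) \<le> measure M (pull l W)"
    using pull_sets[OF l W(1)] pull_subset[of l W] matchingD(1)[OF l] layer_sets[OF l, of "Suc k"] sets_AB
    by (intro measure_mono_fmeasurable fm_A sets.Diff) (auto simp del: layer.simps)
  also have "\<dots> = measure M (W \<inter> hit \<phi> l)" by (rule measure_pull[OF l W(1)])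
  also have "\<dots> \<le> measure M W"
    using W hit_sets[OF l] by (intro measure_mono_fmeasurable fm_B) auto
  finally show "m - measure M (layer l (Suc k)) \<le> measure M W" unfolding def .
qed

text \<open>
  In \<open>k\<close> steps the layers grow from measure \<open>unmatched l\<close> to three quarters of \<open>m\<close>, and in another \<open>k\<close>
  steps the unreached part of \<open>B\<close> becomes smaller than the unmatched part.
\<close>

lemma reached_positive:
  assumes l: "borel_matching l" and k: "m \<le> 2 ^ k * unmatched l"
  shows "\<exists>j\<le>2 * k. 0 < measure M (reached l j)"
proof (rule ccontr)
  assume no: "\<not> ?thesis"
  have none: "measure M (reached l j) = 0" if "j \<le> 2 * k" for j
  proof -
    have "\<not> 0 < measure M (reached l j)" using no that by blast
    then show ?thesis using measure_nonneg[of M "reached l j"] by linarith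
  qed
  have start: "3 / 4 * m \<le> measure M (layer l k)"
    using layer_lower_bound[OF l, of k] none k m by (simp add: min_def split: if_splits)
  have deficit: "m - measure M (layer l (k + i)) \<le> m / 4 * (1 / 2) ^ i" for i
  proof (induction i)
    case (Suc i)
    have "m / 4 * (1 / 2) ^ i \<le> m / 4 * 1" using m by (intro mult_left_mono power_le_one) auto
    then have "3 / 4 * m \<le> measure M (layer l (k + i))" using Suc by simp
    from unreached_bound[OF l this] show ?case using Suc by simp
  qed (use start in simp)
  have "m / 4 * (1 / 2) ^ k \<le> m / 4 * 1" using m by (intro mult_left_mono power_le_one) auto
  then have big: "3 / 4 * m \<le> measure M (layer l (k + k))" using deficit[of k] by simp
  let ?W = "B - translates \<phi> S (layer l (k + k))"
  have W: "?W \<in> sets M" using sets_AB translates_sets[OF layer_sets[OF l]] by auto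
  have "unmatched l \<le> measure M (?W \<union> reached l (k + k))"
    unfolding unmatched_def using W sets_AB hit_sets[OF l] reached_sets[OF l]
    by (intro measure_mono_fmeasurable fm_B) (auto simp: reached_def)
  also have "\<dots> \<le> measure M ?W + measure M (reached l (k + k))"
    using W reached_sets[OF l] by (rule measure_Un_le)
  also have "measure M (reached l (k + k)) = 0" by (intro none) simp
  finally have "2 * unmatched l \<le> m / 4 * (1 / 2) ^ k"
    using unreached_bound(1)[OF l big] deficit[of k] by linarith
  then have "2 ^ k * (2 * unmatched l) \<le> 2 ^ k * (m / 4 * (1 / 2) ^ k)" by (intro mult_left_mono) auto
  also have "\<dots> = m / 4" by (simp add: power_one_over)
  finally show False using k m by linarith
qed

lemma measure_act:
  assumes "s \<in> S" "X \<in> sets M"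
  shows "measure M (\<phi> s ` X) = measure M X"
  using assms S invariant[of s X] by (auto simp: measure_def)

lemma act_sets:
  assumes "s \<in> S" "X \<in> sets M"
  shows "\<phi> s ` X \<in> sets M"
  using assms S act_image[of s X] by (auto simp: sets_M)

lemma differ_sets:
  assumes f: "borel_matching f" and g: "borel_matching g"
  shows "{x. f x \<noteq> g x} \<in> sets M"
proof -
  have "{x. f x \<noteq> g x} = (dom f \<union> dom g) - (\<Union>s\<in>S. {x. f x = Some s} \<inter> {x. g x = Some s})"
    (is "_ = ?R")
  proof (intro equalityI subsetI)
    fix x assume "x \<in> {x. f x \<noteq> g x}"
    then show "x \<in> ?R" by (cases "f x"; cases "g x") auto
  next
    fix x assume x: "x \<in> ?R"
    show "x \<in> {x. f x \<noteq> g x}"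
    proof
      show "f x \<noteq> g x"
      proof
        assume e: "f x = g x"
        then have "f x \<noteq> None" using x by (auto simp: dom_def)
        then obtain s where "f x = Some s" by blast
        then show False using x e matching_Some(2)[OF f] by auto
      qed
    qed
  qed
  moreover have "(\<Union>s\<in>S. {x. f x = Some s} \<inter> {x. g x = Some s}) \<in> sets M"
    using S matchingD(5)[OF f] matchingD(5)[OF g] by (intro sets.finite_UN sets.Int) (auto simp: sets_M)
  ultimately show ?thesis using dom_sets[OF f] dom_sets[OF g] by auto
qed

lemma differ_subset:
  assumes f: "borel_matching f" and g: "borel_matching g"
  shows "{x. f x \<noteq> g x} \<subseteq> A"
proof
  fix x assume "x \<in> {x. f x \<noteq> g x}"
  then have "x \<in> dom f \<or> x \<in> dom g" by (cases "f x"; cases "g x") auto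
  then show "x \<in> A" using matchingD(1)[OF f] matchingD(1)[OF g] by blast
qed

lemma frequent_label:
  assumes Y: "Y \<in> sets M" "Y \<subseteq> translates \<phi> S X" "0 < measure M Y" and X: "X \<in> sets M"
  obtains s where "s \<in> S" "0 < measure M (Y \<inter> \<phi> s ` X)"
proof -
  have "\<exists>s\<in>S. 0 < measure M (Y \<inter> \<phi> s ` X)"
  proof (rule ccontr)
    assume no: "\<not> ?thesis"
    have "Y = (\<Union>s\<in>S. Y \<inter> \<phi> s ` X)" using Y(2) by (auto simp: translates_def)
    then have "measure M Y \<le> (\<Sum>s\<in>S. measure M (Y \<inter> \<phi> s ` X))"
      using measure_UNION_le[OF S(1), of "\<lambda>s. Y \<inter> \<phi> s ` X" M] Y(1) act_sets[OF _ X] by auto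
    also have "\<dots> \<le> (\<Sum>s\<in>S. 0)" using no by (intro sum_mono) (auto simp: not_less)
    finally show False using Y(3) by simp
  qed
  then show ?thesis using that by blast
qed

lemma matching_restrict_sets:
  assumes "borel_matching l" "V \<in> sets M"
  shows "borel_matching (l |` V)"
  by (rule matching_restrict[OF assms(1)]) (use matchingD(5)[OF assms(1)] assms(2) in \<open>auto simp: sets_M\<close>)

text \<open>
  Shifting along alternating paths. A part \<open>Y'\<close> of \<open>Y\<close> that is reached by paths with the same labels is
  added to the matched points. The paths start at different points of \<open>Y'\<close> but use the same group
  elements, and their vertices lie in different layers, so they do not collide.
\<close>

lemma shift_along_layers:
  assumes l: "borel_matching l"
  shows "\<lbrakk>Y \<in> sets M; Y \<subseteq> B; Y \<subseteq> translates \<phi> S (layer l k);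
      \<forall>i<k. Y \<inter> translates \<phi> S (layer l i) = {}; 0 < measure M Y\<rbrakk> \<Longrightarrow>
    \<exists>Y' g. Y' \<in> sets M \<and> Y' \<subseteq> Y \<and> 0 < measure M Y' \<and> borel_matching g \<and> dom g \<subseteq> layer l k \<and>
      hit \<phi> g = hit \<phi> (l |` layer l k) \<union> Y' \<and>
      measure M {x. g x \<noteq> (l |` layer l k) x} \<le> (real k + 1) * measure M Y'"
proof (induction k arbitrary: Y)
  case 0
  let ?X = "layer l 0"
  have X: "?X \<in> sets M" by (rule layer_sets[OF l])
  obtain s where s: "s \<in> S" "0 < measure M (Y \<inter> \<phi> s ` ?X)"
    using frequent_label[OF 0(1,3,5) X] .
  have sc: "s \<in> carrier G" using s S by auto
  define Q where "Q = \<phi> (inv s) ` (Y \<inter> \<phi> s ` ?X)"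
  have sQ: "\<phi> s ` Q = Y \<inter> \<phi> s ` ?X" using sc by (auto simp: Q_def image_image)
  have Q: "Q \<in> sets M" "Q \<subseteq> ?X" using 0(1) X s sym sc by (auto simp: Q_def intro!: act_sets)
  have empty: "l |` ?X = Map.empty" by (auto simp: restrict_map_def)
  have me: "borel_matching Map.empty" by (rule matchingI) auto
  have he: "hit \<phi> Map.empty = {}" by (simp add: hit_def)
  define g where "g = (\<lambda>x. if x \<in> Q then Some s else Map.empty x)"
  have QA: "Q \<subseteq> A - dom Map.empty" using Q(2) by auto
  have sQB: "\<phi> s ` Q \<subseteq> B - hit \<phi> Map.empty" unfolding sQ he using 0(2) by blast
  have Qb: "Q \<in> sets borel" using Q(1) by (simp add: sets_M)
  note ext = matching_extend[OF me act_inj[OF sc] s(1) QA sQB Qb sets.Un]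
  have mg: "borel_matching g" unfolding g_def by (rule ext(1))
  have dg: "dom g = Q" by (auto simp: g_def split: if_splits)
  have hg: "hit \<phi> g = hit \<phi> Map.empty \<union> \<phi> s ` Q" unfolding g_def by (rule ext(3))
  have "{x. g x \<noteq> (l |` ?X) x} = Q" unfolding empty g_def by auto
  moreover have "measure M (\<phi> s ` Q) = measure M Q" by (rule measure_act[OF s(1) Q(1)])
  ultimately have "measure M {x. g x \<noteq> (l |` ?X) x} \<le> (real 0 + 1) * measure M (\<phi> s ` Q)" by simp
  moreover have "hit \<phi> g = hit \<phi> (l |` ?X) \<union> \<phi> s ` Q" unfolding empty by (rule hg)
  moreover have "dom g \<subseteq> ?X" unfolding dg by (rule Q(2))
  moreover have "\<phi> s ` Q \<in> sets M" by (rule act_sets[OF s(1) Q(1)])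
  moreover have "\<phi> s ` Q \<subseteq> Y" "0 < measure M (\<phi> s ` Q)" using s(2) by (auto simp: sQ)
  ultimately show ?case using mg by (intro exI[of _ "\<phi> s ` Q"] exI[of _ g] conjI)
next
  case (Suc k)
  define X where "X = layer l k"
  define X' where "X' = layer l (Suc k)"
  have Xs: "X \<in> sets M" "X' \<in> sets M" unfolding X_def X'_def by (rule layer_sets[OF l])+
  have XX': "X \<subseteq> X'" and X'_eq: "X' = X \<union> pull l (translates \<phi> S X)" by (auto simp: X_def X'_def)
  have X'A: "X' \<subseteq> A" unfolding X'_def by (rule layer_subset[OF l])
  obtain s where s: "s \<in> S" "0 < measure M (Y \<inter> \<phi> s ` X')"
    using frequent_label[OF Suc.prems(1,3,5) layer_sets[OF l]] unfolding X'_def .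
  have sc: "s \<in> carrier G" using s S by auto
  define Q where "Q = \<phi> (inv s) ` (Y \<inter> \<phi> s ` X')"
  have sQ: "\<phi> s ` Q = Y \<inter> \<phi> s ` X'" using sc by (auto simp: Q_def image_image)
  have Q: "Q \<in> sets M" "Q \<subseteq> X'"
    using Suc.prems(1) Xs s sym sc by (auto simp: Q_def intro!: act_sets)
  have YX: "Y \<inter> translates \<phi> S X = {}" using Suc.prems(4) by (simp add: X_def)
  have QX: "Q \<inter> X = {}"
  proof (rule ccontr)
    assume "Q \<inter> X \<noteq> {}"
    then obtain q where q: "q \<in> Q" "q \<in> X" by blast
    then have "\<phi> s q \<in> Y" using sQ by blast
    moreover have "\<phi> s q \<in> translates \<phi> S X" using q s(1) by (auto simp: translates_def)
    ultimately show False using YX by blast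
  qed
  have Qpull: "Q \<subseteq> pull l (translates \<phi> S X)" using Q(2) QX X'_eq by blast
  then have Qdom: "Q \<subseteq> dom l" using pull_subset by blast
  define Z where "Z = move \<phi> l ` (Q \<inter> dom l)"
  have Z: "Z \<in> sets M" "measure M Z = measure M Q"
    using moved_sets[OF l Q(1)] measure_moved[OF l Q(1)] Qdom by (auto simp: Z_def Int_absorb2)
  have ZB: "Z \<subseteq> B" using matchingD(3)[OF l] by (auto simp: Z_def)
  have ZX: "Z \<subseteq> translates \<phi> S (layer l k)" using Qpull by (auto simp: Z_def pull_def X_def)
  have Zi: "Z \<inter> translates \<phi> S (layer l i) = {}" if i: "i < k" for i
  proof (rule ccontr)
    assume "Z \<inter> translates \<phi> S (layer l i) \<noteq> {}"
    then obtain q where q: "q \<in> Q" "q \<in> pull l (translates \<phi> S (layer l i))"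
      using Qdom by (auto simp: Z_def pull_def)
    then have "q \<in> layer l (Suc i)" by simp
    then have "q \<in> X" unfolding X_def using layer_mono[of "Suc i" k l] i by auto
    then show False using q(1) QX by blast
  qed
  have mQ: "measure M (\<phi> s ` Q) = measure M Q" by (rule measure_act[OF s(1) Q(1)])
  then have Zpos: "0 < measure M Z" using s(2) Z(2) sQ by simp
  have "\<forall>i<k. Z \<inter> translates \<phi> S (layer l i) = {}" using Zi by simp
  from Suc.IH[OF Z(1) ZB ZX this Zpos] obtain Z' g'
    where Z': "Z' \<in> sets M" "Z' \<subseteq> Z" "0 < measure M Z'" and g': "borel_matching g'" "dom g' \<subseteq> X"
      "hit \<phi> g' = hit \<phi> (l |` X) \<union> Z'" and dg': "measure M {x. g' x \<noteq> (l |` X) x} \<le> (real k + 1) * measure M Z'"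
    unfolding X_def by (elim exE conjE)
  define Q' where "Q' = Q \<inter> pull l Z'"
  have Q': "Q' \<in> sets M" "Q' \<subseteq> Q" using Q(1) pull_sets[OF l Z'(1)] by (auto simp: Q'_def)
  have moveQ': "move \<phi> l ` (Q' \<inter> dom l) = Z'"
  proof (intro equalityI subsetI)
    fix z assume z: "z \<in> Z'"
    have "z \<in> move \<phi> l ` (Q \<inter> dom l)" using subsetD[OF Z'(2) z] unfolding Z_def .
    then obtain q where "q \<in> Q" "q \<in> dom l" "z = move \<phi> l q" by blast
    then show "z \<in> move \<phi> l ` (Q' \<inter> dom l)" using z by (auto simp: Q'_def pull_def)
  qed (auto simp: Q'_def pull_def)
  have mQ': "measure M Q' = measure M Z'"
    using measure_moved[OF l Q'(1)] moveQ' Q'(2) Qdom by (simp add: Int_absorb2)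
  define R where "R = X' - X - Q'"
  have R: "R \<in> sets M" using Xs Q' by (auto simp: R_def)
  have lR: "borel_matching (l |` R)" by (rule matching_restrict_sets[OF l R])
  have domR: "dom (l |` R) = R \<inter> dom l" by (auto simp: restrict_map_def split: if_splits)
  have hitR: "hit \<phi> (l |` R) = move \<phi> l ` (R \<inter> dom l)" by (rule hit_restrict)
  have hitX: "hit \<phi> (l |` X) = move \<phi> l ` (X \<inter> dom l)" by (rule hit_restrict)
  have injl: "inj_on (move \<phi> l) (dom l)" by (rule matchingD(4)[OF l])
  have g'im: "hit \<phi> g' = move \<phi> l ` ((X \<union> Q') \<inter> dom l)"
    unfolding g'(3) hitX moveQ'[symmetric] by (simp add: image_Un Int_Un_distrib2)
  have dis1: "dom g' \<inter> dom (l |` R) = {}" using g'(2) unfolding domR unfolding R_def by blast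
  have "((X \<union> Q') \<inter> dom l) \<inter> (R \<inter> dom l) = {}" by (auto simp: R_def)
  then have dis2: "hit \<phi> g' \<inter> hit \<phi> (l |` R) = {}"
    unfolding g'im hitR using inj_on_image_Int[OF injl, of "(X \<union> Q') \<inter> dom l" "R \<inter> dom l"] by simp
  define h where "h = g' ++ (l |` R)"
  note un = matching_Un[OF g'(1) lR dis1 dis2 sets.Un, folded h_def]
  have domh: "dom h = (R \<inter> dom l) \<union> dom g'" unfolding h_def dom_map_add domR ..
  have hith: "hit \<phi> h = hit \<phi> (l |` X')"
  proof -
    have e: "((X \<union> Q') \<inter> dom l) \<union> (R \<inter> dom l) = X' \<inter> dom l"
      using XX' Q'(2) Q(2) by (auto simp: R_def)
    have "hit \<phi> h = move \<phi> l ` ((X \<union> Q') \<inter> dom l) \<union> move \<phi> l ` (R \<inter> dom l)"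
      using un(2) unfolding g'im hitR .
    also have "\<dots> = move \<phi> l ` (((X \<union> Q') \<inter> dom l) \<union> (R \<inter> dom l))" by (rule image_Un[symmetric])
    finally show ?thesis unfolding e hit_restrict .
  qed
  define g where "g = (\<lambda>x. if x \<in> Q' then Some s else h x)"
  have Q'X: "Q' \<inter> X = {}" using Q'(2) QX by blast
  have Q'A: "Q' \<subseteq> A - dom h" using Q'(2) Q(2) X'A Q'X g'(2) unfolding domh unfolding R_def by blast
  have sQ'Y: "\<phi> s ` Q' \<subseteq> Y" using Q'(2) sQ by blast
  have sQ'B: "\<phi> s ` Q' \<subseteq> B - hit \<phi> h"
  proof
    fix y assume y: "y \<in> \<phi> s ` Q'"
    have "y \<notin> move \<phi> l ` (X' \<inter> dom l)"
    proof
      assume "y \<in> move \<phi> l ` (X' \<inter> dom l)"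
      then obtain x where "x \<in> layer l (Suc k)" "x \<in> dom l" "y = move \<phi> l x" by (auto simp: X'_def)
      then have "y \<in> translates \<phi> S X" using moved_layer unfolding X_def by blast
      then show False using y sQ'Y YX by blast
    qed
    then show "y \<in> B - hit \<phi> h" using y sQ'Y Suc.prems(2) unfolding hith hit_restrict by blast
  qed
  have Q'b: "Q' \<in> sets borel" using Q'(1) by (simp add: sets_M)
  note ext = matching_extend[OF un(1) act_inj[OF sc] s(1) Q'A sQ'B Q'b sets.Un]
  have mg: "borel_matching g" unfolding g_def by (rule ext(1))
  have dg: "dom g = dom h \<union> Q'" unfolding g_def by (rule ext(2))
  have hg: "hit \<phi> g = hit \<phi> h \<union> \<phi> s ` Q'" unfolding g_def by (rule ext(3))
  have mY': "measure M (\<phi> s ` Q') = measure M Z'" using measure_act[OF s(1) Q'(1)] mQ' by simp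
  have ch: "{x. g x \<noteq> (l |` X') x} \<subseteq> {x. g' x \<noteq> (l |` X) x} \<union> Q'"
  proof
    fix x assume x: "x \<in> {x. g x \<noteq> (l |` X') x}"
    show "x \<in> {x. g' x \<noteq> (l |` X) x} \<union> Q'"
    proof (rule ccontr)
      assume "x \<notin> {x. g' x \<noteq> (l |` X) x} \<union> Q'"
      then have no: "g' x = (l |` X) x" "x \<notin> Q'" by auto
      have "g x = h x" using no by (simp add: g_def)
      also have "\<dots> = (l |` X') x"
        using no XX' by (auto simp: h_def map_add_def restrict_map_def R_def split: option.splits)
      finally show False using x by simp
    qed
  qed
  have lX: "borel_matching (l |` X)" by (rule matching_restrict_sets[OF l Xs(1)])
  have D: "{x. g' x \<noteq> (l |` X) x} \<in> sets M" "{x. g' x \<noteq> (l |` X) x} \<subseteq> A"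
    by (rule differ_sets[OF g'(1) lX], rule differ_subset[OF g'(1) lX])
  have "{x. g x \<noteq> (l |` X') x} \<in> sets M"
    by (rule differ_sets[OF mg matching_restrict_sets[OF l Xs(2)]])
  moreover have "{x. g' x \<noteq> (l |` X) x} \<union> Q' \<in> fmeasurable M"
    using D Q'(1) Q'A by (intro fm_A sets.Un Un_least) auto
  ultimately have "measure M {x. g x \<noteq> (l |` X') x} \<le> measure M ({x. g' x \<noteq> (l |` X) x} \<union> Q')"
    by (rule measure_mono_fmeasurable[OF ch])
  also have "\<dots> \<le> measure M {x. g' x \<noteq> (l |` X) x} + measure M Q'"
    using D(1) Q'(1) by (rule measure_Un_le)
  also have "\<dots> \<le> (real k + 1) * measure M Z' + measure M Z'" using dg' mQ' by simp
  also have "\<dots> = (real (Suc k) + 1) * measure M (\<phi> s ` Q')" unfolding mY' by (simp add: algebra_simps)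
  finally have "measure M {x. g x \<noteq> (l |` X') x} \<le> (real (Suc k) + 1) * measure M (\<phi> s ` Q')" .
  moreover have "hit \<phi> g = hit \<phi> (l |` X') \<union> \<phi> s ` Q'" unfolding hg hith ..
  moreover have "dom g \<subseteq> X'" using g'(2) XX' Q'(2) Q(2) unfolding dg domh unfolding R_def by blast
  moreover have "\<phi> s ` Q' \<in> sets M" by (rule act_sets[OF s(1) Q'(1)])
  moreover have "0 < measure M (\<phi> s ` Q')" using Z'(3) mY' by simp
  ultimately show ?case using mg sQ'Y unfolding X'_def
    by (intro exI[of _ "\<phi> s ` Q'"] exI[of _ g] conjI)
qed

lemma augment:
  assumes l: "borel_matching l" and Y: "Y \<in> sets M" "Y \<subseteq> B - hit \<phi> l" "0 < measure M Y"
    and reach: "Y \<subseteq> translates \<phi> S (layer l k)" "\<forall>i<k. Y \<inter> translates \<phi> S (layer l i) = {}"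
  obtains f where "borel_matching f" "unmatched f < unmatched l"
    "measure M {x. f x \<noteq> l x} \<le> (real k + 1) * (unmatched l - unmatched f)"
proof -
  define X where "X = layer l k"
  have X: "X \<in> sets M" unfolding X_def by (rule layer_sets[OF l])
  have YB: "Y \<subseteq> B" using Y(2) by blast
  from shift_along_layers[OF l Y(1) YB reach Y(3)]
  obtain Y' g where Y': "Y' \<in> sets M" "Y' \<subseteq> Y" "0 < measure M Y'" and g: "borel_matching g" "dom g \<subseteq> X"
    "hit \<phi> g = hit \<phi> (l |` X) \<union> Y'" and d: "measure M {x. g x \<noteq> (l |` X) x} \<le> (real k + 1) * measure M Y'"
    unfolding X_def by (elim exE conjE)
  have lX: "borel_matching (l |` (- X))" using X by (intro matching_restrict_sets[OF l]) (auto simp: sets_M)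
  have injl: "inj_on (move \<phi> l) (dom l)" by (rule matchingD(4)[OF l])
  have dis1: "dom g \<inter> dom (l |` (- X)) = {}" using g(2) by (auto simp: restrict_map_def split: if_splits)
  have "move \<phi> l ` (X \<inter> dom l) \<inter> move \<phi> l ` (- X \<inter> dom l) = {}"
    using inj_on_image_Int[OF injl, of "X \<inter> dom l" "- X \<inter> dom l"] by auto
  moreover have "Y' \<inter> move \<phi> l ` (- X \<inter> dom l) = {}" using Y' Y(2) by (auto simp: hit_def)
  ultimately have dis2: "hit \<phi> g \<inter> hit \<phi> (l |` (- X)) = {}"
    unfolding g(3) hit_restrict by blast
  define f where "f = g ++ (l |` (- X))"
  note un = matching_Un[OF g(1) lX dis1 dis2 sets.Un, folded f_def]
  have "(X \<inter> dom l) \<union> (- X \<inter> dom l) = dom l" by blast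
  then have pq: "move \<phi> l ` (X \<inter> dom l) \<union> move \<phi> l ` (- X \<inter> dom l) = hit \<phi> l"
    unfolding hit_def by (metis image_Un)
  have "hit \<phi> f = (move \<phi> l ` (X \<inter> dom l) \<union> Y') \<union> move \<phi> l ` (- X \<inter> dom l)"
    using un(2) unfolding g(3) hit_restrict .
  also have "\<dots> = (move \<phi> l ` (X \<inter> dom l) \<union> move \<phi> l ` (- X \<inter> dom l)) \<union> Y'"
    by (simp only: Un_ac)
  finally have hf: "hit \<phi> f = hit \<phi> l \<union> Y'" unfolding pq .
  have "B - hit \<phi> f = (B - hit \<phi> l) - Y'" unfolding hf by blast
  moreover have "measure M ((B - hit \<phi> l) - Y') = unmatched l - measure M Y'"
    unfolding unmatched_def
    using Y' Y(2) sets_AB hit_sets[OF l] fm_B[of "B - hit \<phi> l"]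
    by (intro measure_Diff) (auto simp: fmeasurable_def)
  ultimately have gain: "unmatched f = unmatched l - measure M Y'" by (simp add: unmatched_def)
  have "f x \<noteq> l x \<longleftrightarrow> g x \<noteq> (l |` X) x" for x
  proof (cases "x \<in> X")
    case True
    then show ?thesis by (simp add: f_def map_add_def)
  next
    case False
    have "x \<notin> dom g" using g(2) False by (rule contra_subsetD)
    then have "g x = None" by (simp add: domIff)
    then show ?thesis using False by (cases "l x") (auto simp: f_def map_add_def)
  qed
  then have "{x. f x \<noteq> l x} = {x. g x \<noteq> (l |` X) x}" by (rule Collect_cong)
  then have ch: "measure M {x. f x \<noteq> l x} \<le> (real k + 1) * measure M Y'" using d by (simp only:)
  have mf: "borel_matching f" by (rule un(1))
  have gain': "unmatched l - unmatched f = measure M Y'" using gain by linarith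
  show ?thesis
  proof (rule that[OF mf])
    show "unmatched f < unmatched l" using gain Y'(3) by linarith
    show "measure M {x. f x \<noteq> l x} \<le> (real k + 1) * (unmatched l - unmatched f)"
      unfolding gain' by (rule ch)
  qed
qed

text \<open>
  Path lengths are linear in \<open>k\<close> while \<open>u\<close> is of the order \<open>1 / 2 ^ k\<close>; this makes their product with
  \<open>sqrt u\<close> bounded.
\<close>

lemma path_length_bound: "(2 * real k + 1)\<^sup>2 \<le> 9 * 2 ^ k"
proof -
  have step: "(2 * real (Suc k) + 1)\<^sup>2 \<le> 9 * 2 ^ Suc k" if "3 \<le> k" "(2 * real k + 1)\<^sup>2 \<le> 9 * 2 ^ k" for k
  proof -
    have "0 \<le> (real k - 3) * (4 * real k + 8) + 17" using that(1) by (intro add_nonneg_nonneg mult_nonneg_nonneg) auto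
    then have "(2 * real (Suc k) + 1)\<^sup>2 \<le> 2 * (2 * real k + 1)\<^sup>2"
      by (simp add: power2_eq_square algebra_simps)
    then show ?thesis using that(2) by simp
  qed
  consider "k = 0" | "k = 1" | "k = 2" | "3 \<le> k" by linarith
  then show ?thesis
  proof cases
    case 4
    then show ?thesis by (induction k rule: dec_induct) (use step in simp_all)
  qed simp_all
qed

text \<open>
  If a part \<open>u\<close> of \<open>B\<close> is unmatched, then paths whose length is logarithmic in \<open>m / u\<close> suffice. The
  changes caused by an improvement are therefore controlled by the decrease of \<open>sqrt u\<close>.
\<close>

lemma improve:
  assumes l: "borel_matching l" and pos: "0 < unmatched l"
  obtains f where "borel_matching f" "unmatched f < unmatched l"
    "measure M {x. f x \<noteq> l x} \<le> 2 * sqrt (18 * m) * (sqrt (unmatched l) - sqrt (unmatched f))"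
proof -
  let ?u = "unmatched l"
  have ex: "\<exists>k. m \<le> 2 ^ k * ?u"
  proof -
    obtain k where "m / ?u < 2 ^ k" using real_arch_pow[of 2 "m / ?u"] by auto
    then have "m \<le> 2 ^ k * ?u" using pos by (simp add: pos_divide_less_eq)
    then show ?thesis by blast
  qed
  define k where "k = (LEAST k. m \<le> 2 ^ k * ?u)"
  have k: "m \<le> 2 ^ k * ?u" unfolding k_def by (rule LeastI_ex[OF ex])
  have k2: "2 ^ k * ?u \<le> 2 * m"
  proof (cases k)
    case 0
    then show ?thesis using unmatched_bounds(2)[OF l] m by simp
  next
    case (Suc i)
    then have "\<not> m \<le> 2 ^ i * ?u" unfolding k_def by (metis not_less_Least lessI)
    then show ?thesis using Suc by simp
  qed
  define j where "j = (LEAST j. 0 < measure M (reached l j))"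
  obtain j0 where j0: "j0 \<le> 2 * k" "0 < measure M (reached l j0)" using reached_positive[OF l k] by blast
  have j: "0 < measure M (reached l j)" unfolding j_def by (rule LeastI[of _ j0]) (rule j0(2))
  have jk: "j \<le> 2 * k" unfolding j_def using Least_le[of "\<lambda>j. 0 < measure M (reached l j)" j0] j0 by simp
  define Y where "Y = reached l j - (\<Union>i<j. reached l i)"
  have Y: "Y \<in> sets M" unfolding Y_def using reached_sets[OF l] by auto
  have "measure M (\<Union>i<j. reached l i) \<le> (\<Sum>i<j. measure M (reached l i))"
    using reached_sets[OF l] by (intro measure_UNION_le) auto
  also have "\<dots> \<le> (\<Sum>i<j. 0)"
    using not_less_Least[of _ "\<lambda>j. 0 < measure M (reached l j)"] unfolding j_def
    by (intro sum_mono) (simp add: not_less)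
  finally have null: "measure M (\<Union>i<j. reached l i) \<le> 0" by simp
  have un: "(\<Union>i<j. reached l i) \<in> sets M" using reached_sets[OF l] by auto
  have "measure M (reached l j) \<le> measure M (Y \<union> (\<Union>i<j. reached l i))"
  proof (intro measure_mono_fmeasurable fm_B)
    show "reached l j \<subseteq> Y \<union> (\<Union>i<j. reached l i)" by (auto simp: Y_def)
    show "Y \<union> (\<Union>i<j. reached l i) \<subseteq> B" by (auto simp: Y_def reached_def)
  qed (use Y un reached_sets[OF l] in auto)
  also have "\<dots> \<le> measure M Y + measure M (\<Union>i<j. reached l i)"
    using Y reached_sets[OF l] by (intro measure_Un_le) auto
  finally have Ypos: "0 < measure M Y" using j null by linarith
  have Ysub: "Y \<subseteq> B - hit \<phi> l" "Y \<subseteq> translates \<phi> S (layer l j)" by (auto simp: Y_def reached_def)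
  have Yi: "\<forall>i<j. Y \<inter> translates \<phi> S (layer l i) = {}" by (auto simp: Y_def reached_def)
  obtain f where f: "borel_matching f" "unmatched f < ?u"
    "measure M {x. f x \<noteq> l x} \<le> (real j + 1) * (?u - unmatched f)"
    by (rule augment[OF l Y Ysub(1) Ypos Ysub(2) Yi])
  let ?v = "unmatched f"
  have v: "0 \<le> ?v" by (rule unmatched_bounds)
  have "((2 * real k + 1) * sqrt ?u)\<^sup>2 = (2 * real k + 1)\<^sup>2 * ?u" using pos by (simp add: power_mult_distrib)
  also have "\<dots> \<le> 9 * 2 ^ k * ?u" using path_length_bound pos by (intro mult_right_mono) auto
  also have "\<dots> \<le> 18 * m" unfolding mult.assoc using k2 by linarith
  finally have len: "(2 * real k + 1) * sqrt ?u \<le> sqrt (18 * m)" by (rule real_le_rsqrt)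
  have s: "sqrt ?v \<le> sqrt ?u" using f(2) by simp
  have "(real j + 1) * (?u - ?v) \<le> (2 * real k + 1) * (?u - ?v)"
    using jk f(2) by (intro mult_right_mono) auto
  also have "\<dots> = (2 * real k + 1) * ((sqrt ?u + sqrt ?v) * (sqrt ?u - sqrt ?v))"
    using v pos by (simp add: algebra_simps)
  also have "\<dots> \<le> (2 * real k + 1) * ((2 * sqrt ?u) * (sqrt ?u - sqrt ?v))"
    using s by (intro mult_left_mono mult_right_mono) auto
  also have "\<dots> = 2 * ((2 * real k + 1) * sqrt ?u) * (sqrt ?u - sqrt ?v)" by (simp add: algebra_simps)
  also have "\<dots> \<le> 2 * sqrt (18 * m) * (sqrt ?u - sqrt ?v)"
    using s len by (intro mult_right_mono mult_left_mono) auto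
  finally show ?thesis using that[OF f(1,2)] f(3) by linarith
qed

text \<open>
  The limit is undefined where the labels do not stabilize, which is a null set if the changes
  have finite total measure.
\<close>

definition eventual :: "(nat \<Rightarrow> 'a \<rightharpoonup> 'g) \<Rightarrow> 'a \<rightharpoonup> 'g" where
  "eventual f x = (if \<exists>s. \<forall>\<^sub>F n in sequentially. f n x = Some s
    then Some (THE s. \<forall>\<^sub>F n in sequentially. f n x = Some s) else None)"

lemma eventual_Some: "eventual f x = Some s \<longleftrightarrow> (\<forall>\<^sub>F n in sequentially. f n x = Some s)"
proof -
  have uniq: "s = t" if "\<forall>\<^sub>F n in sequentially. f n x = Some s" "\<forall>\<^sub>F n in sequentially. f n x = Some t" for s t
  proof -
    have "\<forall>\<^sub>F n :: nat in sequentially. s = t" using that by eventually_elim simp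
    then show ?thesis by simp
  qed
  have "(THE t. \<forall>\<^sub>F n in sequentially. f n x = Some t) = s" if "\<forall>\<^sub>F n in sequentially. f n x = Some s" for s
    using that uniq by (intro the_equality) auto
  then show ?thesis unfolding eventual_def by auto
qed

lemma matching_eventual:
  assumes f: "\<And>n. borel_matching (f n)"
  shows "borel_matching (eventual f)"
proof (rule matchingI)
  fix x s assume "eventual f x = Some s"
  then obtain n where "f n x = Some s" unfolding eventual_Some using eventually_happens by fastforce
  then show "x \<in> A \<and> s \<in> S \<and> \<phi> s x \<in> B" using matching_Some[OF f] by blast
next
  fix x y s t assume "eventual f x = Some s" "eventual f y = Some t" and e: "\<phi> s x = \<phi> t y"
  then have "\<forall>\<^sub>F n in sequentially. f n x = Some s" "\<forall>\<^sub>F n in sequentially. f n y = Some t"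
    unfolding eventual_Some by auto
  then have "\<forall>\<^sub>F n :: nat in sequentially. x = y"
    by eventually_elim (rule matching_inj[OF f _ _ e])
  then show "x = y" by simp
next
  fix s
  have "{x. eventual f x = Some s} = (\<Union>N. \<Inter>n. {x. f (N + n) x = Some s})"
    unfolding eventual_Some eventually_sequentially by (auto simp: le_iff_add)
  also have "\<dots> \<in> sets borel"
    using matchingD(5)[OF f] by (intro sets.countable_UN image_subsetI sets.countable_INT) auto
  finally show "{x. eventual f x = Some s} \<in> sets borel" .
qed

lemma eventual_differ: "{x. eventual f x \<noteq> f n x} \<subseteq> (\<Union>i. {x. f (Suc (n + i)) x \<noteq> f (n + i) x})"
proof
  fix x assume x: "x \<in> {x. eventual f x \<noteq> f n x}"
  show "x \<in> (\<Union>i. {x. f (Suc (n + i)) x \<noteq> f (n + i) x})"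
  proof (rule ccontr)
    assume "\<not> ?thesis"
    then have c: "f (Suc (n + i)) x = f (n + i) x" for i by auto
    have "f (n + i) x = f n x" for i by (induction i) (use c in simp_all)
    then have "\<forall>k\<ge>n. f k x = f n x" by (metis le_iff_add)
    then have ev: "\<forall>\<^sub>F k in sequentially. f k x = f n x"
      unfolding eventually_sequentially by (rule exI[of _ n])
    have "eventual f x = f n x"
    proof (cases "f n x")
      case None
      show ?thesis
      proof (cases "eventual f x")
        case (Some s)
        then have "\<forall>\<^sub>F k in sequentially. f k x = Some s" by (simp add: eventual_Some)
        then have "\<forall>\<^sub>F k :: nat in sequentially. False" using ev by eventually_elim (simp add: None)
        then show ?thesis by simp
      qed (simp add: None)
    next
      case (Some s)
      then show ?thesis using ev by (simp add: eventual_Some)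
    qed
    then show False using x by simp
  qed
qed

lemma unmatched_differ:
  assumes l: "borel_matching l" and f: "borel_matching f"
  shows "unmatched f \<le> unmatched l + measure M {x. f x \<noteq> l x}"
proof -
  have "A - dom f \<subseteq> (A - dom l) \<union> {x. f x \<noteq> l x}" by auto
  then have "measure M (A - dom f) \<le> measure M ((A - dom l) \<union> {x. f x \<noteq> l x})"
    using sets_AB dom_sets[OF l] dom_sets[OF f] differ_sets[OF f l] differ_subset[OF f l]
    by (intro measure_mono_fmeasurable fm_A) auto
  also have "\<dots> \<le> measure M (A - dom l) + measure M {x. f x \<noteq> l x}"
    using sets_AB dom_sets[OF l] differ_sets[OF f l] by (intro measure_Un_le) auto
  finally show ?thesis using unmatched_eq l f by simp
qed

text \<open>
  Changes are paid for by the decrease of \<open>sqrt (unmatched l)\<close>. These costs telescope along a sequence,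
  which is what makes increasing sequences converge.
\<close>

definition improves :: "('a \<rightharpoonup> 'g) \<Rightarrow> ('a \<rightharpoonup> 'g) \<Rightarrow> bool" where
  "improves l f \<longleftrightarrow>
    measure M {x. f x \<noteq> l x} \<le> 2 * sqrt (18 * m) * (sqrt (unmatched l) - sqrt (unmatched f))"

lemma improves_mono:
  assumes "improves l f"
  shows "unmatched f \<le> unmatched l"
proof -
  have "0 \<le> 2 * sqrt (18 * m) * (sqrt (unmatched l) - sqrt (unmatched f))"
    using assms measure_nonneg[of M "{x. f x \<noteq> l x}"] unfolding improves_def by linarith
  then show ?thesis using m by (simp add: zero_le_mult_iff)
qed

lemma improves_trans:
  assumes m': "borel_matching l" "borel_matching f" "borel_matching g" and "improves l f" "improves f g"
  shows "improves l g"
proof -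
  have "measure M {x. g x \<noteq> l x} \<le> measure M ({x. g x \<noteq> f x} \<union> {x. f x \<noteq> l x})"
    using m' differ_sets differ_subset by (intro measure_mono_fmeasurable fm_A) auto
  also have "\<dots> \<le> measure M {x. g x \<noteq> f x} + measure M {x. f x \<noteq> l x}"
    using m' differ_sets by (intro measure_Un_le) auto
  finally show ?thesis using assms(4,5) unfolding improves_def by (simp add: algebra_simps)
qed

lemma improves_eventual:
  assumes f: "\<And>n. borel_matching (f n)" and step: "\<And>n. improves (f n) (f (Suc n))"
  shows "improves (f n) (eventual f)"
proof -
  let ?K = "2 * sqrt (18 * m)"
  define r where "r n = sqrt (unmatched (f n))" for n
  have K: "0 \<le> ?K" using m by simp
  have dec: "decseq r"
    unfolding decseq_Suc_iff r_def using improves_mono[OF step] by simp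
  have r0: "0 \<le> r n" for n by (simp add: r_def unmatched_bounds)
  obtain c where c: "r \<longlonglongrightarrow> c" "\<And>n. c \<le> r n" using decseq_convergent[OF dec, of 0] r0 by metis
  have bound: "measure M {x. eventual f x \<noteq> f n x} \<le> ?K * (r n - c)" for n
  proof -
    define D where "D i = {x. f (Suc (n + i)) x \<noteq> f (n + i) x}" for i
    have D: "D i \<in> sets M" "D i \<subseteq> A" for i
      unfolding D_def by (rule differ_sets[OF f f], rule differ_subset[OF f f])
    have part: "measure M (\<Union>i<N. D i) \<le> ?K * (r n - c)" for N
    proof -
      have "measure M (\<Union>i<N. D i) \<le> (\<Sum>i<N. measure M (D i))" using D by (intro measure_UNION_le) auto
      also have "\<dots> \<le> (\<Sum>i<N. ?K * (r (n + i) - r (n + Suc i)))"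
        using step unfolding improves_def D_def r_def by (intro sum_mono) simp
      also have "\<dots> = ?K * (\<Sum>i<N. r (n + i) - r (n + Suc i))" by (simp add: sum_distrib_left)
      also have "(\<Sum>i<N. r (n + i) - r (n + Suc i)) = r n - r (n + N)"
        using sum_lessThan_telescope'[of "\<lambda>i. r (n + i)" N] by simp
      also have "?K * (r n - r (n + N)) \<le> ?K * (r n - c)" using c(2) K by (intro mult_left_mono) auto
      finally show ?thesis .
    qed
    have UNeq: "(\<Union>N. \<Union>i<N. D i) = (\<Union>i. D i)"
    proof (intro equalityI subsetI)
      fix x assume "x \<in> (\<Union>i. D i)"
      then obtain i where "x \<in> D i" by blast
      then have "x \<in> (\<Union>j<Suc i. D j)" by blast
      then show "x \<in> (\<Union>N. \<Union>i<N. D i)" by blast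
    qed blast
    have UA: "(\<Union>i. D i) \<in> fmeasurable M" using D by (intro fm_A) auto
    have "(\<lambda>N. measure M (\<Union>i<N. D i)) \<longlonglongrightarrow> measure M (\<Union>N. \<Union>i<N. D i)"
    proof (rule Lim_measure_incseq)
      show "incseq (\<lambda>N. \<Union>i<N. D i)" by (intro incseq_SucI UN_mono) auto
      show "emeasure M (\<Union>N. \<Union>i<N. D i) \<noteq> \<infinity>" using UA unfolding UNeq by (auto simp: fmeasurable_def)
    qed (use D in auto)
    then have "measure M (\<Union>N. \<Union>i<N. D i) \<le> ?K * (r n - c)" by (rule LIMSEQ_le_const2) (use part in auto)
    moreover note UNeq
    moreover have "measure M {x. eventual f x \<noteq> f n x} \<le> measure M (\<Union>i. D i)"
      using eventual_differ[of f n] UA differ_sets[OF matching_eventual[OF f] f]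
      by (intro measure_mono_fmeasurable) (auto simp: D_def)
    ultimately show ?thesis by simp
  qed
  have "unmatched (eventual f) \<le> c\<^sup>2"
  proof (rule LIMSEQ_le_const)
    show "(\<lambda>n. (r n)\<^sup>2 + ?K * (r n - c)) \<longlonglongrightarrow> c\<^sup>2"
      using tendsto_add[OF tendsto_power[OF c(1), of 2]
          tendsto_mult[OF tendsto_const[of ?K] tendsto_diff[OF c(1) tendsto_const[of c]]]] by simp
    have "unmatched (eventual f) \<le> (r n)\<^sup>2 + ?K * (r n - c)" for n
      using unmatched_differ[of "f n" "eventual f", OF f matching_eventual[OF f]] bound[of n]
      by (simp add: r_def unmatched_bounds)
    then show "\<exists>N. \<forall>n\<ge>N. unmatched (eventual f) \<le> (r n)\<^sup>2 + ?K * (r n - c)" by blast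
  qed
  moreover have "0 \<le> c" using c(1) r0 by (intro LIMSEQ_le_const) auto
  ultimately have "sqrt (unmatched (eventual f)) \<le> c" by (intro real_le_lsqrt) (auto simp: unmatched_bounds)
  then have "?K * (r n - c) \<le> ?K * (r n - sqrt (unmatched (eventual f)))" using K by (intro mult_left_mono) auto
  then show ?thesis using bound[of n] unfolding improves_def r_def by linarith
qed

theorem almost_perfect_matching:
  obtains l where "borel_matching l" "measure M (A - dom l) = 0" "measure M (B - hit \<phi> l) = 0"
proof -
  have "\<exists>z\<in>Collect borel_matching. \<forall>y\<in>Collect borel_matching. improves z y \<longrightarrow> unmatched z \<le> unmatched y"
  proof (rule exists_minimal_along_order[of Map.empty "Collect borel_matching" unmatched improves])
    show "Map.empty \<in> Collect borel_matching" by (auto intro: matchingI)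
    fix f :: "nat \<Rightarrow> 'a \<rightharpoonup> 'g" assume "\<And>n. f n \<in> Collect borel_matching \<and> improves (f n) (f (Suc n))"
    then show "\<exists>z\<in>Collect borel_matching. \<forall>n. improves (f n) z"
      using matching_eventual[of f] improves_eventual[of f] by (intro bexI[of _ "eventual f"]) auto
  next
    fix l f g
    show "0 \<le> unmatched l" by (rule unmatched_bounds)
    show "improves l l" by (simp add: improves_def)
    show "unmatched f \<le> unmatched l" if "improves l f" using that by (rule improves_mono)
    show "improves l g" if "l \<in> Collect borel_matching" "f \<in> Collect borel_matching"
        "g \<in> Collect borel_matching" "improves l f" "improves f g"
      using that by (auto intro: improves_trans)
  next
    fix z assume "z \<in> Collect borel_matching"
      "\<And>y. y \<in> Collect borel_matching \<Longrightarrow> improves z y \<Longrightarrow> unmatched z \<le> unmatched y"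
    then show "\<exists>z\<in>Collect borel_matching. \<forall>y\<in>Collect borel_matching. improves z y \<longrightarrow> unmatched z \<le> unmatched y"
      by blast
  qed
  then obtain z where z: "borel_matching z"
    "\<And>y. borel_matching y \<Longrightarrow> improves z y \<Longrightarrow> unmatched z \<le> unmatched y" by auto
  have "unmatched z = 0"
  proof (rule ccontr)
    assume "unmatched z \<noteq> 0"
    then have "0 < unmatched z" using unmatched_bounds(1)[of z] by linarith
    then obtain f where f: "borel_matching f" "unmatched f < unmatched z" "improves z f"
      by (rule improve[OF z(1), folded improves_def])
    then show False using z(2)[OF f(1,3)] by linarith
  qed
  then show ?thesis using that[OF z(1)] unmatched_eq[OF z(1)] by (simp add: unmatched_def)
qed

end

section \<open>Equidecompositions between members of the covering class\<close>

context space_action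
begin

lemma equidecomposable_covers:
  assumes "equidecomposable G \<phi> \<A> B A"
  obtains T where "finite T" "T \<subseteq> carrier G" "A \<subseteq> translates \<phi> T B"
    "B \<subseteq> translates \<phi> ((\<lambda>t. inv t) ` T) A"
proof -
  obtain S l where S: "finite S" "S \<subseteq> carrier G" and l: "perfect_matching \<phi> S UNIV B A l"
    using perfect_matching_if_equidecomposable[OF assms] by metis
  have lS: "\<exists>s\<in>S. move \<phi> l x = \<phi> s x" if x: "x \<in> B" for x
  proof -
    obtain s where "l x = Some s" using x perfect_matchingD(2)[OF l] by blast
    then show ?thesis using matching_Some(2)[OF perfect_matchingD(1)[OF l]] by (auto simp: move_def)
  qed
  show ?thesis
  proof (rule that[OF S])
    show "A \<subseteq> translates \<phi> S B"
    proof
      fix y assume "y \<in> A"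
      then obtain x where x: "x \<in> B" "y = move \<phi> l x" using perfect_matchingD(3)[OF l] by blast
      then obtain s where "s \<in> S" "y = \<phi> s x" using lS by auto
      then show "y \<in> translates \<phi> S B" using x(1) by (auto simp: translates_def)
    qed
    show "B \<subseteq> translates \<phi> ((\<lambda>t. inv t) ` S) A"
    proof
      fix x assume x: "x \<in> B"
      then obtain s where s: "s \<in> S" "move \<phi> l x = \<phi> s x" using lS by blast
      then have "\<phi> s x \<in> A" using x perfect_matchingD(3)[OF l] by (metis imageI)
      moreover have "x = \<phi> (inv s) (\<phi> s x)" using s S by auto
      ultimately show "x \<in> translates \<phi> ((\<lambda>t. inv t) ` S) A" using s(1) by (auto simp: translates_def)
    qed
  qed
qed

lemma covers_trans:
  assumes "covers G \<phi> B A" "covers G \<phi> A U"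
  shows "covers G \<phi> B U"
proof -
  obtain S T where S: "finite S" "S \<subseteq> carrier G" "A \<subseteq> translates \<phi> S B"
    and T: "finite T" "T \<subseteq> carrier G" "U \<subseteq> translates \<phi> T A"
    using assms unfolding covers_def by blast
  have "translates \<phi> T A \<subseteq> translates \<phi> T (translates \<phi> S B)" by (rule translates_mono[OF S(3)])
  then have "U \<subseteq> translates \<phi> ((\<lambda>(t, s). t \<otimes> s) ` (T \<times> S)) B"
    using T(3) translates_translates[OF S(2) T(2)] by blast
  moreover have "(\<lambda>(t, s). t \<otimes> s) ` (T \<times> S) \<subseteq> carrier G" using S(2) T(2) by auto
  moreover have "finite ((\<lambda>(t, s). t \<otimes> s) ` (T \<times> S))" using S(1) T(1) by simp
  ultimately show ?thesis
    unfolding covers_def by (intro exI[of _ "(\<lambda>(t, s). t \<otimes> s) ` (T \<times> S)"] conjI)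
qed

end

context borel_action
begin

lemma relcompact_translates:
  assumes parad: "paradoxical_action G \<phi>" and A: "compact (closure A)"
    and T: "finite T" "T \<subseteq> carrier G" and B: "B \<subseteq> translates \<phi> T A"
  shows "compact (closure B)"
proof -
  have c: "compact (closure (\<phi> t ` closure A))" if "t \<in> T" for t
    using parad A that T(2) unfolding paradoxical_action_def by blast
  then have K: "compact (\<Union>t\<in>T. closure (\<phi> t ` closure A))" using T(1) by auto
  then have "closure (\<Union>t\<in>T. closure (\<phi> t ` closure A)) = (\<Union>t\<in>T. closure (\<phi> t ` closure A))"
    by (intro closure_closed compact_imp_closed)
  then have "compact (closure (\<Union>t\<in>T. closure (\<phi> t ` closure A)))" using K by simp
  moreover have "B \<subseteq> (\<Union>t\<in>T. closure (\<phi> t ` closure A))"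
  proof
    fix x assume "x \<in> B"
    then obtain t a where "t \<in> T" "a \<in> A" "x = \<phi> t a" using B by (auto simp: translates_def)
    then have "x \<in> \<phi> t ` closure A" using closure_subset[of A] by blast
    then show "x \<in> (\<Union>t\<in>T. closure (\<phi> t ` closure A))"
      using closure_subset[of "\<phi> t ` closure A"] \<open>t \<in> T\<close> by blast
  qed
  ultimately show ?thesis by (rule compact_closure_subset)
qed

lemma equidecomposable_relcompact_covering:
  assumes parad: "paradoxical_action G \<phi>" and A: "A \<in> relcompact_covering G \<phi>"
    and eq: "equidecomposable G \<phi> \<A> B A"
  shows "B \<in> relcompact_covering G \<phi>"
proof -
  obtain T where T: "finite T" "T \<subseteq> carrier G" "A \<subseteq> translates \<phi> T B"
    "B \<subseteq> translates \<phi> ((\<lambda>t. inv t) ` T) A" by (rule equidecomposable_covers[OF eq])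
  have "compact (closure B)"
    using A T by (intro relcompact_translates[OF parad _ _ _ T(4)]) (auto simp: relcompact_covering_def)
  moreover have "covers G \<phi> B A" using T unfolding covers_def by blast
  ultimately show ?thesis using A covers_trans unfolding relcompact_covering_def by blast
qed

text \<open>
  Without any requirement on the pieces, mutual expansion gives injections in both directions.
\<close>

lemma relcompact_covering_matching:
  assumes parad: "paradoxical_action G \<phi>" and two: "p \<noteq> (q :: 'a)"
    and A: "A \<in> relcompact_covering G \<phi>" and B: "B \<in> relcompact_covering G \<phi>"
  obtains K l where "finite K" "K \<subseteq> carrier G" "perfect_matching \<phi> K UNIV A B l"
proof -
  have cA: "compact (closure A)" and cB: "compact (closure B)"
    using A B by (auto simp: relcompact_covering_def)
  obtain S where S: "finite S" "S \<subseteq> carrier G"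
    and eS: "\<And>F. finite F \<Longrightarrow> F \<subseteq> A \<Longrightarrow> 2 * card F \<le> card (translates \<phi> S F \<inter> B)"
    using paradoxical_expansion[OF parad two cA B] by metis
  obtain T where T: "finite T" "T \<subseteq> carrier G"
    and eT: "\<And>F. finite F \<Longrightarrow> F \<subseteq> B \<Longrightarrow> 2 * card F \<le> card (translates \<phi> T F \<inter> A)"
    using paradoxical_expansion[OF parad two cB A] by metis
  have "card F \<le> card (translates \<phi> S F \<inter> B)" if "finite F" "F \<subseteq> A" for F using eS[OF that] by linarith
  then obtain f where f: "matching \<phi> S UNIV A B f" "dom f = A" by (rule Hall_matching[OF S])
  have "card F \<le> card (translates \<phi> T F \<inter> A)" if "finite F" "F \<subseteq> B" for F using eT[OF that] by linarith
  then obtain g where g: "matching \<phi> T UNIV B A g" "dom g = B" by (rule Hall_matching[OF T])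
  have K: "finite (S \<union> (\<lambda>t. inv t) ` T)" "S \<union> (\<lambda>t. inv t) ` T \<subseteq> carrier G" using S T by auto
  interpret all: invariant_sigma_algebra G \<phi> UNIV
  proof (intro invariant_sigma_algebra.intro invariant_sigma_algebra_axioms.intro)
    show "space_action G \<phi>" by unfold_locales
    show "sigma_algebra UNIV (UNIV :: 'a set set)" using sigma_algebra_Pow[of "UNIV :: 'a set"] by simp
  qed simp
  obtain h where h: "perfect_matching \<phi> (S \<union> (\<lambda>t. inv t) ` T) UNIV A B h"
    by (rule all.Schroeder_Bernstein_matching[OF f g S(1) T(1) S(2) T(2)])
  show ?thesis by (rule that[OF K h])
qed

text \<open>
  The injections in both directions that exist off meager sets are restricted to a common invariant
  comeager set, where the Schroeder--Bernstein argument keeps the pieces Borel.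
\<close>

lemma baire_matching:
  assumes parad: "paradoxical_action G \<phi>" and two: "p \<noteq> (q :: 'a)"
    and mg: "\<And>g S :: 'a set. g \<in> carrier G \<Longrightarrow> meager S \<Longrightarrow> meager (\<phi> g ` S)"
    and A: "A \<in> relcompact_covering G \<phi>" "A \<in> baire_property_sets"
    and B: "B \<in> relcompact_covering G \<phi>" "B \<in> baire_property_sets"
  obtains K Z0 where "finite K" "K \<subseteq> carrier G" "Z0 \<in> sets borel" "meager Z0"
    "\<And>Z. \<lbrakk>Z0 \<subseteq> Z; Z \<in> sets borel; \<And>g. g \<in> K \<Longrightarrow> \<phi> g ` Z = Z\<rbrakk> \<Longrightarrow>
      \<exists>l. perfect_matching \<phi> K (sets borel) (A - Z) (B - Z) l"
proof -
  have cA: "compact (closure A)" and cB: "compact (closure B)"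
    using A B by (auto simp: relcompact_covering_def)
  obtain S where S: "finite S" "S \<subseteq> carrier G"
    and eS: "\<And>F. finite F \<Longrightarrow> F \<subseteq> A \<Longrightarrow> 2 * card F \<le> card (translates \<phi> S F \<inter> B)"
    using paradoxical_expansion[OF parad two cA B(1)] by metis
  obtain T where T: "finite T" "T \<subseteq> carrier G"
    and eT: "\<And>F. finite F \<Longrightarrow> F \<subseteq> B \<Longrightarrow> 2 * card F \<le> card (translates \<phi> T F \<inter> A)"
    using paradoxical_expansion[OF parad two cB A(1)] by metis
  obtain ZA where ZA: "ZA \<in> sets borel" "meager ZA" "A - ZA \<in> sets borel" by (rule baire_borel_off_meager[OF A(2)])
  obtain ZB where ZB: "ZB \<in> sets borel" "meager ZB" "B - ZB \<in> sets borel" by (rule baire_borel_off_meager[OF B(2)])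
  define K where "K = S \<union> T \<union> (\<lambda>t. inv t) ` T"
  have K: "finite K" "K \<subseteq> carrier G" using S T by (auto simp: K_def)
  define \<I> where "\<I> = {Z :: 'a set. Z \<in> sets borel \<and> meager Z}"
  have ZI: "ZA \<union> ZB \<in> \<I>" using ZA ZB meager_Un by (auto simp: \<I>_def)
  have unI: "\<Union>\<Z> \<in> \<I>" if "countable \<Z>" "\<Z> \<subseteq> \<I>" for \<Z>
    using that meager_Union[of \<Z>] unfolding \<I>_def by (auto intro!: sets.countable_Union)
  have actI: "\<phi> g ` Z \<in> \<I>" if "g \<in> carrier G" "Z \<in> \<I>" for g Z
    using that mg act_image by (auto simp: \<I>_def)
  obtain Z1 where Z1: "Z1 \<in> \<I>" "ZA \<union> ZB \<subseteq> Z1" "\<And>g. g \<in> K \<Longrightarrow> \<phi> g ` Z1 = Z1"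
    using invariant_hull[OF K ZI unI actI] by metis
  have Z1b: "Z1 \<in> sets borel" "meager Z1" using Z1(1) by (auto simp: \<I>_def)
  have off: "translates \<phi> R F \<inter> (C - Z1) = translates \<phi> R F \<inter> C" if "R \<subseteq> K" "F \<inter> Z1 = {}" for R F C
  proof -
    have "translates \<phi> R F \<inter> Z1 = {}"
    proof (rule ccontr)
      assume "translates \<phi> R F \<inter> Z1 \<noteq> {}"
      then obtain g x where g: "g \<in> R" "x \<in> F" "\<phi> g x \<in> Z1" by (auto simp: translates_def)
      then have "\<phi> g x \<in> \<phi> g ` Z1" using Z1(3) that(1) by blast
      moreover have "g \<in> carrier G" using g(1) that(1) K(2) by blast
      ultimately have "x \<in> Z1" by (auto simp: act_eq_iff)
      then show False using g(2) that(2) by blast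
    qed
    then show ?thesis by blast
  qed
  have "A - Z1 = (A - ZA) - Z1" "B - Z1 = (B - ZB) - Z1" using Z1(2) by auto
  then have bA: "A - Z1 \<in> sets borel" and bB: "B - Z1 \<in> sets borel" using ZA(3) ZB(3) Z1b(1) by auto
  have "2 * card F \<le> card (translates \<phi> S F \<inter> (B - Z1))" if "finite F" "F \<subseteq> A - Z1" for F
  proof -
    have F: "S \<subseteq> K" "F \<subseteq> A" "F \<inter> Z1 = {}" using that(2) by (auto simp: K_def)
    show ?thesis unfolding off[OF F(1,3)] by (rule eS[OF that(1) F(2)])
  qed
  then obtain f where f: "matching \<phi> S (sets borel) (A - Z1) (B - Z1) f" "meager (A - Z1 - dom f)"
    by (rule matching_off_meager[OF S bA bB])
  have "2 * card F \<le> card (translates \<phi> T F \<inter> (A - Z1))" if "finite F" "F \<subseteq> B - Z1" for F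
  proof -
    have F: "T \<subseteq> K" "F \<subseteq> B" "F \<inter> Z1 = {}" using that(2) by (auto simp: K_def)
    show ?thesis unfolding off[OF F(1,3)] by (rule eT[OF that(1) F(2)])
  qed
  then obtain g where g: "matching \<phi> T (sets borel) (B - Z1) (A - Z1) g" "meager (B - Z1 - dom g)"
    by (rule matching_off_meager[OF T bB bA])
  define Z0 where "Z0 = Z1 \<union> (A - Z1 - dom f) \<union> (B - Z1 - dom g)"
  have "Z0 \<in> sets borel"
    using Z1b bA bB matching_dom_in[OF f(1) S(1)] matching_dom_in[OF g(1) T(1)] by (auto simp: Z0_def)
  moreover have "meager Z0" unfolding Z0_def by (intro meager_Un Z1b f(2) g(2))
  moreover have "\<exists>l. perfect_matching \<phi> K (sets borel) (A - Z) (B - Z) l"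
    if Z: "Z0 \<subseteq> Z" "Z \<in> sets borel" "\<And>g. g \<in> K \<Longrightarrow> \<phi> g ` Z = Z" for Z
  proof -
    have inv: "\<phi> g ` (- Z) = - Z" if "g \<in> K" for g
      using that Z(3) K(2) by (intro invariant_Compl) auto
    have cap: "X \<inter> - Z \<in> sets borel" if "X \<in> sets borel" for X using that Z(2) by auto
    note pf = cap[OF matchingD(5)[OF f(1)]] and pg = cap[OF matchingD(5)[OF g(1)]]
    have eA: "(A - Z1) \<inter> - Z = A - Z" and eB: "(B - Z1) \<inter> - Z = B - Z" using Z(1) by (auto simp: Z0_def)
    have f': "matching \<phi> S (sets borel) (A - Z) (B - Z) (f |` (- Z))"
      using matching_restrict_invariant[OF f(1) inv pf] unfolding eA eB by (simp add: K_def)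
    have g': "matching \<phi> T (sets borel) (B - Z) (A - Z) (g |` (- Z))"
      using matching_restrict_invariant[OF g(1) inv pg] unfolding eA eB by (simp add: K_def)
    have df: "dom (f |` (- Z)) = A - Z" using matchingD(1)[OF f(1)] Z(1) by (auto simp: Z0_def)
    have dg: "dom (g |` (- Z)) = B - Z" using matchingD(1)[OF g(1)] Z(1) by (auto simp: Z0_def)
    obtain h where h: "perfect_matching \<phi> (S \<union> (\<lambda>t. inv t) ` T) (sets borel) (A - Z) (B - Z) h"
      by (rule Schroeder_Bernstein_matching[OF f' df g' dg S(1) T(1) S(2) T(2)])
    have "perfect_matching \<phi> K (sets borel) (A - Z) (B - Z) h"
      by (rule perfect_matching_weaken[OF h]) (auto simp: K_def)
    then show ?thesis by blast
  qed
  ultimately show ?thesis using that[OF K] by blast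
qed

end

context invariant_borel_action
begin

lemma act_null_sets:
  assumes "g \<in> carrier G" "N \<in> null_sets M"
  shows "\<phi> g ` N \<in> null_sets M"
  using assms invariant[of g N] act_image[of g N] by (auto simp: null_sets_def sets_M)

lemma act_completion:
  assumes g: "g \<in> carrier G" and X: "X \<in> sets (completion M)"
  shows "\<phi> g ` X \<in> sets (completion M)" "emeasure (completion M) (\<phi> g ` X) = emeasure (completion M) X"
proof -
  obtain Y N N' where X: "X = Y \<union> N" "N \<subseteq> N'" "N' \<in> null_sets M" "Y \<in> sets M"
    by (rule sets_completionE[OF X])
  have N: "N \<in> null_sets (completion M)"
    using X(2,3) by (blast intro: null_sets_completion_subset null_sets_completionI)
  have "\<phi> g ` N \<subseteq> \<phi> g ` N'" using X(2) by (rule image_mono)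
  moreover have "\<phi> g ` N' \<in> null_sets (completion M)"
    by (rule null_sets_completionI[OF act_null_sets[OF g X(3)]])
  ultimately have gN: "\<phi> g ` N \<in> null_sets (completion M)" by (rule null_sets_completion_subset)
  have gY: "\<phi> g ` Y \<in> sets M" using act_image[OF g] X(4) by (simp add: sets_M)
  have im: "\<phi> g ` X = \<phi> g ` Y \<union> \<phi> g ` N" unfolding X(1) by (rule image_Un)
  show "\<phi> g ` X \<in> sets (completion M)" unfolding im using gN gY by auto
  have "emeasure (completion M) (\<phi> g ` X) = emeasure (completion M) (\<phi> g ` Y)"
    unfolding im using gY gN by (intro emeasure_Un_null_set) auto
  also have "\<dots> = emeasure (completion M) Y" using gY X(4) invariant[OF g X(4)] by simp
  also have "\<dots> = emeasure (completion M) X"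
    unfolding X(1) using X(4) N by (intro emeasure_Un_null_set[symmetric]) auto
  finally show "emeasure (completion M) (\<phi> g ` X) = emeasure (completion M) X" .
qed

lemma translates_completion:
  assumes "finite S" "S \<subseteq> carrier G" "X \<in> sets (completion M)"
  shows "translates \<phi> S X \<in> sets (completion M)"
  unfolding translates_def using assms act_completion(1) by (intro sets.finite_UN) auto

lemma equidecomposable_measure:
  assumes eq: "equidecomposable G \<phi> \<A> B A" and \<A>: "\<A> \<subseteq> sets (completion M)"
  shows "emeasure (completion M) B = emeasure (completion M) A"
proof -
  obtain m :: nat and \<gamma> P where g: "\<And>i. i < m \<Longrightarrow> \<gamma> i \<in> carrier G \<and> P i \<in> \<A>"
    and dP: "disjoint_family_on P {..<m}" and B: "(\<Union>i<m. P i) = B"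
    and dQ: "disjoint_family_on (\<lambda>i. \<phi> (\<gamma> i) ` P i) {..<m}" and A: "(\<Union>i<m. \<phi> (\<gamma> i) ` P i) = A"
    using eq unfolding equidecomposable_def by blast
  have P: "P i \<in> sets (completion M)" if "i < m" for i using g[OF that] \<A> by blast
  have Q: "\<phi> (\<gamma> i) ` P i \<in> sets (completion M)" if "i < m" for i
    using g[OF that] act_completion(1) P[OF that] by blast
  have "emeasure (completion M) B = (\<Sum>i<m. emeasure (completion M) (P i))"
    unfolding B[symmetric] using P dP by (intro sum_emeasure[symmetric]) auto
  also have "\<dots> = (\<Sum>i<m. emeasure (completion M) (\<phi> (\<gamma> i) ` P i))"
    using act_completion(2)[symmetric] g P by (intro sum.cong) auto
  also have "\<dots> = emeasure (completion M) A"
    unfolding A[symmetric] using Q dQ by (intro sum_emeasure) auto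
  finally show ?thesis .
qed

text \<open>
  Expansion inside \<open>D\<close> gives expansion into a subset \<open>P\<close> that covers \<open>D\<close>: if the image of \<open>X\<close> is almost
  all of \<open>D\<close>, it contains most of \<open>P\<close>. Otherwise one of the \<open>card T\<close> translates that cover \<open>D\<close> by \<open>P\<close>
  carries a proportional part of it back into \<open>P\<close>, which costs a factor \<open>card T\<close> that does not
  depend on \<open>\<eta>\<close>.
\<close>

lemma expansion_into_covering_subset:
  fixes \<eta> m :: real
  assumes D: "D \<in> fmeasurable (completion M)" and P: "P \<in> sets (completion M)" "P \<subseteq> D"
    and P0: "P0 \<in> sets M" "P0 \<subseteq> P" "P - P0 \<in> null_sets (completion M)"
    and T: "finite T" "T \<subseteq> carrier G" "D \<subseteq> translates \<phi> T P"
    and m: "measure (completion M) P = m" "measure (completion M) D \<le> 2 * m" "0 < m"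
    and \<eta>: "0 < \<eta>" "\<eta> \<le> 1 / 8" "\<eta> * card T \<le> 1 / 2"
    and R: "R \<subseteq> carrier G" "\<And>Y. \<lbrakk>Y \<in> sets (completion M); Y \<subseteq> D\<rbrakk> \<Longrightarrow>
      min ((1 - \<eta>) * measure (completion M) D) (measure (completion M) Y / \<eta>)
        \<le> measure (completion M) (translates \<phi> R Y \<inter> D)"
    and S: "finite S" "S \<subseteq> carrier G" "R \<subseteq> S" "\<And>t r. t \<in> T \<Longrightarrow> r \<in> R \<Longrightarrow> inv t \<otimes> r \<in> S"
    and X: "X \<in> sets M" "X \<subseteq> D"
  shows "min (3 / 4 * m) (2 * measure M X) \<le> measure M (translates \<phi> S X \<inter> P0)"
proof -
  let ?\<mu> = "measure (completion M)"
  define V where "V = translates \<phi> S X"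
  have XS: "X \<in> sets (completion M)" using X(1) by simp
  have V: "V \<in> sets M"
    unfolding V_def translates_def using S X(1) act_image sets_M by (intro sets.finite_UN) auto
  have fin: "finite R" using S(1,3) by (rule finite_subset[rotated])
  have VP: "V \<inter> P \<in> fmeasurable (completion M)"
    using V P by (intro fmeasurableI2[OF D]) auto
  have "V \<inter> P = (V \<inter> P0) \<union> V \<inter> (P - P0)" using P0(2) by blast
  moreover have "V \<inter> (P - P0) \<in> null_sets (completion M)"
    by (rule null_sets_completion_subset[OF _ P0(3)]) blast
  ultimately have "?\<mu> (V \<inter> P) = ?\<mu> (V \<inter> P0)"
    using V P0(1) by (simp add: measure_Un_null_set)
  also have "\<dots> = measure M (V \<inter> P0)" using V P0(1) by simp
  finally have muP0: "measure M (V \<inter> P0) = ?\<mu> (V \<inter> P)" by simp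
  define Y where "Y = translates \<phi> R X \<inter> D"
  have YS: "Y \<in> sets (completion M)"
    unfolding Y_def using translates_completion[OF fin R(1) XS] D by auto
  have Yf: "Y \<in> fmeasurable (completion M)" using YS by (intro fmeasurableI2[OF D]) (auto simp: Y_def)
  have YV: "Y \<subseteq> V" using S(3) by (auto simp: Y_def V_def translates_def)
  have "min ((1 - \<eta>) * ?\<mu> D) (?\<mu> X / \<eta>) \<le> ?\<mu> Y" unfolding Y_def by (rule R(2)[OF XS X(2)])
  then consider "(1 - \<eta>) * ?\<mu> D \<le> ?\<mu> Y" | "?\<mu> X / \<eta> \<le> ?\<mu> Y" by linarith
  then show ?thesis
  proof cases
    case 1
    have DY: "D - Y \<in> fmeasurable (completion M)" using D YS by (intro fmeasurableI2[OF D]) auto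
    have "P \<subseteq> (V \<inter> P) \<union> (D - Y)" using P(2) YV by blast
    then have "m \<le> ?\<mu> ((V \<inter> P) \<union> (D - Y))"
      unfolding m(1)[symmetric] using P VP DY by (intro measure_mono_fmeasurable) auto
    also have "\<dots> \<le> ?\<mu> (V \<inter> P) + ?\<mu> (D - Y)" using VP DY by (intro measure_Un_le) auto
    also have "?\<mu> (D - Y) = ?\<mu> D - ?\<mu> Y"
      using D YS by (intro measure_Diff) (auto simp: fmeasurable_def Y_def)
    finally have "m \<le> ?\<mu> (V \<inter> P) + \<eta> * ?\<mu> D" using 1 by (simp add: algebra_simps)
    moreover have "\<eta> * ?\<mu> D \<le> 1 / 8 * (2 * m)" using \<eta> m by (intro mult_mono) auto
    ultimately show ?thesis unfolding muP0[unfolded V_def] V_def by linarith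
  next
    case 2
    have YU: "Y \<subseteq> (\<Union>t\<in>T. \<phi> t ` (V \<inter> P))"
    proof
      fix y assume y: "y \<in> Y"
      then obtain r x where r: "r \<in> R" "x \<in> X" "y = \<phi> r x" by (auto simp: Y_def translates_def)
      obtain t b where t: "t \<in> T" "b \<in> P" "y = \<phi> t b" using y T(3) by (auto simp: Y_def translates_def)
      have c: "t \<in> carrier G" "r \<in> carrier G" using t(1) r(1) T(2) R(1) by auto
      have "b = \<phi> (inv t) y" using t(3) c by simp
      also have "\<dots> = \<phi> (inv t \<otimes> r) x" using r(3) c by (simp add: act_mult)
      finally have "b \<in> V" using S(4)[OF t(1) r(1)] r(2) by (auto simp: V_def translates_def)
      then show "y \<in> (\<Union>t\<in>T. \<phi> t ` (V \<inter> P))" using t by blast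
    qed
    have act: "\<phi> t ` (V \<inter> P) \<in> sets (completion M)" "?\<mu> (\<phi> t ` (V \<inter> P)) = ?\<mu> (V \<inter> P)"
      "emeasure (completion M) (\<phi> t ` (V \<inter> P)) = emeasure (completion M) (V \<inter> P)" if "t \<in> T" for t
      using act_completion[of t "V \<inter> P"] that T(2) VP by (auto simp: measure_def)
    have "\<phi> t ` (V \<inter> P) \<in> fmeasurable (completion M)" if "t \<in> T" for t
      using act[OF that] VP by (simp add: fmeasurable_def del: emeasure_completion)
    then have U: "(\<Union>t\<in>T. \<phi> t ` (V \<inter> P)) \<in> fmeasurable (completion M)" using T(1) by (intro fmeasurable.finite_UN)
    have "?\<mu> Y \<le> ?\<mu> (\<Union>t\<in>T. \<phi> t ` (V \<inter> P))"
      using YU YS U by (rule measure_mono_fmeasurable)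
    also have "\<dots> \<le> (\<Sum>t\<in>T. ?\<mu> (\<phi> t ` (V \<inter> P)))" using act(1) T(1) by (intro measure_UNION_le) auto
    also have "\<dots> = card T * ?\<mu> (V \<inter> P)" using act(2) by simp
    finally have "?\<mu> X / \<eta> \<le> card T * ?\<mu> (V \<inter> P)" using 2 by linarith
    then have "?\<mu> X \<le> \<eta> * card T * ?\<mu> (V \<inter> P)" using \<eta>(1) by (simp add: divide_le_eq ac_simps)
    also have "\<dots> \<le> 1 / 2 * ?\<mu> (V \<inter> P)" using \<eta>(3) by (intro mult_right_mono) auto
    finally have "2 * measure M X \<le> ?\<mu> (V \<inter> P)" using X(1) by simp
    then show ?thesis unfolding muP0[unfolded V_def] V_def by linarith
  qed
qed

lemma completion_borel_kernel:
  assumes "X \<in> sets (completion M)"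
  obtains X0 N where "X0 \<in> sets M" "X0 \<subseteq> X" "N \<in> null_sets M" "X - X0 \<subseteq> N"
    "X - X0 \<in> null_sets (completion M)"
proof -
  obtain Y N N' where X: "X = Y \<union> N" "N \<subseteq> N'" "N' \<in> null_sets M" "Y \<in> sets M"
    by (rule sets_completionE[OF assms])
  have "X - Y \<subseteq> N'" using X(1,2) by blast
  then show ?thesis
    using that[of Y N'] X null_sets_completion_subset[OF _ null_sets_completionI[OF X(3)]] by blast
qed

lemma ex_expanding_pair:
  assumes expanding: "expanding_action G \<phi> M"
    and A: "A \<in> sets (completion M)" "A \<in> relcompact_covering G \<phi>" "covers G \<phi> A (A \<union> B)"
    and B: "B \<in> sets (completion M)" "B \<in> relcompact_covering G \<phi>" "covers G \<phi> B (A \<union> B)"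
    and eq: "emeasure (completion M) A = emeasure (completion M) B"
    and A0: "A0 \<in> sets M" "A0 \<subseteq> A" "A - A0 \<in> null_sets (completion M)"
    and B0: "B0 \<in> sets M" "B0 \<subseteq> B" "B - B0 \<in> null_sets (completion M)"
  obtains S m where "expanding_pair G \<phi> M S A0 B0 m"
proof -
  let ?\<mu> = "measure (completion M)"
  define D where "D = A \<union> B"
  obtain U where "open U" "U \<noteq> {}" "covers G \<phi> A U" using A(2) by (auto simp: relcompact_covering_def)
  then obtain TU where TU: "finite TU" "TU \<subseteq> carrier G" "U \<subseteq> translates \<phi> TU A"
    unfolding covers_def by (elim exE conjE)
  have "U \<subseteq> translates \<phi> TU D"
    using TU(3) translates_mono[of A D \<phi> TU] by (simp add: D_def)
  then have "covers G \<phi> D U" unfolding covers_def using TU by (intro exI[of _ TU] conjI)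
  moreover have "compact (closure D)" using A(2) B(2) by (simp add: relcompact_covering_def D_def compact_Un)
  ultimately have "D \<in> relcompact_covering G \<phi>"
    unfolding relcompact_covering_def using \<open>open U\<close> \<open>U \<noteq> {}\<close> by (intro CollectI conjI exI[of _ U])
  moreover have DS: "D \<in> sets (completion M)" using A(1) B(1) by (simp add: D_def)
  ultimately have dD: "domain_of_expansion G \<phi> M D" using expanding by (simp add: expanding_action_def)
  have dA: "domain_of_expansion G \<phi> M A" using A expanding by (simp add: expanding_action_def)
  have D: "D \<in> fmeasurable (completion M)" using dD DS by (simp add: domain_of_expansion_def fmeasurable_def)
  have Af: "A \<in> fmeasurable (completion M)" and Apos: "0 < emeasure (completion M) A"
    using dA A(1) by (simp_all add: domain_of_expansion_def fmeasurable_def)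
  have Bf: "B \<in> fmeasurable (completion M)" using Af eq B(1) by (simp add: fmeasurable_def)
  define m where "m = ?\<mu> A"
  have mB: "?\<mu> B = m" using eq by (simp add: m_def measure_def)
  have mpos: "0 < m"
    using Apos Af by (simp add: m_def emeasure_eq_measure2 ennreal_less_zero_iff)
  have mD: "?\<mu> D \<le> 2 * m"
    using measure_Un_le[of A "completion M" B] A(1) B(1) mB by (simp add: D_def m_def)
  obtain TA where TA: "finite TA" "TA \<subseteq> carrier G" "D \<subseteq> translates \<phi> TA A"
    using A(3) unfolding covers_def D_def by (elim exE conjE)
  obtain TB where TB: "finite TB" "TB \<subseteq> carrier G" "D \<subseteq> translates \<phi> TB B"
    using B(3) unfolding covers_def D_def by (elim exE conjE)
  define T where "T = TA \<union> TB"
  have T: "finite T" "T \<subseteq> carrier G" using TA TB by (auto simp: T_def)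
  have "translates \<phi> TA A \<subseteq> translates \<phi> T A" "translates \<phi> TB B \<subseteq> translates \<phi> T B"
    by (auto simp: T_def translates_def)
  then have TP: "D \<subseteq> translates \<phi> T A" "D \<subseteq> translates \<phi> T B"
    using TA(3) TB(3) by (auto intro: subset_trans)
  \<comment> \<open>The number of covering translates is fixed before the accuracy \<open>\<eta>\<close> is chosen.\<close>
  define \<eta> :: real where "\<eta> = 1 / (8 * (card T + 1))"
  have \<eta>: "0 < \<eta>" "\<eta> \<le> 1 / 8" "\<eta> * card T \<le> 1 / 2"
    by (auto simp: \<eta>_def field_simps)
  have "\<forall>\<eta>::real. \<eta> > 0 \<longrightarrow> (\<exists>R. finite R \<and> R \<subseteq> carrier G \<and>
      (\<forall>Y\<in>sets (completion M). Y \<subseteq> D \<longrightarrow>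
        min ((1 - \<eta>) * ?\<mu> D) (?\<mu> Y / \<eta>) \<le> ?\<mu> (translates \<phi> R Y \<inter> D)))"
    using dD unfolding domain_of_expansion_def by (elim conjE)
  from this[rule_format, OF \<eta>(1)] obtain R where R0: "finite R" "R \<subseteq> carrier G"
    "\<forall>Y\<in>sets (completion M). Y \<subseteq> D \<longrightarrow>
      min ((1 - \<eta>) * ?\<mu> D) (?\<mu> Y / \<eta>) \<le> ?\<mu> (translates \<phi> R Y \<inter> D)"
    by (elim exE conjE)
  note R = R0(1,2) R0(3)[rule_format]
  define S0 where "S0 = R \<union> (\<lambda>(t, r). inv t \<otimes> r) ` (T \<times> R)"
  define S where "S = S0 \<union> (\<lambda>s. inv s) ` S0"
  have TR: "inv t \<otimes> r \<in> carrier G" if "t \<in> T" "r \<in> R" for t r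
    using that T R(2) by (intro m_closed inv_closed) auto
  then have S0: "finite S0" "S0 \<subseteq> carrier G" using R T by (auto simp: S0_def)
  have S: "finite S" "S \<subseteq> carrier G" using S0 by (auto simp: S_def)
  have RS: "R \<subseteq> S" by (auto simp: S_def S0_def)
  have TRS: "inv t \<otimes> r \<in> S" if "t \<in> T" "r \<in> R" for t r
  proof -
    have "(\<lambda>(t, r). inv t \<otimes> r) (t, r) \<in> (\<lambda>(t, r). inv t \<otimes> r) ` (T \<times> R)"
      using that by (intro imageI) simp
    then show ?thesis by (simp add: S_def S0_def)
  qed
  have sym: "inv s \<in> S" if "s \<in> S" for s
  proof -
    have "s \<in> S0 \<or> (\<exists>t\<in>S0. s = inv t)" using that by (auto simp: S_def)
    then show ?thesis
    proof
      assume "\<exists>t\<in>S0. s = inv t"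
      then obtain t where "t \<in> S0" "s = inv t" by blast
      then have "inv s = t" using S0(2) by auto
      then show ?thesis using \<open>t \<in> S0\<close> by (simp add: S_def)
    qed (simp add: S_def)
  qed
  have kernel: "measure M P0 = m" "P0 \<in> fmeasurable M"
    if P: "P \<in> fmeasurable (completion M)" "?\<mu> P = m" "P0 \<in> sets M" "P0 \<subseteq> P" "P - P0 \<in> null_sets (completion M)"
    for P P0
  proof -
    have "P = P0 \<union> (P - P0)" using P(4) by blast
    then have "?\<mu> P = ?\<mu> P0" using measure_Un_null_set[of P0 "completion M" "P - P0"] P(3,5) by simp
    then show "measure M P0 = m" using P(2,3) by simp
    have "P0 \<in> fmeasurable (completion M)" using P by (intro fmeasurableI2[OF P(1)]) auto
    then show "P0 \<in> fmeasurable M" using P(3) by (simp add: fmeasurable_def)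
  qed
  have AD: "A \<subseteq> D" and BD: "B \<subseteq> D" by (auto simp: D_def)
  have "expanding_pair G \<phi> M S A0 B0 m"
  proof (intro expanding_pair.intro expanding_pair_axioms.intro)
    show "invariant_borel_action G \<phi> M" by unfold_locales
    show "A0 \<in> fmeasurable M" "measure M A0 = m" using kernel[OF Af _ A0] by (simp_all add: m_def)
    show "B0 \<in> fmeasurable M" "measure M B0 = m" using kernel[OF Bf mB B0] by simp_all
    fix X assume X: "X \<in> sets M"
    show "min (3 / 4 * m) (2 * measure M X) \<le> measure M (translates \<phi> S X \<inter> B0)" if "X \<subseteq> A0"
      by (rule expansion_into_covering_subset[OF D B(1) BD B0 T TP(2) mB mD mpos \<eta> R(2,3) S RS TRS X])
        (use that A0(2) AD in auto)
    show "min (3 / 4 * m) (2 * measure M X) \<le> measure M (translates \<phi> S X \<inter> A0)" if "X \<subseteq> B0"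
      by (rule expansion_into_covering_subset[OF D A(1) AD A0 T TP(1) m_def[symmetric] mD mpos \<eta> R(2,3) S RS TRS X])
        (use that B0(2) BD in auto)
  qed (use S sym mpos in auto)
  then show ?thesis by (rule that)
qed

text \<open>
  The exceptional null set may be enlarged to any invariant Borel set, so that it can be adapted to the
  labels of other matchings.
\<close>

lemma measure_matching:
  assumes expanding: "expanding_action G \<phi> M"
    and A: "A \<in> sets (completion M)" "A \<in> relcompact_covering G \<phi>" "covers G \<phi> A (A \<union> B)"
    and B: "B \<in> sets (completion M)" "B \<in> relcompact_covering G \<phi>" "covers G \<phi> B (A \<union> B)"
    and eq: "emeasure (completion M) A = emeasure (completion M) B"
  obtains S N0 where "finite S" "S \<subseteq> carrier G" "N0 \<in> null_sets M"
    "\<And>N. \<lbrakk>N0 \<subseteq> N; N \<in> sets borel; \<And>g. g \<in> S \<Longrightarrow> \<phi> g ` N = N\<rbrakk> \<Longrightarrow>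
      \<exists>l. perfect_matching \<phi> S (sets borel) (A - N) (B - N) l"
proof -
  obtain A0 NA where A0: "A0 \<in> sets M" "A0 \<subseteq> A" "NA \<in> null_sets M" "A - A0 \<subseteq> NA"
    "A - A0 \<in> null_sets (completion M)" by (rule completion_borel_kernel[OF A(1)])
  obtain B0 NB where B0: "B0 \<in> sets M" "B0 \<subseteq> B" "NB \<in> null_sets M" "B - B0 \<subseteq> NB"
    "B - B0 \<in> null_sets (completion M)" by (rule completion_borel_kernel[OF B(1)])
  obtain S m where "expanding_pair G \<phi> M S A0 B0 m"
    by (rule ex_expanding_pair[OF expanding A B eq A0(1,2,5) B0(1,2,5)])
  then interpret expanding_pair G \<phi> M S A0 B0 m .
  obtain l where l: "matching \<phi> S (sets borel) A0 B0 l"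
    and null: "measure M (A0 - dom l) = 0" "measure M (B0 - hit \<phi> l) = 0" by (rule almost_perfect_matching)
  have nA: "A0 - dom l \<in> null_sets M"
    using fm_A[of "A0 - dom l"] sets_AB dom_sets[OF l] null(1) by (simp add: null_sets_def emeasure_eq_measure2)
  have nB: "B0 - hit \<phi> l \<in> null_sets M"
    using fm_B[of "B0 - hit \<phi> l"] sets_AB hit_sets[OF l] null(2) by (simp add: null_sets_def emeasure_eq_measure2)
  define N0 where "N0 = NA \<union> NB \<union> (A0 - dom l) \<union> (B0 - hit \<phi> l)"
  have N0: "N0 \<in> null_sets M" unfolding N0_def using A0(3) B0(3) nA nB by (intro null_sets.Un)
  have pl: "perfect_matching \<phi> S (sets borel) (dom l) (hit \<phi> l) l"
  proof -
    have "matching \<phi> S (sets borel) (dom l) (hit \<phi> l) l"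
      using l unfolding matching_def hit_def by simp
    then show ?thesis by (simp add: perfect_matching_def hit_def)
  qed
  have "\<exists>l'. perfect_matching \<phi> S (sets borel) (A - N) (B - N) l'"
    if N: "N0 \<subseteq> N" "N \<in> sets borel" "\<And>g. g \<in> S \<Longrightarrow> \<phi> g ` N = N" for N
  proof -
    have inv: "\<phi> g ` (- N) = - N" if "g \<in> S" for g
      using that N(3) S(2) by (intro invariant_Compl) auto
    have pieces: "{x. l x = Some s} \<inter> - N \<in> sets borel" for s using matchingD(5)[OF l] N(2) by auto
    have "dom l \<inter> - N = A - N"
      using N(1) A0(2,4) matchingD(1)[OF l] by (auto simp: N0_def)
    moreover have "hit \<phi> l \<inter> - N = B - N"
      using N(1) B0(2,4) hit_subset[OF l] by (auto simp: N0_def)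
    moreover have "perfect_matching \<phi> S (sets borel) (dom l \<inter> - N) (hit \<phi> l \<inter> - N) (l |` (- N))"
      by (rule perfect_matching_restrict[OF pl S(2) inv pieces])
    ultimately show ?thesis by auto
  qed
  then show ?thesis by (rule that[OF S N0])
qed

end

context space_action
begin

lemma equidecomposable_in:
  assumes eq: "equidecomposable G \<phi> \<A> B A" and "sigma_algebra UNIV \<A>"
  shows "B \<in> \<A>"
proof -
  interpret sigma_algebra UNIV \<A> by fact
  obtain m :: nat and P where "\<And>i. i < m \<Longrightarrow> P i \<in> \<A>" "(\<Union>i<m. P i) = B"
    using eq unfolding equidecomposable_def by blast
  then show ?thesis by (metis finite_UN finite_lessThan lessThan_iff)
qed

lemma perfect_matching_identity:
  assumes "{} \<in> \<A>" "UNIV \<in> \<A>"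
  shows "perfect_matching \<phi> {\<one>} \<A> UNIV UNIV (\<lambda>x. Some \<one>)"
proof -
  have "matching \<phi> {\<one>} \<A> UNIV UNIV (\<lambda>x. Some \<one>)"
  proof (rule matchingI)
    fix s
    have "{x :: 'a. Some \<one> = Some s} = (if s = \<one> then UNIV else {})" by auto
    then show "{x :: 'a. Some \<one> = Some s} \<in> \<A>" using assms by simp
  qed auto
  then show ?thesis by (auto simp: perfect_matching_def move_def dom_def)
qed

lemma equidecomposable_UNIV:
  assumes "{} \<in> \<A>" "UNIV \<in> \<A>"
  shows "equidecomposable G \<phi> \<A> UNIV UNIV"
  by (rule equidecomposable_if_perfect_matching[OF perfect_matching_identity[OF assms]]) auto

end

context invariant_borel_action
begin

lemma null_invariant_hull:
  assumes K: "finite K" "K \<subseteq> carrier G" and "N \<in> null_sets M"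
  obtains N' where "N' \<in> null_sets M" "N \<subseteq> N'" "\<And>g. g \<in> K \<Longrightarrow> \<phi> g ` N' = N'"
proof -
  have un: "\<Union>\<Z> \<in> null_sets M" if "countable \<Z>" "\<Z> \<subseteq> null_sets M" for \<Z>
    using null_sets_UN'[OF that(1), of "\<lambda>Z. Z" M] that(2) by auto
  show ?thesis
    by (rule invariant_hull[OF K assms(3), of thesis]) (fact un, fact act_null_sets, rule that)
qed

lemma covers_union:
  assumes parad: "paradoxical_action G \<phi>" and two: "p \<noteq> (q :: 'a)"
    and A: "A \<in> relcompact_covering G \<phi>" and B: "B \<in> relcompact_covering G \<phi>"
  shows "covers G \<phi> A (A \<union> B)" "covers G \<phi> B (A \<union> B)"
proof -
  have "compact (closure (A \<union> B))" using A B by (simp add: relcompact_covering_def compact_Un)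
  then show "covers G \<phi> A (A \<union> B)" "covers G \<phi> B (A \<union> B)"
    using paradoxical_covers[OF parad two] A B by blast+
qed

text \<open>
  The matching is built for \<open>sym_diff B N\<close>, which agrees with \<open>B\<close> off an invariant null set that contains \<open>N\<close>.
\<close>

lemma essentially_equidecomposable:
  assumes parad: "paradoxical_action G \<phi>" and expanding: "expanding_action G \<phi> M" and two: "p \<noteq> (q :: 'a)"
    and A: "A \<in> sets (completion M)" "A \<in> relcompact_covering G \<phi>"
    and B: "B \<in> sets (completion M)" "sym_diff B N \<in> relcompact_covering G \<phi>" "N \<in> null_sets (completion M)"
    and eq: "emeasure (completion M) B = emeasure (completion M) A"
  shows "ess_borel_equidecomposable G \<phi> M B A"
proof -
  define C where "C = sym_diff B N"
  have Ccov: "C \<in> relcompact_covering G \<phi>" using B(2) by (simp add: C_def)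
  have NS: "N \<in> sets (completion M)" using B(3) by auto
  have CS: "C \<in> sets (completion M)" using B(1) NS by (auto simp: C_def)
  have CN: "C - N = B - N" by (auto simp: C_def)
  have "emeasure (completion M) C = emeasure (completion M) (C - N)"
    by (rule emeasure_Diff_null_set[OF B(3) CS, symmetric])
  also have "\<dots> = emeasure (completion M) B"
    unfolding CN by (rule emeasure_Diff_null_set[OF B(3) B(1)])
  finally have eqC: "emeasure (completion M) C = emeasure (completion M) A" using eq by simp
  obtain N1 where N1: "N1 \<in> null_sets M" "N \<subseteq> N1" using B(3) by (auto simp: null_sets_completion_iff2)
  obtain S N0 where S: "finite S" "S \<subseteq> carrier G" and N0: "N0 \<in> null_sets M"
    and match: "\<And>N. \<lbrakk>N0 \<subseteq> N; N \<in> sets borel; \<And>g. g \<in> S \<Longrightarrow> \<phi> g ` N = N\<rbrakk> \<Longrightarrow>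
      \<exists>l. perfect_matching \<phi> S (sets borel) (C - N) (A - N) l"
    using measure_matching[OF expanding CS Ccov covers_union(1)[OF parad two Ccov A(2)]
        A covers_union(2)[OF parad two Ccov A(2)] eqC] by metis
  obtain N2 where N2: "N2 \<in> null_sets M" "N0 \<union> N1 \<subseteq> N2" "\<And>g. g \<in> S \<Longrightarrow> \<phi> g ` N2 = N2"
    using null_invariant_hull[OF S null_sets.Un[OF N0 N1(1)]] by metis
  have N2b: "N2 \<in> sets borel" using N2(1) by (auto simp: null_sets_def sets_M)
  have "N0 \<subseteq> N2" using N2(2) by blast
  from match[OF this N2b N2(3)] obtain l where l: "perfect_matching \<phi> S (sets borel) (C - N2) (A - N2) l"
    by blast
  have "C - N2 = B - N2" using N1(2) N2(2) by (auto simp: C_def)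
  then have "borel_equidecomposable G \<phi> (B - N2) (A - N2)"
    using equidecomposable_if_perfect_matching[OF l S] by (simp add: borel_equidecomposable_def)
  then show ?thesis
    unfolding ess_borel_equidecomposable_def using A(1) B(1) null_sets_completionI[OF N2(1)] by blast
qed

text \<open>
  The set \<open>B - N\<close> may fail to cover an open set, but it does so after the null set \<open>A \<inter> N'\<close> is added.
\<close>

lemma essentially_equidecomposable_converse:
  assumes parad: "paradoxical_action G \<phi>" and A: "A \<in> relcompact_covering G \<phi>"
    and ess: "ess_borel_equidecomposable G \<phi> M B A"
  shows "B \<in> sets (completion M)" "emeasure (completion M) B = emeasure (completion M) A"
    "\<exists>N \<in> null_sets (completion M). sym_diff B N \<in> relcompact_covering G \<phi>"
proof -
  obtain N N' where AS: "A \<in> sets (completion M)" and BS: "B \<in> sets (completion M)"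
    and N: "N \<in> null_sets (completion M)" "N' \<in> null_sets (completion M)"
    and eq: "equidecomposable G \<phi> (sets borel) (B - N) (A - N')"
    using ess unfolding ess_borel_equidecomposable_def borel_equidecomposable_def by blast
  show "B \<in> sets (completion M)" by (rule BS)
  have "sets borel \<subseteq> sets (completion M)" using sets_M by auto
  from equidecomposable_measure[OF eq this]
  show "emeasure (completion M) B = emeasure (completion M) A"
    unfolding emeasure_Diff_null_set[OF N(1) BS] emeasure_Diff_null_set[OF N(2) AS] .
  obtain T where T: "finite T" "T \<subseteq> carrier G" "A - N' \<subseteq> translates \<phi> T (B - N)"
    "B - N \<subseteq> translates \<phi> ((\<lambda>t. inv t) ` T) (A - N')" by (rule equidecomposable_covers[OF eq])
  define E where "E = (B - N) \<union> (A \<inter> N')"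
  have "translates \<phi> ((\<lambda>t. inv t) ` T) (A - N') \<subseteq> translates \<phi> ((\<lambda>t. inv t) ` T) A"
    by (rule translates_mono) blast
  then have BN: "B - N \<subseteq> translates \<phi> ((\<lambda>t. inv t) ` T) A" using T(4) by (rule subset_trans[rotated])
  have "compact (closure (B - N))"
  proof (rule relcompact_translates[OF parad _ _ _ BN])
    show "compact (closure A)" using A by (simp add: relcompact_covering_def)
    show "finite ((\<lambda>t. inv t) ` T)" "(\<lambda>t. inv t) ` T \<subseteq> carrier G" using T(1,2) by auto
  qed
  moreover have "compact (closure (A \<inter> N'))"
    by (rule compact_closure_subset[of A]) (use A in \<open>auto simp: relcompact_covering_def\<close>)
  ultimately have cE: "compact (closure E)" by (simp add: E_def compact_Un)
  have "A \<subseteq> translates \<phi> (insert \<one> T) E"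
  proof
    fix x assume x: "x \<in> A"
    show "x \<in> translates \<phi> (insert \<one> T) E"
    proof (cases "x \<in> N'")
      case True
      then have "\<phi> \<one> x \<in> \<phi> \<one> ` E" using x by (intro imageI) (simp add: E_def)
      then show ?thesis by (auto simp: translates_def)
    next
      case False
      then have "x \<in> translates \<phi> T (B - N)" using x T(3) by blast
      then show ?thesis by (auto simp: translates_def E_def)
    qed
  qed
  moreover have "finite (insert \<one> T)" "insert \<one> T \<subseteq> carrier G" using T(1,2) by simp_all
  ultimately have EA: "covers G \<phi> E A" unfolding covers_def by (intro exI[of _ "insert \<one> T"] conjI)
  obtain U where U: "open U" "U \<noteq> {}" "covers G \<phi> A U" using A unfolding relcompact_covering_def by blast
  have "E \<in> relcompact_covering G \<phi>"
    unfolding relcompact_covering_def using cE U(1,2) covers_trans[OF EA U(3)] by blast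
  moreover have "sym_diff B (sym_diff B E) = E" by blast
  moreover have "sym_diff B E \<in> null_sets (completion M)"
  proof (rule null_sets_completion_subset)
    show "sym_diff B E \<subseteq> N \<union> N'" by (auto simp: E_def)
    show "N \<union> N' \<in> null_sets (completion M)" using N by (rule null_sets.Un)
  qed
  ultimately show "\<exists>N \<in> null_sets (completion M). sym_diff B N \<in> relcompact_covering G \<phi>" by metis
qed

text \<open>
  Off an invariant null set the Borel matching is used, on the null set every piece is measurable.
\<close>

lemma measurably_equidecomposable:
  assumes parad: "paradoxical_action G \<phi>" and expanding: "expanding_action G \<phi> M" and two: "p \<noteq> (q :: 'a)"
    and A: "A \<in> sets (completion M)" "A \<in> relcompact_covering G \<phi>"
    and B: "B \<in> sets (completion M)" "B \<in> relcompact_covering G \<phi>"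
    and eq: "emeasure (completion M) B = emeasure (completion M) A"
  shows "measurably_equidecomposable G \<phi> M B A"
proof -
  obtain S N0 where S: "finite S" "S \<subseteq> carrier G" and N0: "N0 \<in> null_sets M"
    and match: "\<And>N. \<lbrakk>N0 \<subseteq> N; N \<in> sets borel; \<And>g. g \<in> S \<Longrightarrow> \<phi> g ` N = N\<rbrakk> \<Longrightarrow>
      \<exists>l. perfect_matching \<phi> S (sets borel) (B - N) (A - N) l"
    using measure_matching[OF expanding B covers_union(1)[OF parad two B(2) A(2)]
        A covers_union(2)[OF parad two B(2) A(2)] eq] by metis
  obtain K k where K: "finite K" "K \<subseteq> carrier G" and k: "perfect_matching \<phi> K UNIV B A k"
    by (rule relcompact_covering_matching[OF parad two B(2) A(2)])
  have L: "finite (S \<union> K)" "S \<union> K \<subseteq> carrier G" using S K by auto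
  obtain N where N: "N \<in> null_sets M" "N0 \<subseteq> N" "\<And>g. g \<in> S \<union> K \<Longrightarrow> \<phi> g ` N = N"
    using null_invariant_hull[OF L N0] by metis
  have Nb: "N \<in> sets borel" using N(1) by (auto simp: null_sets_def sets_M)
  obtain l where l: "perfect_matching \<phi> S (sets borel) (B - N) (A - N) l"
    using match[OF N(2) Nb] N(3) by auto
  have "perfect_matching \<phi> K (sets (completion M)) (B \<inter> N) (A \<inter> N) (k |` N)"
  proof (rule perfect_matching_restrict[OF k K(2)])
    show "\<phi> g ` N = N" if "g \<in> K" for g using that N(3) by simp
    fix s
    have "{x. k x = Some s} \<inter> N \<in> null_sets (completion M)"
      by (rule null_sets_completion_subset[OF _ null_sets_completionI[OF N(1)]]) blast
    then show "{x. k x = Some s} \<inter> N \<in> sets (completion M)" by auto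
  qed
  then have k': "perfect_matching \<phi> (S \<union> K) (sets (completion M)) (B \<inter> N) (A \<inter> N) (k |` N)"
    by (rule perfect_matching_weaken) auto
  have l': "perfect_matching \<phi> (S \<union> K) (sets (completion M)) (B - N) (A - N) l"
    by (rule perfect_matching_weaken[OF l]) (auto simp: sets_M)
  have "perfect_matching \<phi> (S \<union> K) (sets (completion M)) ((B - N) \<union> (B \<inter> N)) ((A - N) \<union> (A \<inter> N)) (l ++ (k |` N))"
    by (rule perfect_matching_Un[OF l' k']) auto
  then have "equidecomposable G \<phi> (sets (completion M)) ((B - N) \<union> (B \<inter> N)) ((A - N) \<union> (A \<inter> N))"
    using L by (rule equidecomposable_if_perfect_matching)
  then show ?thesis by (simp add: measurably_equidecomposable_def Un_Diff_Int)
qed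

text \<open>
  The invariant null set \<open>N\<close> is split by an invariant meager set \<open>Z\<close>. The matching off \<open>Z\<close> has Borel pieces,
  so it can be used on \<open>N - Z\<close>, and all subsets of \<open>N \<inter> Z\<close> are both null and meager.
\<close>

lemma baire_lebesgue_equidecomposable:
  assumes parad: "paradoxical_action G \<phi>" and expanding: "expanding_action G \<phi> M" and two: "p \<noteq> (q :: 'a)"
    and mg: "\<And>g S :: 'a set. g \<in> carrier G \<Longrightarrow> meager S \<Longrightarrow> meager (\<phi> g ` S)"
    and A: "A \<in> sets (completion M)" "A \<in> relcompact_covering G \<phi>" "A \<in> baire_property_sets"
    and B: "B \<in> sets (completion M)" "B \<in> relcompact_covering G \<phi>" "B \<in> baire_property_sets"
    and eq: "emeasure (completion M) B = emeasure (completion M) A"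
  shows "baire_lebesgue_equidecomposable G \<phi> M B A"
proof -
  define \<A> where "\<A> = sets (completion M) \<inter> (baire_property_sets :: 'a set set)"
  have borelA: "sets borel \<subseteq> \<A>" using borel_subset_baire sets_M by (auto simp: \<A>_def)
  interpret BP: sigma_algebra UNIV "baire_property_sets :: 'a set set" by (rule sigma_algebra_baire)
  have unA: "X \<union> Y \<in> \<A>" if "X \<in> \<A>" "Y \<in> \<A>" for X Y using that by (auto simp: \<A>_def)
  obtain S N0 where S: "finite S" "S \<subseteq> carrier G" and N0: "N0 \<in> null_sets M"
    and match: "\<And>N. \<lbrakk>N0 \<subseteq> N; N \<in> sets borel; \<And>g. g \<in> S \<Longrightarrow> \<phi> g ` N = N\<rbrakk> \<Longrightarrow>
      \<exists>l. perfect_matching \<phi> S (sets borel) (B - N) (A - N) l"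
    using measure_matching[OF expanding B(1,2) covers_union(1)[OF parad two B(2) A(2)]
        A(1,2) covers_union(2)[OF parad two B(2) A(2)] eq] by metis
  obtain K k where K: "finite K" "K \<subseteq> carrier G" and k: "perfect_matching \<phi> K UNIV B A k"
    by (rule relcompact_covering_matching[OF parad two B(2) A(2)])
  obtain J Z0 where J: "finite J" "J \<subseteq> carrier G" and Z0: "Z0 \<in> sets borel" "meager Z0"
    and cat: "\<And>Z. \<lbrakk>Z0 \<subseteq> Z; Z \<in> sets borel; \<And>g. g \<in> J \<Longrightarrow> \<phi> g ` Z = Z\<rbrakk> \<Longrightarrow>
      \<exists>l. perfect_matching \<phi> J (sets borel) (B - Z) (A - Z) l"
    using baire_matching[OF parad two mg B(2,3) A(2,3)] by metis
  define L where "L = S \<union> K \<union> J"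
  have L: "finite L" "L \<subseteq> carrier G" using S K J by (auto simp: L_def)
  obtain N where N: "N \<in> null_sets M" "N0 \<subseteq> N" "\<And>g. g \<in> L \<Longrightarrow> \<phi> g ` N = N"
    using null_invariant_hull[OF L N0] by metis
  have Nb: "N \<in> sets borel" using N(1) by (auto simp: null_sets_def sets_M)
  define \<I> where "\<I> = {Z :: 'a set. Z \<in> sets borel \<and> meager Z}"
  have ZI: "Z0 \<in> \<I>" using Z0 by (simp add: \<I>_def)
  have unI: "\<Union>\<Z> \<in> \<I>" if "countable \<Z>" "\<Z> \<subseteq> \<I>" for \<Z>
    using that meager_Union[of \<Z>] unfolding \<I>_def by (auto intro!: sets.countable_Union)
  have actI: "\<phi> g ` Z \<in> \<I>" if "g \<in> carrier G" "Z \<in> \<I>" for g Z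
    using that mg act_image by (auto simp: \<I>_def)
  obtain Z where Z: "Z \<in> \<I>" "Z0 \<subseteq> Z" "\<And>g. g \<in> L \<Longrightarrow> \<phi> g ` Z = Z"
    using invariant_hull[OF L ZI unI actI] by metis
  have Zb: "Z \<in> sets borel" "meager Z" using Z(1) by (auto simp: \<I>_def)
  obtain l where l: "perfect_matching \<phi> S (sets borel) (B - N) (A - N) l"
    using match[OF N(2) Nb] N(3) by (auto simp: L_def)
  obtain j where j: "perfect_matching \<phi> J (sets borel) (B - Z) (A - Z) j"
    using cat[OF Z(2) Zb(1)] Z(3) by (auto simp: L_def)
  have l': "perfect_matching \<phi> L \<A> (B - N) (A - N) l"
    by (rule perfect_matching_weaken[OF l _ borelA]) (auto simp: L_def)
  have "perfect_matching \<phi> J (sets borel) ((B - Z) \<inter> N) ((A - Z) \<inter> N) (j |` N)"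
  proof (rule perfect_matching_restrict[OF j J(2)])
    show "\<phi> g ` N = N" if "g \<in> J" for g using that N(3) by (simp add: L_def)
    show "{x. j x = Some s} \<inter> N \<in> sets borel" for s
      using matchingD(5)[OF perfect_matchingD(1)[OF j]] Nb by (rule sets.Int)
  qed
  then have j': "perfect_matching \<phi> L \<A> ((B - Z) \<inter> N) ((A - Z) \<inter> N) (j |` N)"
    by (rule perfect_matching_weaken[OF _ _ borelA]) (auto simp: L_def)
  have "perfect_matching \<phi> K \<A> (B \<inter> (N \<inter> Z)) (A \<inter> (N \<inter> Z)) (k |` (N \<inter> Z))"
  proof (rule perfect_matching_restrict[OF k K(2)])
    show "\<phi> g ` (N \<inter> Z) = N \<inter> Z" if "g \<in> K" for g
    proof -
      have gL: "g \<in> L" using that by (simp add: L_def)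
      show ?thesis by (rule invariant_Int[OF subsetD[OF K(2) that] N(3)[OF gL] Z(3)[OF gL]])
    qed
    fix s
    let ?P = "{x. k x = Some s} \<inter> (N \<inter> Z)"
    have "?P \<in> null_sets (completion M)"
      by (rule null_sets_completion_subset[OF _ null_sets_completionI[OF N(1)]]) blast
    moreover have "meager ?P" by (rule meager_subset[OF Zb(2)]) blast
    then have "?P \<in> baire_property_sets"
      unfolding baire_property_sets_def by (intro CollectI exI[of _ "{}"]) simp
    ultimately show "?P \<in> \<A>" by (auto simp: \<A>_def)
  qed
  then have k': "perfect_matching \<phi> L \<A> (B \<inter> (N \<inter> Z)) (A \<inter> (N \<inter> Z)) (k |` (N \<inter> Z))"
    by (rule perfect_matching_weaken) (auto simp: L_def)
  have split: "C = ((C - N) \<union> ((C - Z) \<inter> N)) \<union> (C \<inter> (N \<inter> Z))" for C by blast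
  have u1: "perfect_matching \<phi> L \<A> ((B - N) \<union> ((B - Z) \<inter> N)) ((A - N) \<union> ((A - Z) \<inter> N)) (l ++ (j |` N))"
    by (rule perfect_matching_Un[OF l' j' _ _ unA]) auto
  have "perfect_matching \<phi> L \<A> (((B - N) \<union> ((B - Z) \<inter> N)) \<union> (B \<inter> (N \<inter> Z)))
      (((A - N) \<union> ((A - Z) \<inter> N)) \<union> (A \<inter> (N \<inter> Z))) ((l ++ (j |` N)) ++ (k |` (N \<inter> Z)))"
    by (rule perfect_matching_Un[OF u1 k' _ _ unA]) auto
  then have "equidecomposable G \<phi> \<A> B A"
    unfolding split[of A, symmetric] split[of B, symmetric]
    using L by (rule equidecomposable_if_perfect_matching)
  then show ?thesis by (simp add: baire_lebesgue_equidecomposable_def \<A>_def)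
qed

lemma sigma_algebra_completion_UNIV: "sigma_algebra UNIV (sets (completion M))"
proof -
  have "space M = UNIV" using sets_eq_imp_space_eq[OF sets_M] by simp
  then show ?thesis using sets.sigma_algebra_axioms[of "completion M"] by simp
qed

end

theorem corollary1p10:
  fixes G :: "('g, 'm) monoid_scheme"
    and \<phi> :: "'g \<Rightarrow> 'a::polish_space \<Rightarrow> 'a"
    and M :: "'a measure"
    and A :: "'a set"
  assumes "invariant_borel_action G \<phi> M"
    and "paradoxical_action G \<phi>"
    and "expanding_action G \<phi> M"
    and "A \<in> sets (completion M) \<inter> relcompact_covering G \<phi>"
  shows
    "(\<forall>B. ess_borel_equidecomposable G \<phi> M B A \<longleftrightarrow>
        B \<in> sets (completion M) \<and> emeasure (completion M) B = emeasure (completion M) A \<and>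
        (\<exists>N \<in> null_sets (completion M). sym_diff B N \<in> relcompact_covering G \<phi>)) \<and>
     (\<forall>B. measurably_equidecomposable G \<phi> M B A \<longleftrightarrow>
        B \<in> sets (completion M) \<inter> relcompact_covering G \<phi> \<and>
        emeasure (completion M) B = emeasure (completion M) A) \<and>
     (A \<in> baire_property_sets \<and>
        (\<forall>g \<in> carrier G. \<forall>S :: 'a set. meager S \<longrightarrow> meager (\<phi> g ` S)) \<longrightarrow>
      (\<forall>B. baire_lebesgue_equidecomposable G \<phi> M B A \<longleftrightarrow>
        B \<in> sets (completion M) \<inter> relcompact_covering G \<phi> \<inter> baire_property_sets \<and>
        emeasure (completion M) B = emeasure (completion M) A))"
proof -
  interpret invariant_borel_action G \<phi> M by fact
  note parad = assms(2) and expanding = assms(3)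
  have A: "A \<in> sets (completion M)" "A \<in> relcompact_covering G \<phi>" using assms(4) by auto
  have nonempty: "C \<noteq> {}" if "C \<in> relcompact_covering G \<phi>" for C :: "'a set"
    using that by (auto simp: relcompact_covering_def covers_def translates_def)
  \<comment> \<open>A space with one point has isolated points, but there all sets in question are equal.\<close>
  have one: "C = UNIV" if eq: "\<not> (\<exists>p q :: 'a. p \<noteq> q)" and C: "C \<noteq> {}" for C :: "'a set"
  proof -
    obtain c where "c \<in> C" using C by blast
    then have "x \<in> C" for x using eq by metis
    then show ?thesis by blast
  qed
  have i: "ess_borel_equidecomposable G \<phi> M B A"
    if B: "B \<in> sets (completion M)" "emeasure (completion M) B = emeasure (completion M) A"
      and N: "N \<in> null_sets (completion M)" "sym_diff B N \<in> relcompact_covering G \<phi>" for B N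
  proof (cases "\<exists>p q :: 'a. p \<noteq> q")
    case True
    then show ?thesis using essentially_equidecomposable[OF parad expanding _ A B(1) N(2,1) B(2)] by blast
  next
    case eq: False
    have "A = UNIV" by (rule one[OF eq nonempty[OF A(2)]])
    have "B \<noteq> {}"
    proof
      assume "B = {}"
      then have "N \<noteq> {}" using nonempty[OF N(2)] by simp
      then have "N = UNIV" by (rule one[OF eq])
      then have "emeasure (completion M) UNIV = 0" using N(1) by (auto simp: null_sets_def)
      then have "emeasure M UNIV = 0" by (simp add: sets_M)
      then show False using nonzero_open[of UNIV] by simp
    qed
    then have "B = UNIV" by (rule one[OF eq])
    have "borel_equidecomposable G \<phi> (UNIV - {}) (UNIV - {})"
      using equidecomposable_UNIV[of "sets borel"] by (simp add: borel_equidecomposable_def)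
    then show ?thesis
      unfolding ess_borel_equidecomposable_def using A(1) B(1) \<open>A = UNIV\<close> \<open>B = UNIV\<close> by blast
  qed
  have ii: "measurably_equidecomposable G \<phi> M B A"
    if B: "B \<in> sets (completion M)" "B \<in> relcompact_covering G \<phi>"
      "emeasure (completion M) B = emeasure (completion M) A" for B
  proof (cases "\<exists>p q :: 'a. p \<noteq> q")
    case True
    then show ?thesis using measurably_equidecomposable[OF parad expanding _ A B] by blast
  next
    case eq: False
    have "A = UNIV" "B = UNIV" using one[OF eq nonempty[OF A(2)]] one[OF eq nonempty[OF B(2)]] by auto
    then show ?thesis
      using equidecomposable_UNIV[of "sets (completion M)"] A(1) by (simp add: measurably_equidecomposable_def)
  qed
  have iii: "baire_lebesgue_equidecomposable G \<phi> M B A"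
    if mg: "\<And>g S :: 'a set. g \<in> carrier G \<Longrightarrow> meager S \<Longrightarrow> meager (\<phi> g ` S)" and bA: "A \<in> baire_property_sets"
      and B: "B \<in> sets (completion M)" "B \<in> relcompact_covering G \<phi>" "B \<in> baire_property_sets"
      "emeasure (completion M) B = emeasure (completion M) A" for B
  proof (cases "\<exists>p q :: 'a. p \<noteq> q")
    case True
    then show ?thesis using baire_lebesgue_equidecomposable[OF parad expanding _ mg A bA B] by blast
  next
    case eq: False
    have "A = UNIV" "B = UNIV" using one[OF eq nonempty[OF A(2)]] one[OF eq nonempty[OF B(2)]] by auto
    moreover have "UNIV \<in> sets (completion M) \<inter> (baire_property_sets :: 'a set set)"
      using A(1) bA \<open>A = UNIV\<close> by simp
    moreover have "{} \<in> sets (completion M) \<inter> (baire_property_sets :: 'a set set)"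
      using borel_subset_baire by auto
    ultimately show ?thesis
      unfolding baire_lebesgue_equidecomposable_def using equidecomposable_UNIV by simp
  qed
  have ii': "B \<in> sets (completion M) \<and> B \<in> relcompact_covering G \<phi> \<and>
      emeasure (completion M) B = emeasure (completion M) A"
    if "measurably_equidecomposable G \<phi> M B A" for B
    using that equidecomposable_in[OF _ sigma_algebra_completion_UNIV]
      equidecomposable_relcompact_covering[OF parad A(2)] equidecomposable_measure
    unfolding measurably_equidecomposable_def by blast
  have iii': "B \<in> sets (completion M) \<and> B \<in> relcompact_covering G \<phi> \<and> B \<in> baire_property_sets \<and>
      emeasure (completion M) B = emeasure (completion M) A"
    if eq: "baire_lebesgue_equidecomposable G \<phi> M B A" for B
  proof -
    note eq = eq[unfolded baire_lebesgue_equidecomposable_def]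
    have "equidecomposable G \<phi> (sets (completion M)) B A" "equidecomposable G \<phi> baire_property_sets B A"
      using eq unfolding equidecomposable_def by blast+
    then show ?thesis
      using equidecomposable_in[OF _ sigma_algebra_completion_UNIV] equidecomposable_in[OF _ sigma_algebra_baire]
        equidecomposable_relcompact_covering[OF parad A(2)] equidecomposable_measure by blast
  qed
  show ?thesis
  proof (intro conjI allI impI iffI)
    fix B assume ess: "ess_borel_equidecomposable G \<phi> M B A"
    note conv = essentially_equidecomposable_converse[OF parad A(2) ess]
    show "B \<in> sets (completion M)" by (rule conv(1))
    show "emeasure (completion M) B = emeasure (completion M) A" by (rule conv(2))
    show "\<exists>N \<in> null_sets (completion M). sym_diff B N \<in> relcompact_covering G \<phi>" by (rule conv(3))
  next
    fix B assume B: "B \<in> sets (completion M) \<and> emeasure (completion M) B = emeasure (completion M) A \<and>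
        (\<exists>N \<in> null_sets (completion M). sym_diff B N \<in> relcompact_covering G \<phi>)"
    then obtain N where N: "N \<in> null_sets (completion M)" "sym_diff B N \<in> relcompact_covering G \<phi>" by (elim conjE bexE)
    show "ess_borel_equidecomposable G \<phi> M B A" by (rule i[OF _ _ N]) (simp_all only: B)
  next
    fix B assume "measurably_equidecomposable G \<phi> M B A"
    note conv = ii'[OF this]
    show "B \<in> sets (completion M) \<inter> relcompact_covering G \<phi>" using conv by (intro IntI) simp_all
    show "emeasure (completion M) B = emeasure (completion M) A" using conv by (elim conjE)
  next
    fix B assume "B \<in> sets (completion M) \<inter> relcompact_covering G \<phi> \<and>
        emeasure (completion M) B = emeasure (completion M) A"
    then show "measurably_equidecomposable G \<phi> M B A" by (elim conjE IntE) (rule ii)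
  next
    fix B assume "baire_lebesgue_equidecomposable G \<phi> M B A"
    note conv = iii'[OF this]
    show "B \<in> sets (completion M) \<inter> relcompact_covering G \<phi> \<inter> baire_property_sets"
      using conv by (intro IntI) simp_all
    show "emeasure (completion M) B = emeasure (completion M) A" using conv by (elim conjE)
  next
    fix B assume hyp: "A \<in> baire_property_sets \<and>
        (\<forall>g \<in> carrier G. \<forall>S :: 'a set. meager S \<longrightarrow> meager (\<phi> g ` S))"
      and B: "B \<in> sets (completion M) \<inter> relcompact_covering G \<phi> \<inter> baire_property_sets \<and>
        emeasure (completion M) B = emeasure (completion M) A"
    from B have "B \<in> sets (completion M)" "B \<in> relcompact_covering G \<phi>" "B \<in> baire_property_sets"
      "emeasure (completion M) B = emeasure (completion M) A" by auto
    moreover have "A \<in> baire_property_sets" using hyp by (rule conjunct1)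
    moreover have "\<And>g S :: 'a set. g \<in> carrier G \<Longrightarrow> meager S \<Longrightarrow> meager (\<phi> g ` S)" using hyp by simp
    ultimately show "baire_lebesgue_equidecomposable G \<phi> M B A" by (intro iii)
  qed
qed

end
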